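(* Let $k$ be an algebraically closed field, let $\alpha,\beta,\gamma$ be partitions, and let $\Gamma,\widetilde\Gamma$ be LR-tableaux of shape $(\alpha,\beta,\gamma)$. (a) If $\Gamma\leq_{\sf boundary}\widetilde\Gamma$, then $\Gamma\leq_{\sf dom}\widetilde\Gamma$. (b) Suppose $\beta\setminus\gamma$ is a horizontal strip. If $\Gamma\leq_{\sf box}\widetilde\Gamma$, then $\Gamma\leq_{\sf boundary}\widetilde\Gamma$.
   Context: Partitions and tableaux. A partition $\alpha=(\alpha_1,\dots,\alpha_s)$ is a finite non-increasing sequence of natural numbers (padded by zeros if needed), drawn as a Young diagram whose columns have lengths $\alpha_1,\dots,\alpha_s$; its transpose is $\alpha'_j=\#\{i:\alpha_i\ge j\}$. Natural partial order: $\alpha\leq_{\sf nat}\widetilde\alpha$ if $\alpha'_1+\dots+\alpha'_j\le\widetilde\alpha'_1+\dots+\widetilde\alpha'_j$ for each $j$. An LR-tableau of shape $(\alpha,\beta,\gamma)$ is a Young diagram of shape $\beta$ in which the region $\beta\setminus\gamma$ is filled with $\alpha'_1$ entries $1$, ..., $\alpha'_t$ entries $t$ (where $t=\alpha_1$), such that entries weakly increase along each row (left to right), strictly increase down each column, and for each $\ell>1$ and each column $c$, to the right of $c$ the number of entries $\ell-1$ is at least the number of entries $\ell$. It is encoded as a sequence of partitions $\Gamma=[\gamma^{(0)},\dots,\gamma^{(t)}]$, where $\gamma^{(i)}$ is the region of $\beta$ consisting of the empty boxes and the boxes with entries $\le i$; so $\gamma^{(0)}=\gamma$, $\gamma^{(t)}=\beta$.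 $\mathcal T_{\alpha,\gamma}^\beta$ is the set of LR-tableaux of shape $(\alpha,\beta,\gamma)$. $\beta\setminus\gamma$ is a horizontal strip if $\beta_i\le\gamma_i+1$ for all $i$ (so each column contains at most one entry). Combinatorial orders on $\mathcal T_{\alpha,\gamma}^\beta$. $\Gamma\leq_{\sf dom}\widetilde\Gamma$ if $\gamma^{(i)}\leq_{\sf nat}\widetilde\gamma^{(i)}$ for each $i$. If $\beta\setminus\gamma$ is a horizontal strip: the LR-tableau $\widetilde\Gamma$ is obtained from the LR-tableau $\Gamma$ by a box move if two entries of $\Gamma$ are exchanged in such a way that afterwards the smaller entry is in the higher position (nearer the top row), and $\widetilde\Gamma$ results from this by re-sorting the list of columns if necessary (so that rows become weakly increasing); $\leq_{\sf box}$ is the partial order generated by box moves, where $\Gamma\leq_{\sf box}\widetilde\Gamma$ if $\widetilde\Gamma$ is obtained from $\Gamma$ by a (possibly empty) sequence of box moves between LR-tableaux of shape $(\alpha,\beta,\gamma)$. Varieties. For a partition $\alpha$, $N_\alpha=\bigoplus_i k[T]/(T^{\alpha_i})$. $\mathbb V_{\alpha,\gamma}^\beta$ is the set of monomorphisms of $k[T]$-modules $f:N_\alpha\to N_\beta$ with cokernel isomorphic to $N_\gamma$, as a subset of the affine space $\mathrm{Hom}_k(N_\alpha,N_\beta)$ with the topology induced from the Zariski topology. The LR-tableau of $f\in\mathbb V_{\alpha,\gamma}^\beta$ is $[\gamma^{(0)},\dots,\gamma^{(t)}]$ with $t=\alpha_1$ and $N_\beta/f(T^iN_\alpha)\cong N_{\gamma^{(i)}}$;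 it is an LR-tableau of shape $(\alpha,\beta,\gamma)$. $\mathbb V_\Gamma$ is the set of $f\in\mathbb V_{\alpha,\gamma}^\beta$ with LR-tableau $\Gamma$, and $\overline{\mathbb V}_\Gamma$ is its closure in $\mathbb V_{\alpha,\gamma}^\beta$. $\leq_{\sf boundary}$ is the transitive closure of the relation on $\mathcal T_{\alpha,\gamma}^\beta$ given by $\Gamma\preceq_{\sf boundary}\widetilde\Gamma:\Leftrightarrow\mathbb V_{\widetilde\Gamma}\cap\overline{\mathbb V}_\Gamma\ne\emptyset$. *)

theory Defs
  imports
    "HOL-Analysis.Abstract_Topology"
    "HOL-Library.FuncSet"
    "HOL-Computational_Algebra.Polynomial"
    "HOL-Algebra.Module"
    "HOL-Algebra.AbelCoset"
    "HOL-Algebra.Algebraic_Closure_Type"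
begin

section \<open>Partitions and LR-tableaux\<close>

text \<open>
  A partition is a non-increasing sequence of natural numbers, padded by zeros; as parts are
  indexed from 0, the part usually written \<open>\<alpha>\<^sub>1\<close> is \<open>\<alpha> 0\<close>.
\<close>

definition is_partition :: "(nat \<Rightarrow> nat) \<Rightarrow> bool" where
  "is_partition \<alpha> \<longleftrightarrow> antimono \<alpha> \<and> finite {i. \<alpha> i \<noteq> 0}"

text \<open>Only meaningful for \<open>j \<ge> 1\<close> (for \<open>j = 0\<close> the set is infinite).\<close>

definition conj_part :: "(nat \<Rightarrow> nat) \<Rightarrow> nat \<Rightarrow> nat" where
  "conj_part \<alpha> j = card {i. \<alpha> i \<ge> j}"

definition le_nat :: "(nat \<Rightarrow> nat) \<Rightarrow> (nat \<Rightarrow> nat) \<Rightarrow> bool" where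
  "le_nat \<alpha> \<alpha>' \<longleftrightarrow> (\<forall>j. (\<Sum>l=1..j. conj_part \<alpha> l) \<le> (\<Sum>l=1..j. conj_part \<alpha>' l))"

text \<open>
  A box is a pair (row, column), both counted from 0, with rows numbered from top to bottom.
  Partitions give the lengths of the columns.
\<close>

definition skew :: "(nat \<Rightarrow> nat) \<Rightarrow> (nat \<Rightarrow> nat) \<Rightarrow> (nat \<times> nat) set" where
  "skew \<beta> \<gamma> = {(r, c). \<gamma> c \<le> r \<and> r < \<beta> c}"

text \<open>
  A tableau is the function sending each box of \<open>\<beta> \<setminus> \<gamma>\<close> to its entry.
  All other boxes, in particular the empty ones, get the value 0, which makes the function unique.
\<close>

definition LR_tableaux ::
    "(nat \<Rightarrow> nat) \<Rightarrow> (nat \<Rightarrow> nat) \<Rightarrow> (nat \<Rightarrow> nat) \<Rightarrow> (nat \<times> nat \<Rightarrow> nat) set" where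
  "LR_tableaux \<alpha> \<beta> \<gamma> = {\<Gamma>.
     (\<forall>c. \<gamma> c \<le> \<beta> c) \<and>
     (\<forall>b. b \<notin> skew \<beta> \<gamma> \<longrightarrow> \<Gamma> b = 0) \<and>
     (\<forall>b\<in>skew \<beta> \<gamma>. 1 \<le> \<Gamma> b \<and> \<Gamma> b \<le> \<alpha> 0) \<and>
     (\<forall>l\<in>{1..\<alpha> 0}. card {b \<in> skew \<beta> \<gamma>. \<Gamma> b = l} = conj_part \<alpha> l) \<and>
     (\<forall>r c c'. (r, c) \<in> skew \<beta> \<gamma> \<and> (r, c') \<in> skew \<beta> \<gamma> \<and> c \<le> c' \<longrightarrow> \<Gamma> (r, c) \<le> \<Gamma> (r, c')) \<and>
     (\<forall>r r' c. (r, c) \<in> skew \<beta> \<gamma> \<and> (r', c) \<in> skew \<beta> \<gamma> \<and> r < r' \<longrightarrow> \<Gamma> (r, c) < \<Gamma> (r', c)) \<and>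
     (\<forall>l>1. \<forall>c. card {(r, c'). (r, c') \<in> skew \<beta> \<gamma> \<and> c' > c \<and> \<Gamma> (r, c') = l}
                \<le> card {(r, c'). (r, c') \<in> skew \<beta> \<gamma> \<and> c' > c \<and> \<Gamma> (r, c') = l - 1})}"

text \<open>
  The partition \<open>\<gamma>\<^sup>(\<^sup>i\<^sup>)\<close> of the sequence encoding \<open>\<Gamma>\<close>:
  it consists of the empty boxes (whose value is 0) and those with entry at most \<open>i\<close>.
\<close>

definition layer :: "(nat \<Rightarrow> nat) \<Rightarrow> (nat \<times> nat \<Rightarrow> nat) \<Rightarrow> nat \<Rightarrow> nat \<Rightarrow> nat" where
  "layer \<beta> \<Gamma> i = (\<lambda>c. card {r. r < \<beta> c \<and> \<Gamma> (r, c) \<le> i})"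

definition le_dom ::
    "(nat \<Rightarrow> nat) \<Rightarrow> (nat \<Rightarrow> nat) \<Rightarrow> (nat \<times> nat \<Rightarrow> nat) \<Rightarrow> (nat \<times> nat \<Rightarrow> nat) \<Rightarrow> bool" where
  "le_dom \<alpha> \<beta> \<Gamma> \<Gamma>' \<longleftrightarrow> (\<forall>i\<le>\<alpha> 0. le_nat (layer \<beta> \<Gamma> i) (layer \<beta> \<Gamma>' i))"

definition horizontal_strip :: "(nat \<Rightarrow> nat) \<Rightarrow> (nat \<Rightarrow> nat) \<Rightarrow> bool" where
  "horizontal_strip \<beta> \<gamma> \<longleftrightarrow> (\<forall>i. \<beta> i \<le> \<gamma> i + 1)"

text \<open>
  In \<open>box_move\<close>, \<open>\<sigma>\<close> re-sorts the list of columns: column \<open>c\<close> of the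
  result is column \<open>\<sigma> c\<close> of the tableau with the two entries exchanged, including its length
  and its empty boxes.
\<close>

definition box_move ::
    "(nat \<Rightarrow> nat) \<Rightarrow> (nat \<Rightarrow> nat) \<Rightarrow> (nat \<Rightarrow> nat) \<Rightarrow>
     (nat \<times> nat \<Rightarrow> nat) \<Rightarrow> (nat \<times> nat \<Rightarrow> nat) \<Rightarrow> bool" where
  "box_move \<alpha> \<beta> \<gamma> \<Gamma> \<Gamma>' \<longleftrightarrow>
     \<Gamma> \<in> LR_tableaux \<alpha> \<beta> \<gamma> \<and> \<Gamma>' \<in> LR_tableaux \<alpha> \<beta> \<gamma> \<and>
     (\<exists>r\<^sub>1 c\<^sub>1 r\<^sub>2 c\<^sub>2 \<sigma>.
        (r\<^sub>1, c\<^sub>1) \<in> skew \<beta> \<gamma> \<and> (r\<^sub>2, c\<^sub>2) \<in> skew \<beta> \<gamma> \<and>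
        r\<^sub>1 < r\<^sub>2 \<and> \<Gamma> (r\<^sub>1, c\<^sub>1) > \<Gamma> (r\<^sub>2, c\<^sub>2) \<and>
        bij \<sigma> \<and> (\<forall>c. \<beta> (\<sigma> c) = \<beta> c \<and> \<gamma> (\<sigma> c) = \<gamma> c) \<and>
        (\<forall>r c. \<Gamma>' (r, c) =
           (\<Gamma>((r\<^sub>1, c\<^sub>1) := \<Gamma> (r\<^sub>2, c\<^sub>2), (r\<^sub>2, c\<^sub>2) := \<Gamma> (r\<^sub>1, c\<^sub>1))) (r, \<sigma> c)))"

definition le_box ::
    "(nat \<Rightarrow> nat) \<Rightarrow> (nat \<Rightarrow> nat) \<Rightarrow> (nat \<Rightarrow> nat) \<Rightarrow>
     (nat \<times> nat \<Rightarrow> nat) \<Rightarrow> (nat \<times> nat \<Rightarrow> nat) \<Rightarrow> bool" where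
  "le_box \<alpha> \<beta> \<gamma> = (box_move \<alpha> \<beta> \<gamma>)\<^sup>*\<^sup>*"


section \<open>Homomorphisms and quotients of modules\<close>

text \<open>
  Maps compatible with addition and with the scalars in \<open>S\<close>. They are extensional, so that
  they form the actual set of homomorphisms between the carriers.
\<close>

definition mod_hom ::
    "'r set \<Rightarrow> ('r, 'a, 'm) module_scheme \<Rightarrow> ('r, 'b, 'n) module_scheme \<Rightarrow> ('a \<Rightarrow> 'b) set" where
  "mod_hom S M N = {f \<in> carrier M \<rightarrow>\<^sub>E carrier N.
     (\<forall>x\<in>carrier M. \<forall>y\<in>carrier M. f (x \<oplus>\<^bsub>M\<^esub> y) = f x \<oplus>\<^bsub>N\<^esub> f y) \<and>
     (\<forall>a\<in>S. \<forall>x\<in>carrier M. f (a \<odot>\<^bsub>M\<^esub> x) = a \<odot>\<^bsub>N\<^esub> f x)}"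

definition mod_iso ::
    "'r set \<Rightarrow> ('r, 'a, 'm) module_scheme \<Rightarrow> ('r, 'b, 'n) module_scheme \<Rightarrow> bool" where
  "mod_iso S M N \<longleftrightarrow> (\<exists>f\<in>mod_hom S M N. bij_betw f (carrier M) (carrier N))"

text \<open>
  Module records extend ring records; the multiplicative fields of the modules below are
  irrelevant and left unspecified.
\<close>

definition quot_module :: "('r, 'a, 'm) module_scheme \<Rightarrow> 'a set \<Rightarrow> ('r, 'a set) module" where
  "quot_module M H =
     \<lparr>carrier = a_rcosets\<^bsub>M\<^esub> H, monoid.mult = undefined, one = undefined,
      ring.zero = H, add = set_add M,
      module.smult = (\<lambda>a A. \<Union>x\<in>A. H +>\<^bsub>M\<^esub> (a \<odot>\<^bsub>M\<^esub> x))\<rparr>"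


section \<open>Zariski topology\<close>

inductive_set poly_funs :: "('x \<Rightarrow> 'k::comm_ring_1) set \<Rightarrow> ('x \<Rightarrow> 'k) set"
  for C :: "('x \<Rightarrow> 'k) set" where
  const: "(\<lambda>_. a) \<in> poly_funs C"
| coord: "c \<in> C \<Longrightarrow> c \<in> poly_funs C"
| add: "p \<in> poly_funs C \<Longrightarrow> q \<in> poly_funs C \<Longrightarrow> (\<lambda>x. p x + q x) \<in> poly_funs C"
| mult: "p \<in> poly_funs C \<Longrightarrow> q \<in> poly_funs C \<Longrightarrow> (\<lambda>x. p x * q x) \<in> poly_funs C"

definition zero_locus :: "'x set \<Rightarrow> ('x \<Rightarrow> 'k::zero) set \<Rightarrow> 'x set" where
  "zero_locus E P = {x \<in> E. \<forall>p\<in>P. p x = 0}"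

definition zariski_open :: "'x set \<Rightarrow> ('x \<Rightarrow> 'k::idom) set \<Rightarrow> 'x set \<Rightarrow> bool" where
  "zariski_open E C U \<longleftrightarrow> (\<exists>P\<subseteq>poly_funs C. U = E - zero_locus E P)"

lemma istopology_zariski: "istopology (zariski_open E C)"
  unfolding istopology_def
proof (intro conjI allI impI)
  fix S T assume "zariski_open E C S" "zariski_open E C T"
  then obtain P Q where P: "P \<subseteq> poly_funs C" "S = E - zero_locus E P"
    and Q: "Q \<subseteq> poly_funs C" "T = E - zero_locus E Q"
    unfolding zariski_open_def by blast
  let ?R = "{(\<lambda>x. p x * q x) |p q. p \<in> P \<and> q \<in> Q}"
  have "?R \<subseteq> poly_funs C" using P(1) Q(1) by (auto intro: poly_funs.mult)
  moreover have "S \<inter> T = E - zero_locus E ?R"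
    unfolding P(2) Q(2) zero_locus_def by fastforce
  ultimately show "zariski_open E C (S \<inter> T)" unfolding zariski_open_def by blast
next
  fix K assume "\<forall>U\<in>K. zariski_open E C U"
  then obtain P where P: "\<And>U. U \<in> K \<Longrightarrow> P U \<subseteq> poly_funs C \<and> U = E - zero_locus E (P U)"
    unfolding zariski_open_def by metis
  have "(\<Union>U\<in>K. P U) \<subseteq> poly_funs C" using P by blast
  moreover have "\<Union>K = E - zero_locus E (\<Union>U\<in>K. P U)"
  proof -
    have "\<Union>K = (\<Union>U\<in>K. E - zero_locus E (P U))" using P by blast
    also have "\<dots> = E - zero_locus E (\<Union>U\<in>K. P U)" unfolding zero_locus_def by auto
    finally show ?thesis .
  qed
  ultimately show "zariski_open E C (\<Union>K)" unfolding zariski_open_def by blast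
qed

definition zariski :: "'x set \<Rightarrow> ('x \<Rightarrow> 'k::idom) set \<Rightarrow> 'x topology" where
  "zariski E C = topology (zariski_open E C)"

lemma openin_zariski: "openin (zariski E C) U \<longleftrightarrow> zariski_open E C U"
  unfolding zariski_def by (simp add: istopology_zariski topology_inverse')

lemma topspace_zariski: "topspace (zariski E C) = E"
proof -
  have "zariski_open E C E"
    unfolding zariski_open_def zero_locus_def
    by (rule exI[of _ "{\<lambda>_. 1}"]) (auto intro: poly_funs.const)
  moreover have "U \<subseteq> E" if "zariski_open E C U" for U
    using that unfolding zariski_open_def by blast
  ultimately show ?thesis
    unfolding topspace_def openin_zariski by blast
qed


section \<open>The varieties of LR-tableaux\<close>

type_synonym 'k kT_elem = "nat \<Rightarrow> 'k poly"

text \<open>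
  \<open>k[T]\<close> is the type \<open>'k poly\<close>, with the ring structure
  \<open>ring_of_type_algebra\<close>. In the direct sum \<open>nil_mod \<alpha>\<close> of the
  \<open>k[T]/(T\<^sup>a)\<close> with \<open>a = \<alpha> i\<close>, a residue class is represented by its
  remainder modulo \<open>T\<^sup>a\<close>. If \<open>\<alpha> i = 0\<close>, then the component \<open>v i\<close> is
  0, so all elements have finite support.
\<close>

definition nil_mod :: "(nat \<Rightarrow> nat) \<Rightarrow> ('k::field poly, 'k kT_elem) module" where
  "nil_mod \<alpha> =
     \<lparr>carrier = {v. \<forall>i. v i mod monom 1 (\<alpha> i) = v i},
      monoid.mult = undefined, one = undefined,
      ring.zero = (\<lambda>_. 0), add = (\<lambda>v w i. v i + w i),
      module.smult = (\<lambda>p v i. (p * v i) mod monom 1 (\<alpha> i))\<rparr>"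

lemma module_nil_mod:
  "module (ring_of_type_algebra :: 'k::field poly ring) (nil_mod \<alpha>)"
proof (rule moduleI)
  show "cring (ring_of_type_algebra :: 'k poly ring)" by (rule cring_from_type_algebra)
  show "abelian_group (nil_mod \<alpha> :: ('k poly, 'k kT_elem) module)"
  proof (rule abelian_groupI)
    fix x :: "'k kT_elem" assume "x \<in> carrier (nil_mod \<alpha>)"
    then show "\<exists>y\<in>carrier (nil_mod \<alpha>). y \<oplus>\<^bsub>nil_mod \<alpha>\<^esub> x = \<zero>\<^bsub>nil_mod \<alpha>\<^esub>"
      by (intro bexI[of _ "\<lambda>i. - x i"]) (auto simp: nil_mod_def poly_mod_minus_left)
  qed (auto simp: nil_mod_def poly_mod_add_left add_ac)
qed (auto simp: nil_mod_def ring_of_type_algebra_def poly_mod_add_left algebra_simps mod_simps)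

definition kT_hom :: "(nat \<Rightarrow> nat) \<Rightarrow> (nat \<Rightarrow> nat) \<Rightarrow> ('k::field kT_elem \<Rightarrow> 'k kT_elem) set" where
  "kT_hom \<alpha> \<beta> = mod_hom (carrier ring_of_type_algebra) (nil_mod \<alpha>) (nil_mod \<beta>)"

text \<open>The \<open>k\<close>-linear maps; the elements of \<open>k\<close> are the constant polynomials.\<close>

definition k_hom :: "(nat \<Rightarrow> nat) \<Rightarrow> (nat \<Rightarrow> nat) \<Rightarrow> ('k::field kT_elem \<Rightarrow> 'k kT_elem) set" where
  "k_hom \<alpha> \<beta> = mod_hom (range (\<lambda>a. [:a:])) (nil_mod \<alpha>) (nil_mod \<beta>)"

text \<open>
  The basis vector \<open>T\<^sup>j\<close> of the \<open>i\<close>-th summand, and the entries of the matrix of a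
  \<open>k\<close>-linear map with respect to these bases.
\<close>

definition basis_vec :: "nat \<Rightarrow> nat \<Rightarrow> 'k::field kT_elem" where
  "basis_vec i j = (\<lambda>l. if l = i then monom 1 j else 0)"

definition hom_coords ::
    "(nat \<Rightarrow> nat) \<Rightarrow> (nat \<Rightarrow> nat) \<Rightarrow> (('k::field kT_elem \<Rightarrow> 'k kT_elem) \<Rightarrow> 'k) set" where
  "hom_coords \<alpha> \<beta> =
     {(\<lambda>f. coeff (f (basis_vec i j) l) m) |i j l m. j < \<alpha> i \<and> m < \<beta> l}"

definition V_shape ::
    "(nat \<Rightarrow> nat) \<Rightarrow> (nat \<Rightarrow> nat) \<Rightarrow> (nat \<Rightarrow> nat) \<Rightarrow> ('k::field kT_elem \<Rightarrow> 'k kT_elem) set" where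
  "V_shape \<alpha> \<beta> \<gamma> = {f \<in> kT_hom \<alpha> \<beta>.
     inj_on f (carrier (nil_mod \<alpha>)) \<and>
     mod_iso (carrier ring_of_type_algebra)
       (quot_module (nil_mod \<beta>) (f ` carrier (nil_mod \<alpha>))) (nil_mod \<gamma> :: ('k poly, _) module)}"

definition V_top ::
    "(nat \<Rightarrow> nat) \<Rightarrow> (nat \<Rightarrow> nat) \<Rightarrow> (nat \<Rightarrow> nat) \<Rightarrow> ('k::field kT_elem \<Rightarrow> 'k kT_elem) topology" where
  "V_top \<alpha> \<beta> \<gamma> = subtopology (zariski (k_hom \<alpha> \<beta>) (hom_coords \<alpha> \<beta>)) (V_shape \<alpha> \<beta> \<gamma>)"

definition T_power_image :: "nat \<Rightarrow> (nat \<Rightarrow> nat) \<Rightarrow> 'k::field kT_elem set" where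
  "T_power_image i \<alpha> = (\<lambda>x. monom 1 i \<odot>\<^bsub>nil_mod \<alpha>\<^esub> x) ` carrier (nil_mod \<alpha>)"

definition has_tableau ::
    "(nat \<Rightarrow> nat) \<Rightarrow> (nat \<Rightarrow> nat) \<Rightarrow> ('k::field kT_elem \<Rightarrow> 'k kT_elem) \<Rightarrow> (nat \<times> nat \<Rightarrow> nat) \<Rightarrow> bool"
  where
  "has_tableau \<alpha> \<beta> f \<Gamma> \<longleftrightarrow> (\<forall>i\<le>\<alpha> 0.
     mod_iso (carrier ring_of_type_algebra)
       (quot_module (nil_mod \<beta>) (f ` T_power_image i \<alpha>))
       (nil_mod (layer \<beta> \<Gamma> i) :: ('k poly, _) module))"

definition V_tab ::
    "(nat \<Rightarrow> nat) \<Rightarrow> (nat \<Rightarrow> nat) \<Rightarrow> (nat \<Rightarrow> nat) \<Rightarrow> (nat \<times> nat \<Rightarrow> nat) \<Rightarrow>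
     ('k::field kT_elem \<Rightarrow> 'k kT_elem) set" where
  "V_tab \<alpha> \<beta> \<gamma> \<Gamma> = {f \<in> V_shape \<alpha> \<beta> \<gamma>. has_tableau \<alpha> \<beta> f \<Gamma>}"

text \<open>The argument of type \<open>'k itself\<close> selects the ground field.\<close>

definition boundary_step ::
    "'k::field itself \<Rightarrow> (nat \<Rightarrow> nat) \<Rightarrow> (nat \<Rightarrow> nat) \<Rightarrow> (nat \<Rightarrow> nat) \<Rightarrow>
     (nat \<times> nat \<Rightarrow> nat) \<Rightarrow> (nat \<times> nat \<Rightarrow> nat) \<Rightarrow> bool" where
  "boundary_step k \<alpha> \<beta> \<gamma> \<Gamma> \<Gamma>' \<longleftrightarrow>
     \<Gamma> \<in> LR_tableaux \<alpha> \<beta> \<gamma> \<and> \<Gamma>' \<in> LR_tableaux \<alpha> \<beta> \<gamma> \<and>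
     (V_tab \<alpha> \<beta> \<gamma> \<Gamma>' :: ('k kT_elem \<Rightarrow> 'k kT_elem) set)
       \<inter> (V_top \<alpha> \<beta> \<gamma> closure_of V_tab \<alpha> \<beta> \<gamma> \<Gamma>) \<noteq> {}"

definition le_boundary ::
    "'k::field itself \<Rightarrow> (nat \<Rightarrow> nat) \<Rightarrow> (nat \<Rightarrow> nat) \<Rightarrow> (nat \<Rightarrow> nat) \<Rightarrow>
     (nat \<times> nat \<Rightarrow> nat) \<Rightarrow> (nat \<times> nat \<Rightarrow> nat) \<Rightarrow> bool" where
  "le_boundary k \<alpha> \<beta> \<gamma> = (boundary_step k \<alpha> \<beta> \<gamma>)\<^sup>+\<^sup>+"

end

(*
  (a) The module N_beta / f(T^i N_alpha) determines the codimension of f(T^i N_alpha) + T^j N_beta,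
  namely the sum of the first j parts of the conjugate of the i-th layer.  The rank of such a span is
  lower semicontinuous in f, so these codimensions can only grow when passing to the closure.

  (b) If beta \ gamma is a horizontal strip, the lattice condition allows the entries to be
  partitioned into chains 1, 2, ..., alpha_j along columns of strictly increasing length, and each
  chain gives a cyclic embedding ("pole").  For a box move the chains can be chosen so that exchanging
  the two entries gives chains again.  Adding s times one further matrix entry to the sum of poles
  of the second tableau yields a line of embeddings which, for s nonzero, all have the first tableau.
*)
theory Submission
  imports Defs "HOL-Library.Function_Algebras"
begin

section \<open>Submodules and quotients of nilpotent modules\<close>

text \<open>In (b) the tableau of a map is read off from a family spanning the filtration T^i
  N_alpha whose images are triangular: the image belonging to column c has its leading term at
  T^(beta_c - 1) in c and otherwise meets only longer columns, in multiples of that power. Such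
  images determine the quotients by all f(T^i N_alpha) at once: every column with entry above i
  loses one box. For a sum of poles the standard basis works. The extra matrix entry is the
  coefficient that the pole of the first tableau has in the column of the larger entry, the shorter
  of the two. For s nonzero it leads in that column, and one basis vector must be corrected by a
  multiple of another. The obstacle is combinatorial: chains chosen separately for the two tableaux
  need not be related by the exchange, so consecutive entries must be matched in a way that respects
  the column lengths both before and after it. The ground field is infinite, so a polynomial on the
  line that is nonzero at s = 0 is nonzero at some other s. The empty sequence of box moves also has
  to be a boundary relation, which requires a point in the variety of the tableau.\<close>

lemma coeff_mod_monom:
  fixes p :: "'k::field poly"
  shows "coeff (p mod monom 1 n) m = (if m < n then coeff p m else 0)"
proof -
  have nz: "monom 1 n \<noteq> (0::'k poly)" by (simp add: monom_eq_0_iff)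
  have dg: "p mod monom 1 n = 0 \<or> degree (p mod monom 1 n) < n"
    using degree_mod_less[OF nz, of p] by (simp add: degree_monom_eq)
  have "coeff p m = coeff (p div monom 1 n * monom 1 n + p mod monom 1 n) m"
    by (simp only: div_mult_mod_eq)
  also have "\<dots> = coeff (monom 1 n * (p div monom 1 n)) m + coeff (p mod monom 1 n) m"
    by (simp only: coeff_add mult.commute)
  finally show ?thesis using dg by (auto simp: coeff_monom_mult coeff_eq_0)
qed

lemma mod_monom_eq_self_iff:
  fixes p :: "'k::field poly"
  shows "p mod monom 1 n = p \<longleftrightarrow> (\<forall>m\<ge>n. coeff p m = 0)"
  by (auto simp: poly_eq_iff coeff_mod_monom)

lemma carrier_nil_mod:
  "v \<in> carrier (nil_mod \<alpha>) \<longleftrightarrow> (\<forall>i m. \<alpha> i \<le> m \<longrightarrow> coeff (v i) m = 0)"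
  by (auto simp: nil_mod_def mod_monom_eq_self_iff)

lemma add_nil_mod [simp]: "v \<oplus>\<^bsub>nil_mod \<alpha>\<^esub> w = v + w"
  by (simp add: nil_mod_def fun_eq_iff)

lemma zero_nil_mod [simp]: "\<zero>\<^bsub>nil_mod \<alpha>\<^esub> = 0"
  by (simp add: nil_mod_def fun_eq_iff)

lemma smult_nil_mod [simp]: "p \<odot>\<^bsub>nil_mod \<alpha>\<^esub> v = (\<lambda>i. (p * v i) mod monom 1 (\<alpha> i))"
  by (simp add: nil_mod_def)

lemma nil_mod_zero: "0 \<in> carrier (nil_mod \<alpha>)"
  by (simp add: carrier_nil_mod)

lemma nil_mod_add: "v \<in> carrier (nil_mod \<alpha>) \<Longrightarrow> w \<in> carrier (nil_mod \<alpha>) \<Longrightarrow> v + w \<in> carrier (nil_mod \<alpha>)"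
  by (simp add: carrier_nil_mod)

lemma nil_mod_diff: "v \<in> carrier (nil_mod \<alpha>) \<Longrightarrow> w \<in> carrier (nil_mod \<alpha>) \<Longrightarrow> v - w \<in> carrier (nil_mod \<alpha>)"
  by (simp add: carrier_nil_mod)

lemma nil_mod_reduce: "(\<lambda>i. p i mod monom 1 (\<alpha> i)) \<in> carrier (nil_mod \<alpha>)"
  by (simp add: carrier_nil_mod coeff_mod_monom)

lemma nil_mod_reduce_eq: "v \<in> carrier (nil_mod \<alpha>) \<Longrightarrow> v i mod monom 1 (\<alpha> i) = v i"
  by (simp add: carrier_nil_mod mod_monom_eq_self_iff)

text \<open>Scalars act on the whole type, so all carriers are subspaces of a single vector space
  and its dimension theory applies to each of them. \<open>const_smult_nil_mod\<close> identifies
  this action with that of the constant polynomials.\<close>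

definition kscale :: "'k::field \<Rightarrow> 'k kT_elem \<Rightarrow> 'k kT_elem" where
  "kscale a v = (\<lambda>i. smult a (v i))"

lemma kscale_apply [simp]: "kscale a v i = smult a (v i)"
  by (simp add: kscale_def)

interpretation kv: vector_space kscale
  by unfold_locales (auto simp: smult_add_right smult_add_left fun_eq_iff)

lemma const_smult_nil_mod:
  "v \<in> carrier (nil_mod \<alpha>) \<Longrightarrow> (\<lambda>i. ([:a:] * v i) mod monom 1 (\<alpha> i)) = kscale a v"
  by (auto simp: fun_eq_iff mod_monom_eq_self_iff carrier_nil_mod)

lemma subspace_nil_mod: "kv.subspace (carrier (nil_mod \<alpha>))"
  by (auto simp: kv.subspace_def carrier_nil_mod)

lemma carrier_type_algebra [simp]: "carrier ring_of_type_algebra = UNIV"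
  by (simp add: ring_of_type_algebra_def)

section \<open>Submodules, cosets and the isomorphism theorem\<close>

definition submod :: "(nat \<Rightarrow> nat) \<Rightarrow> 'k::field kT_elem set \<Rightarrow> bool" where
  "submod \<beta> H \<longleftrightarrow> H \<subseteq> carrier (nil_mod \<beta>) \<and> 0 \<in> H \<and> (\<forall>x\<in>H. \<forall>y\<in>H. x + y \<in> H) \<and>
     (\<forall>p. \<forall>x\<in>H. p \<odot>\<^bsub>nil_mod \<beta>\<^esub> x \<in> H)"

lemma submodD:
  assumes "submod \<beta> H"
  shows "x \<in> H \<Longrightarrow> x \<in> carrier (nil_mod \<beta>)" "0 \<in> H" "x \<in> H \<Longrightarrow> y \<in> H \<Longrightarrow> x + y \<in> H"
    "x \<in> H \<Longrightarrow> (\<lambda>i. (p * x i) mod monom 1 (\<beta> i)) \<in> H"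
    "x \<in> H \<Longrightarrow> kscale a x \<in> H" "x \<in> H \<Longrightarrow> - x \<in> H" "x \<in> H \<Longrightarrow> y \<in> H \<Longrightarrow> x - y \<in> H"
proof -
  show 1: "x \<in> H \<Longrightarrow> x \<in> carrier (nil_mod \<beta>)" "0 \<in> H" "\<And>x y. x \<in> H \<Longrightarrow> y \<in> H \<Longrightarrow> x + y \<in> H"
    "x \<in> H \<Longrightarrow> (\<lambda>i. (p * x i) mod monom 1 (\<beta> i)) \<in> H"
    using assms by (auto simp: submod_def)
  have 2: "kscale a x \<in> H" if x: "x \<in> H" for x a
  proof -
    have "(\<lambda>i. ([:a:] * x i) mod monom 1 (\<beta> i)) \<in> H"
      using assms x unfolding submod_def smult_nil_mod by blast
    moreover have "x \<in> carrier (nil_mod \<beta>)" using assms x unfolding submod_def by blast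
    ultimately show ?thesis using const_smult_nil_mod by metis
  qed
  then show "x \<in> H \<Longrightarrow> kscale a x \<in> H" .
  have 3: "- x = kscale (-1) x" for x :: "'a kT_elem" by (simp add: fun_eq_iff)
  show 4: "x \<in> H \<Longrightarrow> - x \<in> H" for x unfolding 3 by (rule 2)
  show "x \<in> H \<Longrightarrow> y \<in> H \<Longrightarrow> x - y \<in> H"
    using 1(3)[of x "- y"] 4[of y] by simp
qed

lemma submod_subspace: "submod \<beta> H \<Longrightarrow> kv.subspace H"
  by (auto simp: kv.subspace_def submodD)

lemma coset_nil_mod: "H +>\<^bsub>nil_mod \<beta>\<^esub> x = (\<lambda>h. h + x) ` H"
  by (auto simp: a_r_coset_def')

lemma coset_eq_iff:
  assumes "submod \<beta> H"
  shows "(\<lambda>h. h + x) ` H = (\<lambda>h. h + y) ` H \<longleftrightarrow> x - y \<in> H"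
proof
  assume "(\<lambda>h. h + x) ` H = (\<lambda>h. h + y) ` H"
  moreover have "x \<in> (\<lambda>h. h + x) ` H" using submodD(2)[OF assms] by force
  ultimately obtain h where "h \<in> H" "x = h + y" by blast
  then show "x - y \<in> H" by simp
next
  assume d: "x - y \<in> H"
  have "h + x \<in> (\<lambda>h. h + y) ` H" if "h \<in> H" for h
    using submodD(3)[OF assms that d] by (intro image_eqI[of _ _ "h + (x - y)"]) simp_all
  moreover have "h + y \<in> (\<lambda>h. h + x) ` H" if "h \<in> H" for h
    using submodD(7)[OF assms that d] by (intro image_eqI[of _ _ "h - (x - y)"]) simp_all
  ultimately show "(\<lambda>h. h + x) ` H = (\<lambda>h. h + y) ` H" by blast
qed

lemma coset_add:
  assumes "submod \<beta> H"
  shows "set_add (nil_mod \<beta>) ((\<lambda>h. h + x) ` H) ((\<lambda>h. h + y) ` H) = (\<lambda>h. h + (x + y)) ` H"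
proof -
  have "(h + x) + (h' + y) \<in> (\<lambda>h. h + (x + y)) ` H" if "h \<in> H" "h' \<in> H" for h h'
    using submodD(3)[OF assms that] by (intro image_eqI[of _ _ "h + h'"]) (simp_all add: add_ac)
  moreover have "\<exists>a\<in>H. \<exists>b\<in>H. h + (x + y) = (a + x) + (b + y)" if "h \<in> H" for h
    using submodD(2)[OF assms] that by (intro bexI[of _ h] bexI[of _ 0]) (simp_all add: add_ac)
  ultimately show ?thesis by (auto simp: set_add_def')
qed

text \<open>The union in \<open>quot_module\<close> runs over all representatives, but each of them
  contributes the same coset, because \<open>p\<close> times an element of \<open>H\<close> stays in
  \<open>H\<close>.\<close>

lemma coset_smult:
  assumes H: "submod \<beta> H" 
  shows "(\<Union>z\<in>(\<lambda>h. h + x) ` H. H +>\<^bsub>nil_mod \<beta>\<^esub> (p \<odot>\<^bsub>nil_mod \<beta>\<^esub> z)) = (\<lambda>h. h + (p \<odot>\<^bsub>nil_mod \<beta>\<^esub> x)) ` H"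
proof -
  have "H +>\<^bsub>nil_mod \<beta>\<^esub> (p \<odot>\<^bsub>nil_mod \<beta>\<^esub> (h + x)) = (\<lambda>h. h + (p \<odot>\<^bsub>nil_mod \<beta>\<^esub> x)) ` H" if "h \<in> H" for h
  proof -
    have "(p \<odot>\<^bsub>nil_mod \<beta>\<^esub> (h + x)) - (p \<odot>\<^bsub>nil_mod \<beta>\<^esub> x) = p \<odot>\<^bsub>nil_mod \<beta>\<^esub> h"
      by (auto simp: fun_eq_iff algebra_simps poly_mod_add_left)
    then have "(p \<odot>\<^bsub>nil_mod \<beta>\<^esub> (h + x)) - (p \<odot>\<^bsub>nil_mod \<beta>\<^esub> x) \<in> H"
      using submodD(4)[OF H that] by simp
    then show ?thesis
      using coset_eq_iff[OF H] by (simp add: coset_nil_mod)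
  qed
  moreover have "H \<noteq> {}" using submodD(2)[OF H] by blast
  ultimately show ?thesis by simp
qed

lemma carrier_quot: "carrier (quot_module (nil_mod \<beta>) H) = (\<lambda>x. (\<lambda>h. h + x) ` H) ` carrier (nil_mod \<beta>)"
  by (auto simp: quot_module_def A_RCOSETS_def' coset_nil_mod)

text \<open>First isomorphism theorem: \<open>\<phi>\<close> is constant on the cosets of its
  kernel. Together with the converse \<open>mod_iso_quotE\<close> it allows quotients to be handled
  through homomorphisms on the carrier, without cosets.\<close>

lemma mod_iso_quotI:
  fixes \<phi> :: "'k::field kT_elem \<Rightarrow> 'k kT_elem"
  assumes H: "submod \<beta> H" "H = {x \<in> carrier (nil_mod \<beta>). \<phi> x = 0}"
    and surj: "\<phi> ` carrier (nil_mod \<beta>) = carrier (nil_mod \<delta>)"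
    and add: "\<And>x y. x \<in> carrier (nil_mod \<beta>) \<Longrightarrow> y \<in> carrier (nil_mod \<beta>) \<Longrightarrow> \<phi> (x + y) = \<phi> x + \<phi> y"
    and sm: "\<And>p x. x \<in> carrier (nil_mod \<beta>) \<Longrightarrow> \<phi> (p \<odot>\<^bsub>nil_mod \<beta>\<^esub> x) = p \<odot>\<^bsub>nil_mod \<delta>\<^esub> \<phi> x"
  shows "mod_iso (carrier ring_of_type_algebra) (quot_module (nil_mod \<beta>) H) (nil_mod \<delta> :: ('k poly, _) module)"
proof -
  let ?C = "\<lambda>x. (\<lambda>h. h + x) ` H" and ?Q = "quot_module (nil_mod \<beta>) H"
  \<comment> \<open>The image of a coset under \<open>\<phi>\<close> is a singleton, from which
    \<open>the_elem\<close> reads the value; the restriction supplies the extensionality demanded by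
    \<open>mod_hom\<close>.\<close>
  define F where "F = (\<lambda>A\<in>carrier ?Q. the_elem (\<phi> ` A))"
  have F: "F (?C x) = \<phi> x" if x: "x \<in> carrier (nil_mod \<beta>)" for x
  proof -
    have "\<phi> (h + x) = \<phi> x" if "h \<in> H" for h
      using that x H(2) add[of h x] by auto
    then have "\<phi> ` ?C x = {\<phi> x}" using submodD(2)[OF H(1)] by force
    then show ?thesis using x by (simp add: F_def carrier_quot)
  qed
  have sub: "\<phi> (x - y) = \<phi> x - \<phi> y" if "x \<in> carrier (nil_mod \<beta>)" "y \<in> carrier (nil_mod \<beta>)" for x y
    using add[OF nil_mod_diff[OF that] that(2)] by simp
  have "F \<in> mod_hom UNIV ?Q (nil_mod \<delta>)"
    unfolding mod_hom_def
  proof (intro CollectI conjI ballI)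
    have "F \<in> extensional (carrier ?Q)" by (simp add: F_def)
    then show "F \<in> carrier ?Q \<rightarrow>\<^sub>E carrier (nil_mod \<delta>)"
      using surj F by (auto simp: PiE_def carrier_quot)
  next
    fix A B assume "A \<in> carrier ?Q" "B \<in> carrier ?Q"
    then obtain x y where x: "x \<in> carrier (nil_mod \<beta>)" "A = ?C x" and y: "y \<in> carrier (nil_mod \<beta>)" "B = ?C y"
      by (auto simp: carrier_quot)
    have "A \<oplus>\<^bsub>?Q\<^esub> B = ?C (x + y)"
      unfolding x y using coset_add[OF H(1)] by (simp add: quot_module_def)
    then show "F (A \<oplus>\<^bsub>?Q\<^esub> B) = F A \<oplus>\<^bsub>nil_mod \<delta>\<^esub> F B"
      using x y F[OF nil_mod_add[OF x(1) y(1)]] F[OF x(1)] F[OF y(1)] add[OF x(1) y(1)] by simp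
  next
    fix p A assume "A \<in> carrier ?Q"
    then obtain x where x: "x \<in> carrier (nil_mod \<beta>)" "A = ?C x" by (auto simp: carrier_quot)
    have "p \<odot>\<^bsub>?Q\<^esub> A = ?C (p \<odot>\<^bsub>nil_mod \<beta>\<^esub> x)"
      unfolding x using coset_smult[OF H(1)] by (simp add: quot_module_def)
    moreover have "p \<odot>\<^bsub>nil_mod \<beta>\<^esub> x \<in> carrier (nil_mod \<beta>)" by (simp add: nil_mod_reduce)
    ultimately show "F (p \<odot>\<^bsub>?Q\<^esub> A) = p \<odot>\<^bsub>nil_mod \<delta>\<^esub> F A"
      using x F sm by metis
  qed
  moreover have "bij_betw F (carrier ?Q) (carrier (nil_mod \<delta>))"
    unfolding bij_betw_def
  proof
    show "inj_on F (carrier ?Q)"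
    proof (rule inj_onI)
      fix A B assume "A \<in> carrier ?Q" "B \<in> carrier ?Q" and eq: "F A = F B"
      then obtain x y where x: "x \<in> carrier (nil_mod \<beta>)" "A = ?C x" and y: "y \<in> carrier (nil_mod \<beta>)" "B = ?C y"
        by (auto simp: carrier_quot)
      with eq F sub have "\<phi> (x - y) = 0" by simp
      then have "x - y \<in> H" using x y H(2) nil_mod_diff by blast
      then show "A = B" using x y coset_eq_iff[OF H(1)] by simp
    qed
    have "F ` carrier ?Q = (\<lambda>x. F (?C x)) ` carrier (nil_mod \<beta>)"
      by (simp add: carrier_quot image_image)
    also have "\<dots> = \<phi> ` carrier (nil_mod \<beta>)" using F by (intro image_cong) simp_all
    finally show "F ` carrier ?Q = carrier (nil_mod \<delta>)" using surj by simp
  qed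
  ultimately show ?thesis unfolding mod_iso_def by auto
qed

text \<open>Composing the given isomorphism with the projection to cosets produces
  \<open>\<phi>\<close>; injectivity of the isomorphism turns into the description of the
  kernel.\<close>

lemma mod_iso_quotE:
  fixes H :: "'k::field kT_elem set"
  assumes H: "submod \<beta> H"
    and iso: "mod_iso (carrier ring_of_type_algebra) (quot_module (nil_mod \<beta>) H) (nil_mod \<delta> :: ('k poly, _) module)"
  obtains \<phi> :: "'k kT_elem \<Rightarrow> 'k kT_elem" where "H = {x \<in> carrier (nil_mod \<beta>). \<phi> x = 0}"
    and "\<phi> ` carrier (nil_mod \<beta>) = carrier (nil_mod \<delta>)"
    and "\<And>x y. x \<in> carrier (nil_mod \<beta>) \<Longrightarrow> y \<in> carrier (nil_mod \<beta>) \<Longrightarrow> \<phi> (x + y) = \<phi> x + \<phi> y"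
    and "\<And>p x. x \<in> carrier (nil_mod \<beta>) \<Longrightarrow> \<phi> (p \<odot>\<^bsub>nil_mod \<beta>\<^esub> x) = p \<odot>\<^bsub>nil_mod \<delta>\<^esub> \<phi> x"
proof -
  let ?C = "\<lambda>x. (\<lambda>h. h + x) ` H" and ?Q = "quot_module (nil_mod \<beta>) H"
  obtain F where F: "F \<in> mod_hom UNIV ?Q (nil_mod \<delta>)" and bij: "bij_betw F (carrier ?Q) (carrier (nil_mod \<delta>))"
    using iso unfolding mod_iso_def by auto
  define \<phi> where "\<phi> x = F (?C x)" for x
  have C: "?C x \<in> carrier ?Q" if "x \<in> carrier (nil_mod \<beta>)" for x
    using that by (auto simp: carrier_quot)
  have add: "\<phi> (x + y) = \<phi> x + \<phi> y" if "x \<in> carrier (nil_mod \<beta>)" "y \<in> carrier (nil_mod \<beta>)" for x y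
  proof -
    have "F (?C x \<oplus>\<^bsub>?Q\<^esub> ?C y) = F (?C x) \<oplus>\<^bsub>nil_mod \<delta>\<^esub> F (?C y)"
      using F C that unfolding mod_hom_def by blast
    then show ?thesis using coset_add[OF H] by (simp add: \<phi>_def quot_module_def)
  qed
  have sm: "\<phi> (p \<odot>\<^bsub>nil_mod \<beta>\<^esub> x) = p \<odot>\<^bsub>nil_mod \<delta>\<^esub> \<phi> x" if "x \<in> carrier (nil_mod \<beta>)" for p x
  proof -
    have "F (p \<odot>\<^bsub>?Q\<^esub> ?C x) = p \<odot>\<^bsub>nil_mod \<delta>\<^esub> F (?C x)"
      using F C that unfolding mod_hom_def by blast
    then show ?thesis using coset_smult[OF H, where x = x and p = p] by (simp add: \<phi>_def quot_module_def)
  qed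
  have z: "\<phi> 0 = 0" using add[of 0 0] nil_mod_zero by force
  have "\<phi> x = 0 \<longleftrightarrow> x \<in> H" if x: "x \<in> carrier (nil_mod \<beta>)" for x
  proof -
    have "\<phi> x = 0 \<longleftrightarrow> F (?C x) = F (?C 0)" using z by (simp add: \<phi>_def)
    also have "\<dots> \<longleftrightarrow> ?C x = ?C 0"
      by (rule inj_on_eq_iff[OF bij_betw_imp_inj_on[OF bij] C[OF x] C[OF nil_mod_zero]])
    also have "\<dots> \<longleftrightarrow> x \<in> H" using coset_eq_iff[OF H, of x 0] by simp
    finally show ?thesis .
  qed
  then have "H = {x \<in> carrier (nil_mod \<beta>). \<phi> x = 0}" using submodD(1)[OF H] by auto
  moreover have "\<phi> ` carrier (nil_mod \<beta>) = carrier (nil_mod \<delta>)"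
    using bij by (auto simp: bij_betw_def carrier_quot image_image \<phi>_def)
  ultimately show ?thesis using that add sm by blast
qed

section \<open>Linear algebra over the ground field\<close>

lemma poly_funs_diff:
  assumes "p \<in> poly_funs C" "q \<in> poly_funs C"
  shows "(\<lambda>x. p x - q x) \<in> poly_funs C"
  using poly_funs.add[OF assms(1) poly_funs.mult[OF poly_funs.const[of "-1"] assms(2)]] by simp

text \<open>Independence is an open condition. Instead of minors, the induction performs Gaussian
  elimination on the rows \<open>J\<close>, and \<open>p\<close> becomes the product of the pivots,
  which are nonzero at \<open>x0\<close>.\<close>

lemma independent_family_open:
  fixes A :: "'x \<Rightarrow> 'j \<Rightarrow> 'i \<Rightarrow> 'k::field"
  assumes "finite J"
    and "\<And>j i. j \<in> J \<Longrightarrow> i \<in> I \<Longrightarrow> (\<lambda>x. A x j i) \<in> poly_funs C"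
    and "\<And>u. (\<And>i. i \<in> I \<Longrightarrow> (\<Sum>j\<in>J. u j * A x0 j i) = 0) \<Longrightarrow> (\<forall>j\<in>J. u j = 0)"
  shows "\<exists>p\<in>poly_funs C. p x0 \<noteq> 0 \<and>
    (\<forall>x u. p x \<noteq> 0 \<longrightarrow> (\<forall>i\<in>I. (\<Sum>j\<in>J. u j * A x j i) = 0) \<longrightarrow> (\<forall>j\<in>J. u j = 0))"
  using assms
proof (induction J arbitrary: A rule: finite_induct)
  case empty
  show ?case by (rule bexI[OF _ poly_funs.const[of 1]]) simp
next
  case (insert j0 J)
  obtain i0 where i0: "i0 \<in> I" "A x0 j0 i0 \<noteq> 0"
  proof (rule ccontr)
    assume "\<not> thesis"
    then have z: "A x0 j0 i = 0" if "i \<in> I" for i using that \<open>\<And>i0. \<lbrakk>i0 \<in> I; A x0 j0 i0 \<noteq> 0\<rbrakk> \<Longrightarrow> thesis\<close> by blast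
    \<comment> \<open>If row \<open>j0\<close> vanished at \<open>x0\<close>, the unit vector at
      \<open>j0\<close> would be a nontrivial relation; so a pivot exists.\<close>
    have "(\<Sum>j\<in>insert j0 J. (if j = j0 then 1 else 0) * A x0 j i) = 0" if "i \<in> I" for i
      using insert.hyps z[OF that] by (auto intro!: sum.neutral)
    from insert.prems(2)[OF this] show False by auto
  qed
  \<comment> \<open>Elimination of coordinate \<open>i0\<close> by cross-multiplication: no division
    takes place, so the new entries are again polynomial functions of \<open>x\<close>.\<close>
  define B where "B x j i = A x j0 i0 * A x j i - A x j i0 * A x j0 i" for x j i
  have sumB: "(\<Sum>j\<in>J. u j * B x j i) = A x j0 i0 * (\<Sum>j\<in>J. u j * A x j i) - A x j0 i * (\<Sum>j\<in>J. u j * A x j i0)"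
    for u x i
    by (simp add: B_def sum_distrib_left right_diff_distrib sum_subtractf algebra_simps)
  have "\<exists>p\<in>poly_funs C. p x0 \<noteq> 0 \<and>
    (\<forall>x u. p x \<noteq> 0 \<longrightarrow> (\<forall>i\<in>I. (\<Sum>j\<in>J. u j * B x j i) = 0) \<longrightarrow> (\<forall>j\<in>J. u j = 0))"
  proof (rule insert.IH)
    fix j i assume "j \<in> J" "i \<in> I"
    then show "(\<lambda>x. B x j i) \<in> poly_funs C"
      unfolding B_def using i0(1) insert.prems(1)
      by (intro poly_funs_diff poly_funs.mult) auto
  next
    fix u assume u: "\<And>i. i \<in> I \<Longrightarrow> (\<Sum>j\<in>J. u j * B x0 j i) = 0"
    \<comment> \<open>A relation among the rows of \<open>B\<close> lifts to one among the rows of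
      \<open>A\<close>: multiply by the pivot and choose the coefficient of \<open>j0\<close> so
      that coordinate \<open>i0\<close> cancels.\<close>
    define v where "v j = (if j = j0 then - (\<Sum>j\<in>J. u j * A x0 j i0) else A x0 j0 i0 * u j)" for j
    have vJ: "(\<Sum>j\<in>J. v j * A x0 j i) = A x0 j0 i0 * (\<Sum>j\<in>J. u j * A x0 j i)" for i
      unfolding sum_distrib_left by (rule sum.cong) (use insert.hyps in \<open>auto simp: v_def\<close>)
    have "\<forall>j\<in>insert j0 J. v j = 0"
    proof (rule insert.prems(2))
      fix i assume "i \<in> I"
      show "(\<Sum>j\<in>insert j0 J. v j * A x0 j i) = 0"
        using insert.hyps u[OF \<open>i \<in> I\<close>] unfolding sumB by (simp add: vJ) (simp add: v_def algebra_simps)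
    qed
    then have "A x0 j0 i0 * u j = 0" if "j \<in> J" for j
      using that insert.hyps(2) unfolding v_def by (metis insert_iff)
    then show "\<forall>j\<in>J. u j = 0" using i0 by simp
  qed
  then obtain p where p: "p \<in> poly_funs C" "p x0 \<noteq> 0"
    "\<And>x u. p x \<noteq> 0 \<Longrightarrow> (\<forall>i\<in>I. (\<Sum>j\<in>J. u j * B x j i) = 0) \<Longrightarrow> (\<forall>j\<in>J. u j = 0)"
    by blast
  show ?case
  proof (intro bexI conjI allI impI)
    show "(\<lambda>x. A x j0 i0 * p x) \<in> poly_funs C"
      using insert.prems(1)[OF _ i0(1)] p(1) by (intro poly_funs.mult) auto
    show "A x0 j0 i0 * p x0 \<noteq> 0" using i0 p by simp
    fix x u assume nz: "A x j0 i0 * p x \<noteq> 0" and u: "\<forall>i\<in>I. (\<Sum>j\<in>insert j0 J. u j * A x j i) = 0"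
    have e: "(\<Sum>j\<in>J. u j * A x j i) = - (u j0 * A x j0 i)" if "i \<in> I" for i
      using u that insert.hyps by (simp add: add_eq_0_iff)
    have "\<forall>i\<in>I. (\<Sum>j\<in>J. u j * B x j i) = 0"
      unfolding sumB using e i0(1) by (simp add: algebra_simps)
    then have uJ: "\<forall>j\<in>J. u j = 0" using p(3) nz by auto
    moreover have "u j0 = 0" using e[OF i0(1)] uJ nz by simp
    ultimately show "\<forall>j\<in>insert j0 J. u j = 0" by simp
  qed
qed

lemma sum_fun_apply: "(\<Sum>a\<in>A. f a) x = (\<Sum>a\<in>A. f a x)"
  by (induction A rule: infinite_finite_induct) auto

text \<open>\<open>kv.independent\<close> speaks of sets, the elimination of families. Repetitions
  are excluded because two equal vectors satisfy the relation with coefficients 1 and -1.\<close>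

lemma independent_image_family:
  fixes A :: "'j \<Rightarrow> 'k::field kT_elem"
  assumes J: "finite J"
    and ind: "\<And>u. (\<Sum>j\<in>J. kscale (u j) (A j)) = 0 \<Longrightarrow> (\<forall>j\<in>J. u j = 0)"
  shows "inj_on A J" "kv.independent (A ` J)"
proof -
  show inj: "inj_on A J"
  proof (rule inj_onI, rule ccontr)
    fix x y assume xy: "x \<in> J" "y \<in> J" "A x = A y" "x \<noteq> y"
    define u where "u j = (if j = x then 1 else if j = y then -1 else 0 :: 'k)" for j
    have "(\<Sum>j\<in>J. kscale (u j) (A j)) = (\<Sum>j\<in>{x, y}. kscale (u j) (A j))"
      using J xy by (intro sum.mono_neutral_right) (auto simp: u_def fun_eq_iff)
    also have "\<dots> = 0" using xy by (auto simp: u_def fun_eq_iff)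
    finally have "u x = 0" using ind xy by blast
    then show False by (simp add: u_def)
  qed
  show "kv.independent (A ` J)"
  proof (rule kv.independent_if_scalars_zero)
    fix f x assume "(\<Sum>x\<in>A ` J. kscale (f x) x) = 0" and x: "x \<in> A ` J"
    then have "(\<Sum>j\<in>J. kscale (f (A j)) (A j)) = 0" by (simp add: sum.reindex[OF inj])
    from ind[OF this] x show "f x = 0" by blast
  qed (use J in simp)
qed

lemma independent_familyD:
  assumes "finite J" "inj_on A J" "kv.independent (A ` J)" "(\<Sum>j\<in>J. kscale (u j) (A j)) = 0" "j \<in> J"
  shows "u j = 0"
proof -
  have "(\<Sum>x\<in>A ` J. kscale (u (the_inv_into J A x)) x) = (\<Sum>j\<in>J. kscale (u j) (A j))"
    unfolding sum.reindex[OF assms(2)] by (rule sum.cong) (simp_all add: the_inv_into_f_f[OF assms(2)])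
  then have "u (the_inv_into J A (A j)) = 0"
    using kv.independentD[OF assms(3), of "A ` J" "\<lambda>x. u (the_inv_into J A x)" "A j"] assms by simp
  then show ?thesis using assms by (simp add: the_inv_into_f_f)
qed

text \<open>\<open>ind\<close> and \<open>sp\<close> say that the classes of the \<open>z k\<close>
  form a basis of \<open>V\<close> modulo \<open>W\<close>; adjoining the \<open>z k\<close> to a
  basis of \<open>W\<close> gives one of \<open>V\<close>. The finite spanning set \<open>B0\<close>
  makes the dimensions true cardinalities.\<close>

lemma codim_eq:
  assumes W: "kv.subspace W" "W \<subseteq> V" and V: "kv.subspace V" "V \<subseteq> kv.span B0" "finite B0"
    and K: "finite K" "\<And>k. k \<in> K \<Longrightarrow> z k \<in> V"
    and ind: "\<And>u. (\<Sum>k\<in>K. kscale (u k) (z k)) \<in> W \<Longrightarrow> (\<forall>k\<in>K. u k = 0)"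
    and sp: "\<And>v. v \<in> V \<Longrightarrow> \<exists>u. v - (\<Sum>k\<in>K. kscale (u k) (z k)) \<in> W"
  shows "kv.dim V = kv.dim W + card K"
proof -
  obtain B where B: "B \<subseteq> W" "kv.independent B" "W \<subseteq> kv.span B" "card B = kv.dim W"
    using kv.basis_exists by blast
  have finB: "finite B"
    using kv.independent_span_bound[OF V(3) B(2)] B(1) W V by blast
  have 0: "(\<Sum>k\<in>K. kscale (u k) (z k)) = 0 \<Longrightarrow> (\<forall>k\<in>K. u k = 0)" for u
    using ind[of u] kv.subspace_0[OF W(1)] by simp
  note inj = independent_image_family(1)[OF K(1) 0]
  have disj: "B \<inter> z ` K = {}"
  proof (rule ccontr)
    assume "B \<inter> z ` K \<noteq> {}"
    then obtain k where k: "k \<in> K" "z k \<in> B" by blast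
    have "(\<Sum>k'\<in>K. kscale (if k' = k then 1 else 0) (z k')) = (\<Sum>k'\<in>{k}. kscale (if k' = k then 1 else 0) (z k'))"
      using K k by (intro sum.mono_neutral_right) (auto simp: fun_eq_iff)
    also have "\<dots> \<in> W" using k B by (auto simp: kscale_def)
    finally show False using ind k by fastforce
  qed
  have "kv.independent (B \<union> z ` K)"
  proof (rule kv.independent_if_scalars_zero)
    show "finite (B \<union> z ` K)" using finB K by simp
    fix f x assume s: "(\<Sum>x\<in>B \<union> z ` K. kscale (f x) x) = 0" and x: "x \<in> B \<union> z ` K"
    have s': "(\<Sum>x\<in>B. kscale (f x) x) + (\<Sum>k\<in>K. kscale (f (z k)) (z k)) = 0"
      using s finB K disj by (simp add: sum.union_disjoint sum.reindex[OF inj])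
    have "(\<Sum>x\<in>B. kscale (f x) x) \<in> W"
      using B(1) W(1) by (intro kv.subspace_sum kv.subspace_scale) auto
    then have "- (\<Sum>x\<in>B. kscale (f x) x) \<in> W" by (rule kv.subspace_neg[OF W(1)])
    then have "(\<Sum>k\<in>K. kscale (f (z k)) (z k)) \<in> W"
      unfolding minus_unique[OF s'] .
    then have zK: "\<forall>k\<in>K. f (z k) = 0" by (rule ind)
    then have "(\<Sum>k\<in>K. kscale (f (z k)) (z k)) = 0" by (intro sum.neutral) (auto simp: fun_eq_iff)
    with s' have "(\<Sum>x\<in>B. kscale (f x) x) = 0" by simp
    then have "\<forall>x\<in>B. f x = 0" using kv.independentD[OF B(2) finB subset_refl] by blast
    with zK x show "f x = 0" by blast
  qed
  moreover have "V \<subseteq> kv.span (B \<union> z ` K)"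
  proof
    fix v assume "v \<in> V"
    then obtain u where "v - (\<Sum>k\<in>K. kscale (u k) (z k)) \<in> W" using sp by blast
    then have "v - (\<Sum>k\<in>K. kscale (u k) (z k)) \<in> kv.span (B \<union> z ` K)"
      using B(3) kv.span_mono[of B "B \<union> z ` K"] by blast
    moreover have "(\<Sum>k\<in>K. kscale (u k) (z k)) \<in> kv.span (B \<union> z ` K)"
      by (intro kv.span_sum kv.span_scale kv.span_base) auto
    ultimately show "v \<in> kv.span (B \<union> z ` K)"
      using kv.span_add by fastforce
  qed
  moreover have "B \<union> z ` K \<subseteq> V" using B W K by auto
  ultimately have "card (B \<union> z ` K) = kv.dim V" using kv.basis_card_eq_dim by blast
  then show ?thesis using finB K disj B(4) by (simp add: card_Un_disjoint card_image[OF inj])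
qed

text \<open>The pair \<open>(c, m)\<close> stands for the vector T^m in summand \<open>c\<close>, so
  \<open>boxes \<alpha> i\<close> indexes a k-basis of T^i N_alpha.\<close>

definition boxes :: "(nat \<Rightarrow> nat) \<Rightarrow> nat \<Rightarrow> (nat \<times> nat) set" where
  "boxes \<alpha> i = {(c, m). i \<le> m \<and> m < \<alpha> c}"

lemma finite_boxes:
  assumes "finite {c. \<alpha> c \<noteq> 0}"
  shows "finite (boxes \<alpha> i)"
proof -
  have "boxes \<alpha> i \<subseteq> (SIGMA c:{c. \<alpha> c \<noteq> 0}. {..<\<alpha> c})" by (auto simp: boxes_def)
  then show ?thesis by (rule finite_subset) (use assms in auto)
qed

section \<open>Standard bases, powers of T and homomorphisms\<close>

lemma basis_vec_carrier: "m < \<alpha> c \<Longrightarrow> basis_vec c m \<in> carrier (nil_mod \<alpha>)"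
  by (auto simp: carrier_nil_mod basis_vec_def)

lemma coeff_basis_vec: "coeff (basis_vec c m l) n = (if l = c \<and> m = n then 1 else 0)"
  by (simp add: basis_vec_def)

lemma coeff_sum_basis:
  assumes "finite G"
  shows "coeff ((\<Sum>p\<in>G. kscale (u p) (basis_vec (fst p) (snd p))) l) n = (if (l, n) \<in> G then u (l, n) else 0)"
proof -
  have "coeff ((\<Sum>p\<in>G. kscale (u p) (basis_vec (fst p) (snd p))) l) n =
    (\<Sum>p\<in>G. if p = (l, n) then u p else 0)"
    unfolding sum_fun_apply coeff_sum by (rule sum.cong) (auto simp: coeff_basis_vec)
  then show ?thesis using assms by simp
qed

lemma nil_mod_expand:
  assumes "finite {c. \<alpha> c \<noteq> 0}" "v \<in> carrier (nil_mod \<alpha>)" "\<And>c m. m < i \<Longrightarrow> coeff (v c) m = 0"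
  shows "v = (\<Sum>p\<in>boxes \<alpha> i. kscale (coeff (v (fst p)) (snd p)) (basis_vec (fst p) (snd p)))"
proof (rule ext, rule poly_eqI)
  fix l n
  show "coeff (v l) n = coeff ((\<Sum>p\<in>boxes \<alpha> i. kscale (coeff (v (fst p)) (snd p)) (basis_vec (fst p) (snd p))) l) n"
    using assms unfolding coeff_sum_basis[OF finite_boxes[OF assms(1)]]
    by (auto simp: boxes_def carrier_nil_mod not_le)
qed

text \<open>Vanishing of the low coefficients is divisibility by T^i in every summand. The quotient
  vector is again reduced, since its coefficients are those of \<open>v\<close> moved down by
  \<open>i\<close>.\<close>

lemma T_power_image_iff:
  "v \<in> T_power_image i \<alpha> \<longleftrightarrow> v \<in> carrier (nil_mod \<alpha>) \<and> (\<forall>c. \<forall>m<i. coeff (v c) m = 0)"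
proof
  assume "v \<in> T_power_image i \<alpha>"
  then obtain x where "v = (\<lambda>c. (monom 1 i * x c) mod monom 1 (\<alpha> c))" by (auto simp: T_power_image_def)
  then show "v \<in> carrier (nil_mod \<alpha>) \<and> (\<forall>c. \<forall>m<i. coeff (v c) m = 0)"
    by (auto simp: carrier_nil_mod coeff_mod_monom coeff_monom_mult)
next
  assume v: "v \<in> carrier (nil_mod \<alpha>) \<and> (\<forall>c. \<forall>m<i. coeff (v c) m = 0)"
  have "\<exists>q. v c = monom 1 i * q" for c
    using v by (auto simp: monom_1_dvd_iff' dvd_def[symmetric])
  then obtain q where q: "\<And>c. v c = monom 1 i * q c" by metis
  have "q \<in> carrier (nil_mod \<alpha>)"
    unfolding carrier_nil_mod
  proof (intro allI impI)
    fix c m assume "\<alpha> c \<le> m"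
    then have "coeff (v c) (i + m) = 0" using v by (simp add: carrier_nil_mod)
    then show "coeff (q c) m = 0" by (simp add: q coeff_monom_mult)
  qed
  moreover have "v = (\<lambda>c. (monom 1 i * q c) mod monom 1 (\<alpha> c))"
    using v nil_mod_reduce_eq by (metis q)
  ultimately show "v \<in> T_power_image i \<alpha>" by (auto simp: T_power_image_def)
qed

lemma T_power_image_0: "T_power_image 0 \<alpha> = carrier (nil_mod \<alpha>)"
  by (auto simp: T_power_image_iff)

lemma submod_T_power_image: "submod \<alpha> (T_power_image i \<alpha>)"
proof -
  have "coeff (p * q) m = 0" if "m < i" "\<forall>m<i. coeff q m = 0" for p q :: "'a poly" and m
  proof -
    have "monom 1 i dvd q" using that by (simp add: monom_1_dvd_iff')
    then have "monom 1 i dvd p * q" by simp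
    then show ?thesis using that by (simp add: monom_1_dvd_iff')
  qed
  then show ?thesis
    unfolding submod_def by (auto simp: T_power_image_iff carrier_nil_mod coeff_mod_monom)
qed

lemma kT_homD:
  assumes "f \<in> kT_hom \<alpha> \<beta>"
  shows "x \<in> carrier (nil_mod \<alpha>) \<Longrightarrow> f x \<in> carrier (nil_mod \<beta>)"
    "x \<in> carrier (nil_mod \<alpha>) \<Longrightarrow> y \<in> carrier (nil_mod \<alpha>) \<Longrightarrow> f (x + y) = f x + f y"
    "x \<in> carrier (nil_mod \<alpha>) \<Longrightarrow> f (\<lambda>i. (p * x i) mod monom 1 (\<alpha> i)) = (\<lambda>i. (p * f x i) mod monom 1 (\<beta> i))"
    "x \<in> carrier (nil_mod \<alpha>) \<Longrightarrow> f (kscale a x) = kscale a (f x)"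
    "f 0 = 0"
proof -
  show 1: "x \<in> carrier (nil_mod \<alpha>) \<Longrightarrow> f x \<in> carrier (nil_mod \<beta>)"
    "x \<in> carrier (nil_mod \<alpha>) \<Longrightarrow> y \<in> carrier (nil_mod \<alpha>) \<Longrightarrow> f (x + y) = f x + f y" for x y
    using assms by (auto simp: kT_hom_def mod_hom_def)
  show 2: "x \<in> carrier (nil_mod \<alpha>) \<Longrightarrow> f (\<lambda>i. (p * x i) mod monom 1 (\<alpha> i)) = (\<lambda>i. (p * f x i) mod monom 1 (\<beta> i))" for x p
    using assms by (auto simp: kT_hom_def mod_hom_def)
  show "x \<in> carrier (nil_mod \<alpha>) \<Longrightarrow> f (kscale a x) = kscale a (f x)"
    using 2[of x "[:a:]"] 1 const_smult_nil_mod[of x \<alpha> a] const_smult_nil_mod[of "f x" \<beta> a] by simp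
  show "f 0 = 0" using 1(2)[of 0 0] nil_mod_zero by force
qed

lemma kT_hom_sum:
  assumes f: "f \<in> kT_hom \<alpha> \<beta>" and "\<And>p. p \<in> G \<Longrightarrow> b p \<in> carrier (nil_mod \<alpha>)"
  shows "f (\<Sum>p\<in>G. kscale (u p) (b p)) = (\<Sum>p\<in>G. kscale (u p) (f (b p)))"
  using assms(2)
proof (induction G rule: infinite_finite_induct)
  case (insert x G)
  have "(\<Sum>p\<in>G. kscale (u p) (b p)) \<in> carrier (nil_mod \<alpha>)"
    using insert.prems by (intro kv.subspace_sum[OF subspace_nil_mod] kv.subspace_scale[OF subspace_nil_mod]) auto
  moreover have "kscale (u x) (b x) \<in> carrier (nil_mod \<alpha>)"
    using insert.prems by (intro kv.subspace_scale[OF subspace_nil_mod]) auto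
  ultimately have "f (kscale (u x) (b x) + (\<Sum>p\<in>G. kscale (u p) (b p))) =
    f (kscale (u x) (b x)) + f (\<Sum>p\<in>G. kscale (u p) (b p))" by (intro kT_homD(2)[OF f])
  moreover have "f (kscale (u x) (b x)) = kscale (u x) (f (b x))"
    using insert.prems by (intro kT_homD(4)[OF f]) simp
  moreover have "f (\<Sum>p\<in>G. kscale (u p) (b p)) = (\<Sum>p\<in>G. kscale (u p) (f (b p)))"
    using insert.prems by (intro insert.IH) simp
  ultimately show ?case by (simp only: sum.insert[OF insert.hyps])
qed (use kT_homD(5)[OF f] in simp_all)

lemma submod_image:
  assumes f: "f \<in> kT_hom \<alpha> \<beta>" and H: "submod \<alpha> H"
  shows "submod \<beta> (f ` H)"
  unfolding submod_def smult_nil_mod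
proof (intro conjI allI ballI)
  note sm = submodD[OF H] and hom = kT_homD[OF f]
  show "f ` H \<subseteq> carrier (nil_mod \<beta>)" using sm(1) hom(1) by blast
  show "0 \<in> f ` H" using sm(2) hom(5) by force
  fix x y assume "x \<in> f ` H" "y \<in> f ` H"
  then obtain a b where "a \<in> H" "b \<in> H" "x = f a" "y = f b" by blast
  then show "x + y \<in> f ` H" using sm(1,3)[of a] sm(1)[of b] hom(2)[of a b] by (intro image_eqI[of _ _ "a + b"]) simp_all
next
  note sm = submodD[OF H] and hom = kT_homD[OF f]
  fix p x assume "x \<in> f ` H"
  then obtain a where "a \<in> H" "x = f a" by blast
  then show "(\<lambda>i. p * x i mod monom 1 (\<beta> i)) \<in> f ` H"
    using sm(1,4)[of a] hom(3)[of a p] by (intro image_eqI[of _ _ "\<lambda>i. (p * a i) mod monom 1 (\<alpha> i)"]) simp_all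
qed

text \<open>Both sides count the boxes in the first \<open>j\<close> rows of the diagram with column
  lengths \<open>\<delta>\<close>, row \<open>l\<close> corresponding to the exponent
  \<open>l - 1\<close>. The right side is the dimension of N_delta / T^j N_delta.\<close>

lemma sum_conj_part:
  assumes "finite {c. \<delta> c \<noteq> 0}"
  shows "(\<Sum>l=1..j. conj_part \<delta> l) = card (boxes (\<lambda>c. min (\<delta> c) j) 0)"
proof -
  have fin: "finite {c. l \<le> \<delta> c}" if "l \<in> {1..j}" for l
    using that by (intro finite_subset[OF _ assms]) auto
  have "(\<Sum>l=1..j. conj_part \<delta> l) = card (SIGMA l:{1..j}. {c. l \<le> \<delta> c})"
    using fin by (simp add: conj_part_def card_SigmaI)
  also have "\<dots> = card (boxes (\<lambda>c. min (\<delta> c) j) 0)"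
    by (rule bij_betw_same_card[of "\<lambda>(l, c). (c, l - 1)"],
        rule bij_betw_byWitness[where f' = "\<lambda>(c, m). (m + 1, c)"]) (auto simp: boxes_def)
  finally show ?thesis .
qed

section \<open>Semicontinuity and the dominance order\<close>

text \<open>Left indices give spanning vectors of f(T^i N_alpha), right indices those of T^j N_beta.
  The index set does not depend on \<open>f\<close>, so the same subfamily can be tested for
  independence at different maps.\<close>

definition generator :: "('k::field kT_elem \<Rightarrow> 'k kT_elem) \<Rightarrow> (nat \<times> nat) + (nat \<times> nat) \<Rightarrow> 'k kT_elem" where
  "generator f = case_sum (\<lambda>p. f (basis_vec (fst p) (snd p))) (\<lambda>p. basis_vec (fst p) (snd p))"

text \<open>\<open>W\<close> is f(T^i N_alpha) + T^j N_beta, which is the preimage of T^j N_delta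
  under the quotient map with kernel f(T^i N_alpha). Hence its codimension is the dimension of
  N_delta / T^j N_delta.\<close>

lemma codim_generators:
  fixes f :: "'k::field kT_elem \<Rightarrow> 'k kT_elem" and j :: nat
  assumes f: "f \<in> kT_hom \<alpha> \<beta>"
    and fin: "finite {c. \<alpha> c \<noteq> 0}" "finite {c. \<beta> c \<noteq> 0}" "finite {c. \<delta> c \<noteq> 0}"
    and iso: "mod_iso (carrier ring_of_type_algebra)
       (quot_module (nil_mod \<beta>) (f ` T_power_image i \<alpha>)) (nil_mod \<delta> :: ('k poly, _) module)"
  defines "W \<equiv> kv.span (generator f ` (boxes \<alpha> i <+> boxes \<beta> j))"
  shows "W \<subseteq> carrier (nil_mod \<beta>)"
    and "kv.dim (carrier (nil_mod \<beta>) :: 'k kT_elem set) = kv.dim W + card (boxes (\<lambda>c. min (\<delta> c) j) 0)"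
proof -
  let ?H = "f ` T_power_image i \<alpha>" and ?N = "carrier (nil_mod \<beta>) :: 'k kT_elem set"
  have sH: "submod \<beta> ?H" by (rule submod_image[OF f submod_T_power_image])
  obtain \<phi> where \<phi>: "?H = {x \<in> ?N. \<phi> x = 0}" "\<phi> ` ?N = carrier (nil_mod \<delta>)"
    "\<And>x y. x \<in> ?N \<Longrightarrow> y \<in> ?N \<Longrightarrow> \<phi> (x + y) = \<phi> x + \<phi> y"
    "\<And>p x. x \<in> ?N \<Longrightarrow> \<phi> (p \<odot>\<^bsub>nil_mod \<beta>\<^esub> x) = p \<odot>\<^bsub>nil_mod \<delta>\<^esub> \<phi> x"
    using mod_iso_quotE[OF sH iso] by blast
  \<comment> \<open>Outside the carrier \<open>\<phi>\<close> is arbitrary; the restriction makes it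
    a member of \<open>kT_hom\<close>, so the lemmas on homomorphisms apply.\<close>
  define \<psi> where "\<psi> = restrict \<phi> ?N"
  have \<psi>: "\<psi> \<in> kT_hom \<beta> \<delta>"
    unfolding kT_hom_def mod_hom_def
  proof (intro CollectI conjI ballI)
    show "\<psi> \<in> ?N \<rightarrow>\<^sub>E carrier (nil_mod \<delta>)" using \<phi>(2) by (auto simp: \<psi>_def)
    fix x y :: "'k kT_elem" assume "x \<in> ?N" "y \<in> ?N"
    then show "\<psi> (x \<oplus>\<^bsub>nil_mod \<beta>\<^esub> y) = \<psi> x \<oplus>\<^bsub>nil_mod \<delta>\<^esub> \<psi> y"
      using \<phi>(3)[of x y] nil_mod_add[of x \<beta> y] by (simp add: \<psi>_def)
  next
    fix p and x :: "'k kT_elem" assume "x \<in> ?N"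
    then show "\<psi> (p \<odot>\<^bsub>nil_mod \<beta>\<^esub> x) = p \<odot>\<^bsub>nil_mod \<delta>\<^esub> \<psi> x"
      using \<phi>(4)[of x p] nil_mod_reduce[of "\<lambda>i. p * x i" \<beta>] by (simp add: \<psi>_def)
  qed
  note hom = kT_homD[OF \<psi>]
  have H: "?H = {x \<in> ?N. \<psi> x = 0}" using \<phi>(1) by (auto simp: \<psi>_def)
  have surj: "\<psi> ` ?N = carrier (nil_mod \<delta>)" using \<phi>(2) by (simp add: \<psi>_def)
  define V where "V = {x \<in> ?N. \<forall>c. \<forall>m<j. coeff (\<psi> x c) m = 0}"
  have sV: "kv.subspace V"
    unfolding kv.subspace_def V_def using hom(2,4,5)
    by (auto simp: nil_mod_zero nil_mod_add kv.subspace_scale[OF subspace_nil_mod])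
  have gen: "generator f x \<in> V" if x: "x \<in> boxes \<alpha> i <+> boxes \<beta> j" for x
  proof -
    from x consider c m where "x = Inl (c, m)" "i \<le> m" "m < \<alpha> c" | c m where "x = Inr (c, m)" "j \<le> m" "m < \<beta> c"
      by (auto simp: boxes_def)
    then show ?thesis
    proof cases
      case 1
      then have "(basis_vec c m :: 'k kT_elem) \<in> T_power_image i \<alpha>"
        by (auto simp: T_power_image_iff basis_vec_carrier coeff_basis_vec)
      then have "generator f x \<in> ?H" using 1 by (simp add: generator_def)
      then show ?thesis by (auto simp: H V_def)
    next
      case 2
      have b: "(basis_vec c m :: 'k kT_elem) \<in> ?N" using 2 by (simp add: basis_vec_carrier)
      have "(basis_vec c m :: 'k kT_elem) \<in> T_power_image j \<beta>"
        using 2 b by (auto simp: T_power_image_iff coeff_basis_vec)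
      then obtain y where y: "y \<in> ?N" "basis_vec c m = (\<lambda>c. (monom 1 j * y c) mod monom 1 (\<beta> c))"
        by (auto simp: T_power_image_def)
      have "\<psi> (basis_vec c m) = (\<lambda>c. (monom 1 j * \<psi> y c) mod monom 1 (\<delta> c))"
        unfolding y(2) by (rule hom(3)[OF y(1)])
      then show ?thesis using b 2 by (simp add: V_def generator_def coeff_mod_monom coeff_monom_mult)
    qed
  qed
  have "W \<subseteq> V" unfolding W_def using gen by (intro kv.span_minimal sV) blast
  moreover have "V \<subseteq> W"
  proof
    fix x assume x: "x \<in> V"
    then have xN: "x \<in> ?N" by (simp add: V_def)
    have "\<psi> x \<in> T_power_image j \<delta>" using x hom(1) by (auto simp: V_def T_power_image_iff)
    then obtain y' where y': "y' \<in> carrier (nil_mod \<delta>)" "\<psi> x = (\<lambda>c. (monom 1 j * y' c) mod monom 1 (\<delta> c))"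
      by (auto simp: T_power_image_def)
    then obtain y where y: "y \<in> ?N" "y' = \<psi> y" using surj by blast
    \<comment> \<open>The image of \<open>x\<close> is T^j times that of \<open>y\<close>, so T^j
      \<open>y\<close> accounts for \<open>x\<close> up to the kernel f(T^i N_alpha).\<close>
    define w where "w = (\<lambda>c. (monom 1 j * y c) mod monom 1 (\<beta> c))"
    have w: "w \<in> T_power_image j \<beta>" using y by (auto simp: w_def T_power_image_def)
    then have wN: "w \<in> ?N" by (simp add: T_power_image_iff)
    have "\<psi> w = \<psi> x" unfolding w_def y'(2) y(2) by (rule hom(3)[OF y(1)])
    moreover have "\<psi> x = \<psi> (x - w) + \<psi> w" using hom(2)[OF nil_mod_diff[OF xN wN] wN] by simp
    ultimately have "\<psi> (x - w) = 0" by simp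
    then have "x - w \<in> ?H" using nil_mod_diff[OF xN wN] by (simp add: H)
    then obtain a where a: "a \<in> T_power_image i \<alpha>" "x - w = f a" by blast
    have "a = (\<Sum>p\<in>boxes \<alpha> i. kscale (coeff (a (fst p)) (snd p)) (basis_vec (fst p) (snd p)))"
      using a(1) by (intro nil_mod_expand[OF fin(1)]) (auto simp: T_power_image_iff)
    then have "f a = f (\<Sum>p\<in>boxes \<alpha> i. kscale (coeff (a (fst p)) (snd p)) (basis_vec (fst p) (snd p)))"
      by (rule arg_cong)
    also have "\<dots> = (\<Sum>p\<in>boxes \<alpha> i. kscale (coeff (a (fst p)) (snd p)) (f (basis_vec (fst p) (snd p))))"
      by (rule kT_hom_sum[OF f]) (auto simp: boxes_def basis_vec_carrier)
    also have "\<dots> \<in> W"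
      unfolding W_def
      by (intro kv.span_sum kv.span_scale kv.span_base) (force simp: generator_def image_iff)
    finally have fa: "f a \<in> W" .
    have "w = (\<Sum>p\<in>boxes \<beta> j. kscale (coeff (w (fst p)) (snd p)) (basis_vec (fst p) (snd p)))"
      using w by (intro nil_mod_expand[OF fin(2)]) (auto simp: T_power_image_iff)
    also have "\<dots> \<in> W"
      unfolding W_def
      by (intro kv.span_sum kv.span_scale kv.span_base) (force simp: generator_def image_iff)
    finally have "w \<in> W" .
    then have "f a + w \<in> W" using fa unfolding W_def by (rule kv.span_add[rotated])
    moreover have "x = f a + w" using a(2)[symmetric] by simp
    ultimately show "x \<in> W" by simp
  qed
  ultimately have WV: "W = V" by blast
  show "W \<subseteq> ?N" unfolding WV by (auto simp: V_def)
  let ?K = "boxes (\<lambda>c. min (\<delta> c) j) 0"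
  have K: "finite ?K" by (rule finite_boxes) (rule finite_subset[OF _ fin(3)], auto)
  \<comment> \<open>Preimages of the basis vectors T^m with \<open>m < j\<close> represent a basis
    of the carrier modulo \<open>V\<close>.\<close>
  have "\<exists>z. z \<in> ?N \<and> \<psi> z = basis_vec (fst p) (snd p)" if "p \<in> ?K" for p
  proof -
    have "(basis_vec (fst p) (snd p) :: 'k kT_elem) \<in> carrier (nil_mod \<delta>)"
      using that by (intro basis_vec_carrier) (auto simp: boxes_def)
    then show ?thesis unfolding surj[symmetric] by auto
  qed
  then obtain z where z: "\<And>p. p \<in> ?K \<Longrightarrow> z p \<in> ?N" "\<And>p. p \<in> ?K \<Longrightarrow> \<psi> (z p) = basis_vec (fst p) (snd p)"
    by metis
  have \<psi>z: "\<psi> (\<Sum>p\<in>?K. kscale (u p) (z p)) = (\<Sum>p\<in>?K. kscale (u p) (basis_vec (fst p) (snd p)))" for u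
    using kT_hom_sum[OF \<psi>, of ?K z u] z by simp
  have zN: "(\<Sum>p\<in>?K. kscale (u p) (z p)) \<in> ?N" for u
    using z by (intro kv.subspace_sum kv.subspace_scale subspace_nil_mod) auto
  show "kv.dim ?N = kv.dim W + card ?K"
    unfolding WV
  proof (rule codim_eq[OF sV _ subspace_nil_mod _ _ K])
    show "V \<subseteq> ?N" by (auto simp: V_def)
    show "finite ((\<lambda>p. basis_vec (fst p) (snd p) :: 'k kT_elem) ` boxes \<beta> 0)"
      using finite_boxes[OF fin(2)] by simp
    show "?N \<subseteq> kv.span ((\<lambda>p. basis_vec (fst p) (snd p)) ` boxes \<beta> 0)"
    proof
      fix x :: "'k kT_elem" assume "x \<in> ?N"
      then have "x = (\<Sum>p\<in>boxes \<beta> 0. kscale (coeff (x (fst p)) (snd p)) (basis_vec (fst p) (snd p)))"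
        by (intro nil_mod_expand[OF fin(2)]) auto
      also have "\<dots> \<in> kv.span ((\<lambda>p. basis_vec (fst p) (snd p)) ` boxes \<beta> 0)"
        by (intro kv.span_sum kv.span_scale kv.span_base) blast
      finally show "x \<in> kv.span ((\<lambda>p. basis_vec (fst p) (snd p)) ` boxes \<beta> 0)" .
    qed
    show "z k \<in> ?N" if "k \<in> ?K" for k using z that by blast
    fix u assume u: "(\<Sum>p\<in>?K. kscale (u p) (z p)) \<in> V"
    show "\<forall>k\<in>?K. u k = 0"
    proof
      fix k assume k: "k \<in> ?K"
      obtain c m where cm: "k = (c, m)" by (cases k)
      have "m < j" using k by (simp add: cm boxes_def)
      then have "coeff (\<psi> (\<Sum>p\<in>?K. kscale (u p) (z p)) c) m = 0" using u by (simp add: V_def)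
      then show "u k = 0" using k unfolding \<psi>z coeff_sum_basis[OF K] by (simp add: cm)
    qed
  next
    fix v :: "'k kT_elem" assume v: "v \<in> ?N"
    define u where "u p = coeff (\<psi> v (fst p)) (snd p)" for p
    let ?s = "\<Sum>p\<in>?K. kscale (u p) (z p)"
    have "v - ?s \<in> ?N" using v zN nil_mod_diff by blast
    moreover have "coeff (\<psi> (v - ?s) c) m = 0" if "m < j" for c m
    proof -
      have "\<psi> v = \<psi> (v - ?s) + \<psi> ?s" using hom(2)[OF nil_mod_diff[OF v zN] zN, of u u] by simp
      then have "coeff (\<psi> v c) m = coeff (\<psi> (v - ?s) c) m + coeff (\<psi> ?s c) m" by simp
      moreover have "coeff (\<psi> ?s c) m = coeff (\<psi> v c) m"
        using hom(1)[OF v] that unfolding \<psi>z coeff_sum_basis[OF K]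
        by (auto simp: boxes_def u_def carrier_nil_mod not_less)
      ultimately show ?thesis by simp
    qed
    ultimately show "\<exists>u. v - (\<Sum>p\<in>?K. kscale (u p) (z p)) \<in> V" by (auto simp: V_def)
  qed
qed

lemma kT_hom_subset_k_hom: "kT_hom \<alpha> \<beta> \<subseteq> k_hom \<alpha> \<beta>"
  unfolding kT_hom_def k_hom_def mod_hom_def by (intro Collect_mono) (simp del: smult_nil_mod)

lemma generator_coord:
  assumes "x \<in> boxes \<alpha> i <+> boxes \<beta> j" "p \<in> boxes \<beta> 0"
  shows "(\<lambda>f. coeff (generator f x (fst p)) (snd p)) \<in> poly_funs (hom_coords \<alpha> \<beta>)"
proof (cases x)
  case (Inl q)
  have "(\<lambda>f. coeff (f (basis_vec (fst q) (snd q)) (fst p)) (snd p)) \<in> hom_coords \<alpha> \<beta>"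
    unfolding hom_coords_def using assms Inl by (cases p, cases q) (auto simp: boxes_def)
  then show ?thesis using Inl by (auto simp: generator_def intro: poly_funs.coord)
next
  case (Inr q)
  then show ?thesis by (simp add: generator_def poly_funs.const)
qed

lemma nil_mod_eq_0_iff:
  assumes "v \<in> carrier (nil_mod \<beta>)"
  shows "v = 0 \<longleftrightarrow> (\<forall>p\<in>boxes \<beta> 0. coeff (v (fst p)) (snd p) = 0)"
proof
  assume z: "\<forall>p\<in>boxes \<beta> 0. coeff (v (fst p)) (snd p) = 0"
  have "coeff (v c) m = 0" for c m
    using assms z by (cases "m < \<beta> c") (force simp: carrier_nil_mod boxes_def)+
  then show "v = 0" by (auto simp: fun_eq_iff poly_eq_iff)
qed auto

lemma layer_le: "layer \<beta> \<Gamma> i c \<le> \<beta> c"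
proof -
  have "layer \<beta> \<Gamma> i c \<le> card {..<\<beta> c}"
    unfolding layer_def by (rule card_mono) auto
  then show ?thesis by simp
qed

lemma finite_layer:
  assumes "finite {c. \<beta> c \<noteq> 0}"
  shows "finite {c. layer \<beta> \<Gamma> i c \<noteq> 0}"
proof (rule finite_subset[OF _ assms], rule Collect_mono, intro impI notI)
  fix c assume "layer \<beta> \<Gamma> i c \<noteq> 0" "\<beta> c = 0"
  then show False using layer_le[of \<beta> \<Gamma> i c] by simp
qed

lemma boundary_step_le_dom:
  assumes part: "is_partition \<alpha>" "is_partition \<beta>"
    and step: "boundary_step TYPE('k::field) \<alpha> \<beta> \<gamma> \<Gamma> \<Gamma>'"
  shows "le_dom \<alpha> \<beta> \<Gamma> \<Gamma>'"
  unfolding le_dom_def le_nat_def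
proof (intro allI impI)
  fix i j assume i: "i \<le> \<alpha> 0"
  have fin: "finite {c. \<alpha> c \<noteq> 0}" "finite {c. \<beta> c \<noteq> 0}" using part by (auto simp: is_partition_def)
  let ?N = "carrier (nil_mod \<beta>) :: 'k kT_elem set" and ?X = "boxes \<alpha> i <+> boxes \<beta> j"
  let ?W = "\<lambda>f. kv.span (generator f ` ?X)"
  have finX: "finite ?X" using finite_boxes fin by auto
  obtain f' :: "'k kT_elem \<Rightarrow> 'k kT_elem" where f': "f' \<in> V_tab \<alpha> \<beta> \<gamma> \<Gamma>'"
    and cl: "f' \<in> V_top \<alpha> \<beta> \<gamma> closure_of V_tab \<alpha> \<beta> \<gamma> \<Gamma>"
    using step by (auto simp: boundary_step_def)
  have tab: "f \<in> kT_hom \<alpha> \<beta> \<and> mod_iso (carrier ring_of_type_algebra)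
       (quot_module (nil_mod \<beta>) (f ` T_power_image i \<alpha>)) (nil_mod (layer \<beta> \<Delta> i) :: ('k poly, _) module)"
    if "f \<in> V_tab \<alpha> \<beta> \<gamma> \<Delta>" for f \<Delta>
    using that i by (auto simp: V_tab_def V_shape_def has_tableau_def)
  have codim: "?W f \<subseteq> ?N" "kv.dim ?N = kv.dim (?W f) + (\<Sum>l=1..j. conj_part (layer \<beta> \<Delta> i) l)"
    if "f \<in> V_tab \<alpha> \<beta> \<gamma> \<Delta>" for f \<Delta>
    using codim_generators[OF conjunct1[OF tab[OF that]] fin finite_layer[OF fin(2)] conjunct2[OF tab[OF that]], of j]
    unfolding sum_conj_part[OF finite_layer[OF fin(2)]] by auto
  \<comment> \<open>A basis of the span at the limit map \<open>f'\<close> is selected among the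
    generators. Only its index set \<open>J\<close> is kept when the map varies.\<close>
  obtain B where B: "B \<subseteq> generator f' ` ?X" "kv.independent B" "generator f' ` ?X \<subseteq> kv.span B"
    using kv.maximal_independent_subset[of "generator f' ` ?X"] by blast
  then obtain J where J: "J \<subseteq> ?X" "inj_on (generator f') J" "B = generator f' ` J"
    by (auto simp: subset_image_inj)
  have finJ: "finite J" using J(1) finX by (rule finite_subset)
  have "kv.span B = ?W f'" using B by (simp add: kv.span_eq kv.span_superset subset_trans[OF B(1) kv.span_superset])
  then have dim': "kv.dim (?W f') = card J"
    using kv.dim_span_eq_card_independent[OF B(2)] card_image[OF J(2)] J(3) by simp
  have gN: "generator f x \<in> ?N" if "f \<in> V_tab \<alpha> \<beta> \<gamma> \<Delta>" "x \<in> J" for f \<Delta> x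
    using codim(1)[OF that(1)] kv.span_base[of "generator f x" "generator f ` ?X"] J(1) that(2) by blast
  have zero_iff: "(\<Sum>x\<in>J. kscale (u x) (generator f x)) = 0 \<longleftrightarrow>
      (\<forall>p\<in>boxes \<beta> 0. (\<Sum>x\<in>J. u x * coeff (generator f x (fst p)) (snd p)) = 0)"
    if f: "f \<in> V_tab \<alpha> \<beta> \<gamma> \<Delta>" for f \<Delta> and u :: "_ \<Rightarrow> 'k"
  proof -
    have "(\<Sum>x\<in>J. kscale (u x) (generator f x)) \<in> ?N"
      using gN[OF f] by (intro kv.subspace_sum kv.subspace_scale subspace_nil_mod)
    then show ?thesis by (simp add: nil_mod_eq_0_iff sum_fun_apply coeff_sum)
  qed
  have "\<exists>p\<in>poly_funs (hom_coords \<alpha> \<beta>). p f' \<noteq> 0 \<and>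
    (\<forall>f u. p f \<noteq> 0 \<longrightarrow> (\<forall>q\<in>boxes \<beta> 0. (\<Sum>x\<in>J. u x * coeff (generator f x (fst q)) (snd q)) = 0) \<longrightarrow> (\<forall>x\<in>J. u x = 0))"
  proof (rule independent_family_open[OF finJ])
    show "(\<lambda>f. coeff (generator f x (fst q)) (snd q)) \<in> poly_funs (hom_coords \<alpha> \<beta>)"
      if "x \<in> J" "q \<in> boxes \<beta> 0" for x q
      using generator_coord J(1) that by blast
    fix u :: "(nat \<times> nat) + (nat \<times> nat) \<Rightarrow> 'k" assume "\<And>q. q \<in> boxes \<beta> 0 \<Longrightarrow> (\<Sum>x\<in>J. u x * coeff (generator f' x (fst q)) (snd q)) = 0"
    then have "(\<Sum>x\<in>J. kscale (u x) (generator f' x)) = 0" using zero_iff[OF f'] by blast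
    then show "\<forall>x\<in>J. u x = 0"
      using independent_familyD[OF finJ J(2)] B(2) J(3) by blast
  qed
  then obtain p where p: "p \<in> poly_funs (hom_coords \<alpha> \<beta>)" "p f' \<noteq> 0"
    "\<And>f u. p f \<noteq> 0 \<Longrightarrow> (\<forall>q\<in>boxes \<beta> 0. (\<Sum>x\<in>J. u x * coeff (generator f x (fst q)) (snd q)) = 0) \<Longrightarrow> (\<forall>x\<in>J. u x = 0)"
    by blast
  let ?E = "k_hom \<alpha> \<beta> :: ('k kT_elem \<Rightarrow> 'k kT_elem) set"
  let ?U = "?E - zero_locus ?E {p}"
  have U: "?U = {f \<in> ?E. p f \<noteq> 0}" by (auto simp: zero_locus_def)
  have "openin (zariski ?E (hom_coords \<alpha> \<beta>)) ?U"
    unfolding openin_zariski zariski_open_def using p(1) by blast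
  then have "openin (V_top \<alpha> \<beta> \<gamma>) (?U \<inter> V_shape \<alpha> \<beta> \<gamma>)"
    unfolding V_top_def openin_subtopology by blast
  moreover have "f' \<in> ?U \<inter> V_shape \<alpha> \<beta> \<gamma>"
  proof (rule IntI)
    have "f' \<in> ?E" by (rule subsetD[OF kT_hom_subset_k_hom conjunct1[OF tab[OF f']]])
    then show "f' \<in> ?U" unfolding U using p(2) by blast
    show "f' \<in> V_shape \<alpha> \<beta> \<gamma>" using f' unfolding V_tab_def by blast
  qed
  \<comment> \<open>The neighbourhood of \<open>f'\<close> on which the family indexed by
    \<open>J\<close> stays independent meets the variety of the first tableau.\<close>
  ultimately have "\<exists>f. f \<in> V_tab \<alpha> \<beta> \<gamma> \<Gamma> \<and> f \<in> ?U \<inter> V_shape \<alpha> \<beta> \<gamma>"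
    using conjunct2[OF cl[unfolded in_closure_of], rule_format, of "?U \<inter> V_shape \<alpha> \<beta> \<gamma>"] by blast
  then obtain f where f: "f \<in> V_tab \<alpha> \<beta> \<gamma> \<Gamma>" "f \<in> ?U" by blast
  have ind: "\<forall>x\<in>J. u x = 0" if "(\<Sum>x\<in>J. kscale (u x) (generator f x)) = 0" for u
    using p(3)[of f u] that f(2) unfolding zero_iff[OF f(1)] U by blast
  note indep = independent_image_family[OF finJ ind]
  obtain D where D: "D \<subseteq> ?W f" "kv.independent D" "?W f \<subseteq> kv.span D" "card D = kv.dim (?W f)"
    using kv.basis_exists by blast
  have finD: "finite D"
    using kv.independent_span_bound[OF _ D(2,1)] finX by simp
  have "generator f ` J \<subseteq> kv.span D"
    using D(3) J(1) kv.span_superset[of "generator f ` ?X"] by blast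
  then have "card (generator f ` J) \<le> card D"
    using kv.independent_span_bound[OF finD indep(2)] by blast
  moreover have "card (generator f ` J) = card J" by (rule card_image, rule indep(1))
  ultimately have "kv.dim (?W f') \<le> kv.dim (?W f)"
    unfolding dim' D(4) by linarith
  \<comment> \<open>Both spans lie in the same space, so the smaller dimension at \<open>f'\<close>
    means the larger codimension.\<close>
  then show "(\<Sum>l=1..j. conj_part (layer \<beta> \<Gamma> i) l) \<le> (\<Sum>l=1..j. conj_part (layer \<beta> \<Gamma>' i) l)"
    using codim(2)[OF f(1)] codim(2)[OF f'] by linarith
qed

lemma le_boundary_le_dom:
  assumes "is_partition \<alpha>" "is_partition \<beta>" "le_boundary TYPE('k::field) \<alpha> \<beta> \<gamma> \<Gamma> \<Gamma>'"
  shows "le_dom \<alpha> \<beta> \<Gamma> \<Gamma>'"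
  using assms(3) unfolding le_boundary_def
proof (induction rule: tranclp_induct)
  case (base \<Delta>)
  then show ?case by (rule boundary_step_le_dom[OF assms(1,2)])
next
  case (step \<Delta> \<Delta>')
  then have "le_dom \<alpha> \<beta> \<Delta> \<Delta>'" using boundary_step_le_dom[OF assms(1,2)] by blast
  with step.IH show ?case unfolding le_dom_def le_nat_def by (meson order_trans)
qed

section \<open>Chains in tableaux on horizontal strips\<close>

text \<open>Match from the right, the largest \<open>b\<close> with the largest \<open>a\<close>.
  Removing this pair lowers both counts by one for every \<open>c\<close> up to \<open>b0\<close>,
  and no element of \<open>B\<close> exceeds \<open>b0\<close>; so the counting condition
  persists.\<close>

lemma greedy_matching:
  fixes A B :: "nat set"
  assumes "finite A" "finite B" "\<And>c. card {b \<in> B. c \<le> b} \<le> card {a \<in> A. c \<le> a}"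
  shows "\<exists>m. inj_on m B \<and> (\<forall>b\<in>B. m b \<in> A \<and> b \<le> m b)"
  using assms
proof (induction "card B" arbitrary: A B)
  case 0
  then show ?case by auto
next
  case (Suc n)
  define b0 a0 where "b0 = Max B" and "a0 = Max A"
  have B: "B \<noteq> {}" using Suc.hyps(2) by auto
  have b0: "b0 \<in> B" "\<And>b. b \<in> B \<Longrightarrow> b \<le> b0" using Suc.prems B by (auto simp: b0_def)
  have "0 < card {b \<in> B. b0 \<le> b}" using b0 Suc.prems by (auto simp: card_gt_0_iff)
  then have "{a \<in> A. b0 \<le> a} \<noteq> {}" using Suc.prems(3)[of b0] by force
  then obtain a where a: "a \<in> A" "b0 \<le> a" by blast
  have "A \<noteq> {}" using a by blast
  then have a0: "a0 \<in> A" "\<And>a. a \<in> A \<Longrightarrow> a \<le> a0" using Suc.prems(1) Max_in[OF Suc.prems(1)] by (auto simp: a0_def)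
  have ba: "b0 \<le> a0" using a a0(2) by force
  have "\<exists>m. inj_on m (B - {b0}) \<and> (\<forall>b\<in>B - {b0}. m b \<in> A - {a0} \<and> b \<le> m b)"
  proof (rule Suc.hyps(1))
    show "n = card (B - {b0})" using Suc.hyps(2) b0 Suc.prems by simp
    show "finite (A - {a0})" "finite (B - {b0})" using Suc.prems by auto
    fix c
    show "card {b \<in> B - {b0}. c \<le> b} \<le> card {a \<in> A - {a0}. c \<le> a}"
    proof (cases "c \<le> b0")
      case True
      have "{b \<in> B - {b0}. c \<le> b} = {b \<in> B. c \<le> b} - {b0}" "{a \<in> A - {a0}. c \<le> a} = {a \<in> A. c \<le> a} - {a0}" by auto
      then show ?thesis using Suc.prems(1,2) Suc.prems(3)[of c] True ba a0 b0 by simp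
    next
      case False
      then have "{b \<in> B - {b0}. c \<le> b} = {}" using b0 by force
      then show ?thesis by (metis card.empty le0)
    qed
  qed
  then obtain m where m: "inj_on m (B - {b0})" "\<And>b. b \<in> B - {b0} \<Longrightarrow> m b \<in> A - {a0} \<and> b \<le> m b" by blast
  have "inj_on (m(b0 := a0)) B"
    using m by (fastforce simp: inj_on_def)
  moreover have "\<forall>b\<in>B. (m(b0 := a0)) b \<in> A \<and> b \<le> (m(b0 := a0)) b"
    using m(2) a0(1) ba by auto
  ultimately show ?case by blast
qed

text \<open>Chain indices are assigned from the highest level downwards, each level extending the
  indices transported from the level above along the matching.\<close>

lemma chain_labelling_exists:
  fixes e :: "'c \<Rightarrow> nat"
  assumes bound: "\<And>c. e c \<le> L" and fin: "finite {c. e c \<noteq> 0}"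
    and match: "\<And>l. 0 < l \<Longrightarrow> \<exists>m. inj_on m {c. e c = Suc l} \<and> (\<forall>b. e b = Suc l \<longrightarrow> e (m b) = l \<and> R (m b) b)"
  shows "\<exists>ch. \<forall>l>0. bij_betw ch {c. e c = l} {..<card {c. e c = l}} \<and>
    (\<forall>b b'. e b = Suc l \<longrightarrow> e b' = l \<longrightarrow> ch b = ch b' \<longrightarrow> R b' b)"
proof -
  let ?Q = "\<lambda>ch l. bij_betw ch {c. e c = l} {..<card {c. e c = l}} \<and>
    (\<forall>b b'. e b = Suc l \<longrightarrow> e b' = l \<longrightarrow> ch b = ch b' \<longrightarrow> R b' b)"
  have "\<exists>ch. \<forall>l>0. ?Q ch l"
  proof (rule inc_induct[of 0 L "\<lambda>j. \<exists>ch. \<forall>l>j. ?Q ch l"])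
    have "{c. e c = l} = {}" if "l > L" for l using that bound by (auto simp: not_le[symmetric])
    moreover have "e b \<noteq> Suc l" if "l > L" for l b using that bound[of b] by auto
    ultimately show "\<exists>ch. \<forall>l>L. ?Q ch l" by (auto simp: bij_betw_def)
  next
    fix n assume "\<exists>ch. \<forall>l>Suc n. ?Q ch l"
    then obtain ch where ch: "\<And>l. l > Suc n \<Longrightarrow> ?Q ch l" by blast
    obtain m where m: "inj_on m {c. e c = Suc (Suc n)}"
      "\<And>b. e b = Suc (Suc n) \<Longrightarrow> e (m b) = Suc n \<and> R (m b) b" using match[of "Suc n"] by auto
    let ?U = "{c. e c = Suc (Suc n)}" and ?D = "{c. e c = Suc n}"
    define I where "I = m ` ?U"
    have finD: "finite ?D" "finite ?U" by (rule finite_subset[OF _ fin]; auto)+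
    have ID: "I \<subseteq> ?D" using m by (auto simp: I_def)
    have cI: "card I = card ?U" unfolding I_def using m(1) by (rule card_image)
    have cle: "card ?U \<le> card ?D" using card_mono[OF finD(1) ID] cI by simp
    \<comment> \<open>Columns of this level outside \<open>I\<close> are the last members of their
      chains; they receive the indices following those inherited from the level above.\<close>
    have "card (?D - I) = card {card ?U..<card ?D}"
      using card_Diff_subset[OF finite_subset[OF ID finD(1)] ID] cI by simp
    then obtain g where g: "bij_betw g (?D - I) {card ?U..<card ?D}"
      using finite_same_card_bij[of "?D - I"] finD by (metis finite_Diff finite_atLeastLessThan)
    define ch' where "ch' c = (if e c = Suc n then if c \<in> I then ch (the_inv_into ?U m c) else g c else ch c)" for c
    have bU: "bij_betw ch ?U {..<card ?U}" using ch[of "Suc (Suc n)"] by simp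
    have inv: "the_inv_into ?U m (m b) = b" if "e b = Suc (Suc n)" for b
      using that m(1) by (simp add: the_inv_into_f_f)
    have "bij_betw (the_inv_into ?U m) I ?U"
      unfolding I_def by (rule bij_betw_the_inv_into) (simp add: m(1) bij_betw_imageI)
    from bij_betw_trans[OF this bU]
    have "bij_betw ch' I {..<card ?U}"
      by (rule bij_betw_cong[THEN iffD1, rotated]) (use ID in \<open>auto simp: ch'_def\<close>)
    moreover have "bij_betw ch' (?D - I) {card ?U..<card ?D}"
      using g by (rule bij_betw_cong[THEN iffD1, rotated]) (auto simp: ch'_def)
    ultimately have "bij_betw ch' (I \<union> (?D - I)) ({..<card ?U} \<union> {card ?U..<card ?D})"
      by (rule bij_betw_combine) auto
    moreover have "I \<union> (?D - I) = ?D" using ID by blast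
    moreover have "{..<card ?U} \<union> {card ?U..<card ?D} = {..<card ?D}" using cle by auto
    ultimately have bD: "bij_betw ch' ?D {..<card ?D}" by simp
    have R: "R b' b" if b: "e b = Suc (Suc n)" "e b' = Suc n" "ch' b = ch' b'" for b b'
    proof -
      have chb: "ch' b = ch b" using b by (simp add: ch'_def)
      then have lt: "ch' b < card ?U" using bU b(1) by (auto simp: bij_betw_def)
      have "b' \<in> I"
      proof (rule ccontr)
        assume "b' \<notin> I"
        then have "ch' b' = g b'" "b' \<in> ?D - I" using b by (auto simp: ch'_def)
        then show False using lt b(3) bij_betwE[OF g] by force
      qed
      then obtain b0 where b0: "e b0 = Suc (Suc n)" "b' = m b0" by (auto simp: I_def)
      then have "ch' b' = ch b0" using b inv \<open>b' \<in> I\<close> by (simp add: ch'_def)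
      then have "ch b0 = ch b" using b(3) chb by simp
      then have "b0 = b" using bU b0(1) b(1) by (auto simp: bij_betw_def inj_on_def)
      then show ?thesis using m(2) b0 by blast
    qed
    have "?Q ch' l" if "l > n" for l
    proof (cases "l = Suc n")
      case True then show ?thesis using bD R by simp
    next
      case False
      then have l: "l > Suc n" using that by simp
      have "bij_betw ch' {c. e c = l} {..<card {c. e c = l}}"
        using conjunct1[OF ch[OF l]] by (rule bij_betw_cong[THEN iffD1, rotated]) (use l in \<open>auto simp: ch'_def\<close>)
      then show ?thesis using conjunct2[OF ch[OF l]] l by (auto simp: ch'_def)
    qed
    then show "\<exists>ch. \<forall>l>n. ?Q ch l" by blast
  qed simp
  then show ?thesis .
qed

text \<open>By the bijection, chain \<open>j\<close> has exactly one column for each of the entries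
  1, ..., \<open>\<alpha> j\<close>. The last clause says, avoiding truncated subtraction, that
  \<open>\<beta> c - e c\<close> weakly increases along a chain. This number is the exponent of T in
  the pole, and the clause makes the images triangular.\<close>

definition chain_system :: "(nat \<Rightarrow> nat) \<Rightarrow> (nat \<Rightarrow> nat) \<Rightarrow> (nat \<Rightarrow> nat) \<Rightarrow> (nat \<Rightarrow> nat) \<Rightarrow> bool" where
  "chain_system \<alpha> \<beta> e ch \<longleftrightarrow>
     bij_betw (\<lambda>c. (ch c, e c)) {c. 0 < e c} {(j, l). 0 < l \<and> l \<le> \<alpha> j} \<and>
     (\<forall>c. e c \<le> \<beta> c) \<and>
     (\<forall>c c'. ch c = ch c' \<longrightarrow> 0 < e c \<longrightarrow> e c < e c' \<longrightarrow> \<beta> c + e c' \<le> \<beta> c' + e c)"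

text \<open>A non-increasing sequence has its parts of size at least \<open>l\<close> in an initial
  segment. So labels below \<open>conj_part \<alpha> l\<close> are precisely the chains long enough
  to contain the entry \<open>l\<close>.\<close>

lemma less_conj_part_iff:
  assumes "is_partition \<alpha>" "0 < l"
  shows "j < conj_part \<alpha> l \<longleftrightarrow> l \<le> \<alpha> j"
proof -
  have anti: "\<alpha> i' \<le> \<alpha> i" if "i \<le> i'" for i i' using assms(1) that by (auto simp: is_partition_def antimono_def)
  have "{i. \<alpha> i \<noteq> 0} \<noteq> UNIV" using assms(1) by (auto simp: is_partition_def)
  then obtain i0 where "\<alpha> i0 = 0" by blast
  then have "\<alpha> i0 < l" using assms(2) by simp
  then have ex: "\<exists>i. \<alpha> i < l" by blast
  define n where "n = (LEAST i. \<alpha> i < l)"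
  have "\<alpha> n < l" unfolding n_def using ex by (rule LeastI_ex)
  then have "l \<le> \<alpha> i \<longleftrightarrow> i < n" for i
    using anti[of n i] not_less_Least[of i "\<lambda>i. \<alpha> i < l"] by (auto simp: n_def not_less not_le[symmetric])
  then show ?thesis by (simp add: conj_part_def lessThan_def[symmetric])
qed

text \<open>Strict growth of the length between neighbours suffices: following predecessors, the
  length gains at least one whenever the entry gains one. This gives the last clause and, started at
  an entry 1 in a nonempty column, the bound of the entry by the length.\<close>

lemma chain_systemI:
  assumes \<alpha>: "is_partition \<alpha>"
    and bij: "\<And>l. 0 < l \<Longrightarrow> bij_betw ch {c. e c = l} {..<conj_part \<alpha> l}"
    and step: "\<And>b b'. 0 < e b' \<Longrightarrow> e b = Suc (e b') \<Longrightarrow> ch b = ch b' \<Longrightarrow> \<beta> b' < \<beta> b"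
    and pos: "\<And>c. 0 < e c \<Longrightarrow> 0 < \<beta> c"
  shows "chain_system \<alpha> \<beta> e ch"
proof -
  note iff = less_conj_part_iff[OF \<alpha>]
  have mem: "e c \<le> \<alpha> (ch c)" if "0 < e c" for c
    using bij_betwE[OF bij[OF that]] iff[OF that] by auto
  have ex: "\<exists>c. e c = l \<and> ch c = j" if "0 < l" "l \<le> \<alpha> j" for l j
  proof -
    have "j \<in> ch ` {c. e c = l}" using bij[OF that(1)] iff[OF that(1)] that(2) by (simp add: bij_betw_def)
    then show ?thesis by blast
  qed
  have inj: "c = c'" if "0 < e c" "e c = e c'" "ch c = ch c'" for c c'
    using bij[OF that(1)] that by (auto simp: bij_betw_def inj_on_def)
  have pred: "\<exists>b. e b = e c - 1 \<and> ch b = ch c \<and> \<beta> b < \<beta> c" if "1 < e c" for c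
  proof -
    have "e c \<le> \<alpha> (ch c)" using mem[of c] that by simp
    then have "0 < e c - 1" "e c - 1 \<le> \<alpha> (ch c)" using that by simp_all
    then obtain b where b: "e b = e c - 1" "ch b = ch c" using ex by blast
    then have "\<beta> b < \<beta> c" using that by (intro step) simp_all
    then show ?thesis using b by blast
  qed
  have "e c \<le> \<beta> c" for c
  proof (induction "e c" arbitrary: c rule: less_induct)
    case less
    show ?case
    proof (cases "1 < e c")
      case True
      then obtain b where "e b = e c - 1" "\<beta> b < \<beta> c" using pred by blast
      then show ?thesis using less[of b] True by simp
    next
      case False then show ?thesis using pos[of c] by (cases "e c = 0") auto
    qed
  qed
  moreover have "\<beta> c + e c' \<le> \<beta> c' + e c" if "ch c = ch c'" "0 < e c" "e c < e c'" for c c'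
    using that
  proof (induction "e c'" arbitrary: c' rule: less_induct)
    case less
    then have "1 < e c'" by simp
    then obtain b where b: "e b = e c' - 1" "ch b = ch c'" "\<beta> b < \<beta> c'" using pred by blast
    show ?case
    proof (cases "e c < e b")
      case True then show ?thesis using less.hyps[of b] less.prems b by simp
    next
      case False
      then have "c = b" using inj[of c b] less.prems b by simp
      then show ?thesis using b less.prems by simp
    qed
  qed
  moreover have "bij_betw (\<lambda>c. (ch c, e c)) {c. 0 < e c} {(j, l). 0 < l \<and> l \<le> \<alpha> j}"
    unfolding bij_betw_def
  proof
    show "inj_on (\<lambda>c. (ch c, e c)) {c. 0 < e c}" using inj by (auto simp: inj_on_def)
    show "(\<lambda>c. (ch c, e c)) ` {c. 0 < e c} = {(j, l). 0 < l \<and> l \<le> \<alpha> j}"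
    proof (intro subset_antisym subsetI)
      fix p assume "p \<in> {(j, l). 0 < l \<and> l \<le> \<alpha> j}"
      then obtain j l where p: "p = (j, l)" "0 < l" "l \<le> \<alpha> j" by blast
      then obtain c where "e c = l" "ch c = j" using ex by blast
      then show "p \<in> (\<lambda>c. (ch c, e c)) ` {c. 0 < e c}" using p by blast
    qed (use mem in auto)
  qed
  ultimately show ?thesis unfolding chain_system_def by blast
qed

text \<open>In a horizontal strip the only box of column \<open>c\<close> that can carry an entry is
  the first one below \<open>\<gamma> c\<close>; the default value 0 of a tableau marks columns
  without entry.\<close>

definition entry :: "(nat \<Rightarrow> nat) \<Rightarrow> (nat \<times> nat \<Rightarrow> nat) \<Rightarrow> nat \<Rightarrow> nat" where
  "entry \<gamma> \<Gamma> c = \<Gamma> (\<gamma> c, c)"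

text \<open>Translation of a tableau into a function of the column. For the last part the lattice
  condition matches each entry \<open>Suc l\<close> with an entry \<open>l\<close> weakly to the
  right. Both columns cannot have equal length, since the two entries would then share a row and
  decrease along it.\<close>

lemma LR_entry:
  assumes part: "is_partition \<alpha>" "is_partition \<beta>" and strip: "horizontal_strip \<beta> \<gamma>"
    and LR: "\<Gamma> \<in> LR_tableaux \<alpha> \<beta> \<gamma>"
  shows "(r, c) \<in> skew \<beta> \<gamma> \<longleftrightarrow> r = \<gamma> c \<and> 0 < entry \<gamma> \<Gamma> c"
    and "\<beta> c = \<gamma> c + (if 0 < entry \<gamma> \<Gamma> c then 1 else 0)"
    and "entry \<gamma> \<Gamma> c \<le> \<alpha> 0"
    and "finite {c. entry \<gamma> \<Gamma> c \<noteq> 0}"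
    and "0 < l \<Longrightarrow> card {c. entry \<gamma> \<Gamma> c = l} = conj_part \<alpha> l"
    and "layer \<beta> \<Gamma> i c = \<beta> c - (if i < entry \<gamma> \<Gamma> c then 1 else 0)"
    and "0 < l \<Longrightarrow> \<exists>m. inj_on m {c. entry \<gamma> \<Gamma> c = Suc l} \<and>
      (\<forall>b. entry \<gamma> \<Gamma> b = Suc l \<longrightarrow> entry \<gamma> \<Gamma> (m b) = l \<and> \<beta> (m b) < \<beta> b)"
proof -
  let ?e = "entry \<gamma> \<Gamma>"
  have le: "\<gamma> c \<le> \<beta> c" for c using LR by (simp add: LR_tableaux_def)
  have st: "\<beta> c \<le> \<gamma> c + 1" for c using strip by (simp add: horizontal_strip_def)
  have out: "b \<notin> skew \<beta> \<gamma> \<Longrightarrow> \<Gamma> b = 0" for b using LR unfolding LR_tableaux_def by blast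
  have rng: "b \<in> skew \<beta> \<gamma> \<Longrightarrow> 1 \<le> \<Gamma> b \<and> \<Gamma> b \<le> \<alpha> 0" for b using LR unfolding LR_tableaux_def by blast
  have crd: "l \<in> {1..\<alpha> 0} \<Longrightarrow> card {b \<in> skew \<beta> \<gamma>. \<Gamma> b = l} = conj_part \<alpha> l" for l using LR unfolding LR_tableaux_def by blast
  have row: "(r, c) \<in> skew \<beta> \<gamma> \<Longrightarrow> (r, c') \<in> skew \<beta> \<gamma> \<Longrightarrow> c \<le> c' \<Longrightarrow> \<Gamma> (r, c) \<le> \<Gamma> (r, c')" for r c c'
    using LR unfolding LR_tableaux_def by blast
  have lat: "1 < l \<Longrightarrow> card {(r, c'). (r, c') \<in> skew \<beta> \<gamma> \<and> c' > c \<and> \<Gamma> (r, c') = l}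
                \<le> card {(r, c'). (r, c') \<in> skew \<beta> \<gamma> \<and> c' > c \<and> \<Gamma> (r, c') = l - 1}" for l c
    using LR unfolding LR_tableaux_def by blast
  have skew: "(r, c) \<in> skew \<beta> \<gamma> \<longleftrightarrow> r = \<gamma> c \<and> \<beta> c = \<gamma> c + 1" for r c
    using le[of c] st[of c] by (auto simp: skew_def)
  have pos: "0 < ?e c \<longleftrightarrow> \<beta> c = \<gamma> c + 1" for c
  proof (cases "(\<gamma> c, c) \<in> skew \<beta> \<gamma>")
    case True
    then show ?thesis using rng[OF True] by (simp add: skew entry_def)
  next
    case False
    then show ?thesis using out[OF False] by (simp add: skew entry_def)
  qed
  show sk: "(r, c) \<in> skew \<beta> \<gamma> \<longleftrightarrow> r = \<gamma> c \<and> 0 < ?e c" for r c by (simp add: skew pos)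
  show \<beta>: "\<beta> c = \<gamma> c + (if 0 < ?e c then 1 else 0)" for c using pos[of c] le[of c] st[of c] by auto
  show eb: "?e c \<le> \<alpha> 0" for c
  proof (cases "?e c = 0")
    case False
    then have "(\<gamma> c, c) \<in> skew \<beta> \<gamma>" unfolding sk by simp
    then show ?thesis using rng unfolding entry_def by blast
  qed simp
  have "{c. ?e c \<noteq> 0} \<subseteq> {c. \<beta> c \<noteq> 0}" using \<beta> by auto
  then show fin: "finite {c. ?e c \<noteq> 0}"
    by (rule finite_subset) (use part(2) in \<open>simp add: is_partition_def\<close>)
  have finl: "finite {c. ?e c = l}" if "0 < l" for l
    by (rule finite_subset[OF _ fin]) (use that in auto)
  show crd': "card {c. ?e c = l} = conj_part \<alpha> l" if "0 < l" for l
  proof (cases "l \<le> \<alpha> 0")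
    case True
    have "card {b \<in> skew \<beta> \<gamma>. \<Gamma> b = l} = card {c. ?e c = l}"
      by (rule bij_betw_same_card[of snd], rule bij_betw_byWitness[where f' = "\<lambda>c. (\<gamma> c, c)"])
        (use that in \<open>auto simp: sk entry_def\<close>)
    then show ?thesis using crd[of l] True that by simp
  next
    case False
    then have "{c. ?e c = l} = {}" using eb by auto
    moreover have "{i. l \<le> \<alpha> i} = {}"
      using False part(1) by (auto simp: is_partition_def antimono_def) (meson le0 le_trans)
    ultimately show ?thesis by (simp add: conj_part_def)
  qed
  show "layer \<beta> \<Gamma> i c = \<beta> c - (if i < ?e c then 1 else 0)"
  proof -
    have z: "\<Gamma> (r, c) = 0" if "r < \<gamma> c" for r using out[of "(r, c)"] sk[of r c] that by auto
    have "{r. r < \<beta> c \<and> \<Gamma> (r, c) \<le> i} = {..<\<beta> c - (if i < ?e c then 1 else 0)}"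
    proof (cases "0 < ?e c")
      case True
      then have b: "\<beta> c = Suc (\<gamma> c)" using \<beta> by simp
      have g: "\<Gamma> (\<gamma> c, c) = ?e c" by (simp add: entry_def)
      show ?thesis using z g by (auto simp: b less_Suc_eq)
    next
      case False
      then show ?thesis using z \<beta>[of c] by auto
    qed
    then show ?thesis by (simp add: layer_def)
  qed
  show "\<exists>m. inj_on m {c. ?e c = Suc l} \<and> (\<forall>b. ?e b = Suc l \<longrightarrow> ?e (m b) = l \<and> \<beta> (m b) < \<beta> b)" if l: "0 < l"
  proof -
    have cnt: "card {(r, c'). (r, c') \<in> skew \<beta> \<gamma> \<and> c' > c \<and> \<Gamma> (r, c') = k} = card {c'. c' > c \<and> ?e c' = k}"
      if "0 < k" for c k
      by (rule bij_betw_same_card[of snd], rule bij_betw_byWitness[where f' = "\<lambda>c. (\<gamma> c, c)"])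
        (use that in \<open>auto simp: sk entry_def\<close>)
    have "\<exists>m. inj_on m {c. ?e c = Suc l} \<and> (\<forall>b\<in>{c. ?e c = Suc l}. m b \<in> {c. ?e c = l} \<and> b \<le> m b)"
    proof (rule greedy_matching)
      show "finite {c. ?e c = l}" "finite {c. ?e c = Suc l}" using l finl by auto
      fix c
      show "card {b \<in> {c. ?e c = Suc l}. c \<le> b} \<le> card {b \<in> {c. ?e c = l}. c \<le> b}"
      proof (cases c)
        \<comment> \<open>The lattice condition counts strictly to the right of a column and so
          never covers column 0; the total counts are compared through the content instead.\<close>
        case 0
        have "conj_part \<alpha> (Suc l) \<le> conj_part \<alpha> l"
          unfolding conj_part_def using part(1) l
          by (intro card_mono) (auto simp: is_partition_def elim!: rev_finite_subset)
        then show ?thesis using crd'[of l] crd'[of "Suc l"] l 0 by simp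
      next
        case (Suc d)
        have "{b \<in> {c. ?e c = k}. c \<le> b} = {c'. c' > d \<and> ?e c' = k}" for k using Suc by auto
        then show ?thesis using lat[of "Suc l" d] cnt[of "Suc l" d] cnt[of l d] l by simp
      qed
    qed
    then obtain m where m: "inj_on m {c. ?e c = Suc l}" "\<And>b. ?e b = Suc l \<Longrightarrow> ?e (m b) = l \<and> b \<le> m b" by auto
    have "\<beta> (m b) < \<beta> b" if b: "?e b = Suc l" for b
    proof (rule ccontr)
      assume "\<not> \<beta> (m b) < \<beta> b"
      moreover have "\<beta> (m b) \<le> \<beta> b" using part(2) m(2)[OF b] by (auto simp: is_partition_def antimono_def)
      ultimately have "\<gamma> (m b) = \<gamma> b" using \<beta>[of b] \<beta>[of "m b"] m(2)[OF b] b l by simp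
      then have "\<Gamma> (\<gamma> b, b) \<le> \<Gamma> (\<gamma> b, m b)"
        using m(2)[OF b] b l by (intro row) (auto simp: sk)
      then show False using m(2)[OF b] b \<open>\<gamma> (m b) = \<gamma> b\<close> by (simp add: entry_def)
    qed
    then show ?thesis using m by blast
  qed
qed

section \<open>Chain systems of tableaux and their behaviour under box moves\<close>

lemma LR_chain_system:
  assumes part: "is_partition \<alpha>" "is_partition \<beta>" and strip: "horizontal_strip \<beta> \<gamma>"
    and LR: "\<Gamma> \<in> LR_tableaux \<alpha> \<beta> \<gamma>"
  shows "\<exists>ch. chain_system \<alpha> \<beta> (entry \<gamma> \<Gamma>) ch"
proof -
  note LR' = LR_entry[OF part strip LR]
  obtain ch where ch: "\<And>l. l > 0 \<Longrightarrow> bij_betw ch {c. entry \<gamma> \<Gamma> c = l} {..<card {c. entry \<gamma> \<Gamma> c = l}} \<and>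
    (\<forall>b b'. entry \<gamma> \<Gamma> b = Suc l \<longrightarrow> entry \<gamma> \<Gamma> b' = l \<longrightarrow> ch b = ch b' \<longrightarrow> \<beta> b' < \<beta> b)"
    using chain_labelling_exists[OF LR'(3,4,7)] by blast
  have "chain_system \<alpha> \<beta> (entry \<gamma> \<Gamma>) ch"
  proof (rule chain_systemI[OF part(1)])
    show "bij_betw ch {c. entry \<gamma> \<Gamma> c = l} {..<conj_part \<alpha> l}" if "0 < l" for l
      using ch[OF that] LR'(5)[OF that] by simp
    show "\<beta> b' < \<beta> b" if "0 < entry \<gamma> \<Gamma> b'" "entry \<gamma> \<Gamma> b = Suc (entry \<gamma> \<Gamma> b')" "ch b = ch b'" for b b'
      using ch[OF that(1)] that by blast
    show "0 < \<beta> c" if "0 < entry \<gamma> \<Gamma> c" for c using LR'(2)[of c] that by simp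
  qed
  then show ?thesis by blast
qed

text \<open>Transporting by \<open>\<tau>\<close> keeps the entries and exchanges two lengths
  instead: \<open>c\<^sub>1\<close> gets longer and \<open>c\<^sub>2\<close> shorter. A matching for
  the original lengths survives this unless it hits \<open>c\<^sub>1\<close> as a value or
  \<open>c\<^sub>2\<close> as an argument, that is, unless \<open>l = e c\<^sub>1\<close> or
  \<open>Suc l = e c\<^sub>2\<close>. In these two cases \<open>e c\<^sub>2 < e c\<^sub>1\<close>
  rules out the bad incidences for the transported matching of the exchanged entries, which then
  serves both.\<close>

lemma joint_matching:
  fixes e \<beta> :: "'c \<Rightarrow> nat" and c\<^sub>1 c\<^sub>2 :: 'c
  defines "\<tau> \<equiv> Transposition.transpose c\<^sub>1 c\<^sub>2"
  assumes e: "e c\<^sub>2 < e c\<^sub>1" and \<beta>: "\<beta> c\<^sub>1 < \<beta> c\<^sub>2"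
    and m: "\<exists>m. inj_on m {c. e c = Suc l} \<and> (\<forall>b. e b = Suc l \<longrightarrow> e (m b) = l \<and> \<beta> (m b) < \<beta> b)"
    and m': "\<exists>m. inj_on m {c. e (\<tau> c) = Suc l} \<and> (\<forall>b. e (\<tau> b) = Suc l \<longrightarrow> e (\<tau> (m b)) = l \<and> \<beta> (m b) < \<beta> b)"
  shows "\<exists>m. inj_on m {c. e c = Suc l} \<and>
    (\<forall>b. e b = Suc l \<longrightarrow> e (m b) = l \<and> \<beta> (m b) < \<beta> b \<and> \<beta> (\<tau> (m b)) < \<beta> (\<tau> b))"
proof -
  have \<tau>\<tau>: "\<tau> (\<tau> c) = c" for c by (simp add: \<tau>_def)
  have dec: "\<beta> (\<tau> c) \<le> \<beta> c" if "c \<noteq> c\<^sub>1" for c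
    using that \<beta> by (auto simp: \<tau>_def Transposition.transpose_def)
  have inc: "\<beta> c \<le> \<beta> (\<tau> c)" if "c \<noteq> c\<^sub>2" for c
    using that \<beta> by (auto simp: \<tau>_def Transposition.transpose_def)
  have t1: "\<tau> c\<^sub>1 = c\<^sub>2" by (simp add: \<tau>_def)
  show ?thesis
  proof (cases "Suc l = e c\<^sub>2 \<or> l = e c\<^sub>1")
    case True
    obtain m where m: "inj_on m {c. e (\<tau> c) = Suc l}"
      "\<And>b. e (\<tau> b) = Suc l \<Longrightarrow> e (\<tau> (m b)) = l \<and> \<beta> (m b) < \<beta> b" using m' by blast
    have "inj_on (\<lambda>b. \<tau> (m (\<tau> b))) {c. e c = Suc l}"
    proof (rule inj_onI)
      fix a b assume ab: "a \<in> {c. e c = Suc l}" "b \<in> {c. e c = Suc l}" "\<tau> (m (\<tau> a)) = \<tau> (m (\<tau> b))"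
      then have "m (\<tau> a) = m (\<tau> b)" by (metis \<tau>\<tau>)
      moreover have "\<tau> a \<in> {c. e (\<tau> c) = Suc l}" "\<tau> b \<in> {c. e (\<tau> c) = Suc l}"
        using ab(1,2) by (simp_all add: \<tau>\<tau>)
      ultimately have "\<tau> a = \<tau> b" by (rule inj_onD[OF m(1)])
      then show "a = b" by (metis \<tau>\<tau>)
    qed
    moreover have "e (\<tau> (m (\<tau> b))) = l \<and> \<beta> (\<tau> (m (\<tau> b))) < \<beta> b \<and> \<beta> (\<tau> (\<tau> (m (\<tau> b)))) < \<beta> (\<tau> b)"
      if b: "e b = Suc l" for b
    proof -
      have m2: "e (\<tau> (m (\<tau> b))) = l" "\<beta> (m (\<tau> b)) < \<beta> (\<tau> b)" using m(2)[of "\<tau> b"] b by (auto simp: \<tau>\<tau>)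
      have "m (\<tau> b) \<noteq> c\<^sub>1" using m2(1) True e t1 by auto
      moreover have "b \<noteq> c\<^sub>1" using b True e by auto
      ultimately show ?thesis using m2 dec[of "m (\<tau> b)"] dec[of b] by (simp add: \<tau>\<tau>)
    qed
    ultimately show ?thesis by blast
  next
    case False
    obtain m where m: "inj_on m {c. e c = Suc l}"
      "\<And>b. e b = Suc l \<Longrightarrow> e (m b) = l \<and> \<beta> (m b) < \<beta> b" using m by blast
    have "\<beta> (\<tau> (m b)) < \<beta> (\<tau> b)" if b: "e b = Suc l" for b
    proof -
      have "m b \<noteq> c\<^sub>1" "b \<noteq> c\<^sub>2" using m(2)[OF b] b False by auto
      then show ?thesis using dec[of "m b"] inc[of b] m(2)[OF b] by simp
    qed
    then show ?thesis using m by blast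
  qed
qed

text \<open>Re-sorting by \<open>\<sigma>\<close> preserves lengths, so the second tableau may be
  replaced by the exchange of entries on the unsorted columns. One labelling \<open>ch\<close> is
  then built that works before and after this exchange.\<close>

lemma box_move_chain_system:
  assumes part: "is_partition \<alpha>" "is_partition \<beta>" and strip: "horizontal_strip \<beta> \<gamma>"
    and move: "box_move \<alpha> \<beta> \<gamma> \<Gamma> \<Gamma>'"
  obtains c\<^sub>1 c\<^sub>2 \<sigma> ch where
    "chain_system \<alpha> \<beta> (entry \<gamma> \<Gamma>) ch"
    "chain_system \<alpha> \<beta> (entry \<gamma> \<Gamma> \<circ> Transposition.transpose c\<^sub>1 c\<^sub>2) (ch \<circ> Transposition.transpose c\<^sub>1 c\<^sub>2)"
    "0 < entry \<gamma> \<Gamma> c\<^sub>2" "entry \<gamma> \<Gamma> c\<^sub>2 < entry \<gamma> \<Gamma> c\<^sub>1" "\<beta> c\<^sub>1 < \<beta> c\<^sub>2"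
    "bij \<sigma>" "\<And>c. \<beta> (\<sigma> c) = \<beta> c" "\<And>c. entry \<gamma> \<Gamma>' c = entry \<gamma> \<Gamma> (Transposition.transpose c\<^sub>1 c\<^sub>2 (\<sigma> c))"
proof -
  have LR: "\<Gamma> \<in> LR_tableaux \<alpha> \<beta> \<gamma>" and LR': "\<Gamma>' \<in> LR_tableaux \<alpha> \<beta> \<gamma>" using move by (auto simp: box_move_def)
  note E = LR_entry[OF part strip LR] and E' = LR_entry[OF part strip LR']
  let ?e = "entry \<gamma> \<Gamma>"
  obtain r\<^sub>1 c\<^sub>1 r\<^sub>2 c\<^sub>2 \<sigma> where mv: "(r\<^sub>1, c\<^sub>1) \<in> skew \<beta> \<gamma>" "(r\<^sub>2, c\<^sub>2) \<in> skew \<beta> \<gamma>"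
        "r\<^sub>1 < r\<^sub>2" "\<Gamma> (r\<^sub>1, c\<^sub>1) > \<Gamma> (r\<^sub>2, c\<^sub>2)" "bij \<sigma>" "\<And>c. \<beta> (\<sigma> c) = \<beta> c \<and> \<gamma> (\<sigma> c) = \<gamma> c"
        "\<And>r c. \<Gamma>' (r, c) =
           (\<Gamma>((r\<^sub>1, c\<^sub>1) := \<Gamma> (r\<^sub>2, c\<^sub>2), (r\<^sub>2, c\<^sub>2) := \<Gamma> (r\<^sub>1, c\<^sub>1))) (r, \<sigma> c)"
    using move unfolding box_move_def by blast
  define \<tau> where "\<tau> = Transposition.transpose c\<^sub>1 c\<^sub>2"
  have r: "r\<^sub>1 = \<gamma> c\<^sub>1" "r\<^sub>2 = \<gamma> c\<^sub>2" "0 < ?e c\<^sub>1" "0 < ?e c\<^sub>2" using mv(1,2) by (auto simp: E(1))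
  have lt: "?e c\<^sub>2 < ?e c\<^sub>1" using mv(4) by (simp add: r entry_def)
  have \<beta>: "\<beta> c\<^sub>1 < \<beta> c\<^sub>2" using mv(3) r E(2)[of c\<^sub>1] E(2)[of c\<^sub>2] by simp
  have e': "entry \<gamma> \<Gamma>' c = ?e (\<tau> (\<sigma> c))" for c
    using mv(3) conjunct2[OF mv(6)[of c]] 
    by (auto simp: entry_def mv(7) \<tau>_def Transposition.transpose_def r)
  have \<sigma>: "\<sigma> (inv_into UNIV \<sigma> c) = c" "inv_into UNIV \<sigma> (\<sigma> c) = c" for c
    using mv(5) by (simp_all add: bij_is_surj surj_f_inv_f bij_is_inj)
  have \<tau>\<tau>: "\<tau> (\<tau> c) = c" for c by (simp add: \<tau>_def)
  have match: "\<exists>m. inj_on m {c. ?e c = Suc l} \<and>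
    (\<forall>b. ?e b = Suc l \<longrightarrow> ?e (m b) = l \<and> (\<beta> (m b) < \<beta> b \<and> \<beta> (\<tau> (m b)) < \<beta> (\<tau> b)))" if l: "0 < l" for l
    unfolding \<tau>_def
  proof (rule joint_matching[OF lt \<beta> E(7)[OF l]], fold \<tau>_def)
    obtain m where m: "inj_on m {c. entry \<gamma> \<Gamma>' c = Suc l}"
      "\<And>b. entry \<gamma> \<Gamma>' b = Suc l \<Longrightarrow> entry \<gamma> \<Gamma>' (m b) = l \<and> \<beta> (m b) < \<beta> b" using E'(7)[OF l] by blast
    \<comment> \<open>The matching of the sorted tableau is conjugated by \<open>\<sigma>\<close> to
      act on the unsorted columns.\<close>
    have "inj_on (\<lambda>b. \<sigma> (m (inv_into UNIV \<sigma> b))) {c. ?e (\<tau> c) = Suc l}"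
    proof (rule inj_onI)
      fix a b assume ab: "a \<in> {c. ?e (\<tau> c) = Suc l}" "b \<in> {c. ?e (\<tau> c) = Suc l}" "\<sigma> (m (inv_into UNIV \<sigma> a)) = \<sigma> (m (inv_into UNIV \<sigma> b))"
      then have "m (inv_into UNIV \<sigma> a) = m (inv_into UNIV \<sigma> b)" by (metis \<sigma>(2))
      moreover have "inv_into UNIV \<sigma> a \<in> {c. entry \<gamma> \<Gamma>' c = Suc l}" "inv_into UNIV \<sigma> b \<in> {c. entry \<gamma> \<Gamma>' c = Suc l}"
        using ab(1,2) by (simp_all add: e' \<sigma>(1))
      ultimately have "inv_into UNIV \<sigma> a = inv_into UNIV \<sigma> b" by (rule inj_onD[OF m(1)])
      then show "a = b" by (metis \<sigma>(1))
    qed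
    moreover have "?e (\<tau> (\<sigma> (m (inv_into UNIV \<sigma> b)))) = l \<and> \<beta> (\<sigma> (m (inv_into UNIV \<sigma> b))) < \<beta> b" if "?e (\<tau> b) = Suc l" for b
      using m(2)[of "inv_into UNIV \<sigma> b"] that mv(6)[of "m (inv_into UNIV \<sigma> b)"] mv(6)[of "inv_into UNIV \<sigma> b"] by (simp add: e' \<sigma>)
    ultimately show "\<exists>m. inj_on m {c. ?e (\<tau> c) = Suc l} \<and> (\<forall>b. ?e (\<tau> b) = Suc l \<longrightarrow> ?e (\<tau> (m b)) = l \<and> \<beta> (m b) < \<beta> b)"
      by (intro exI[of _ "\<lambda>b. \<sigma> (m (inv_into UNIV \<sigma> b))"]) blast
  qed
  \<comment> \<open>The relation imposed on neighbours is the conjunction of both length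
    conditions.\<close>
  obtain ch where ch: "\<And>l. l > 0 \<Longrightarrow> bij_betw ch {c. ?e c = l} {..<card {c. ?e c = l}} \<and>
    (\<forall>b b'. ?e b = Suc l \<longrightarrow> ?e b' = l \<longrightarrow> ch b = ch b' \<longrightarrow> (\<beta> b' < \<beta> b \<and> \<beta> (\<tau> b') < \<beta> (\<tau> b)))"
    using chain_labelling_exists[OF E(3,4) match] by blast
  have sys: "chain_system \<alpha> \<beta> ?e ch"
  proof (rule chain_systemI[OF part(1)])
    show "bij_betw ch {c. ?e c = l} {..<conj_part \<alpha> l}" if "0 < l" for l
      using ch[OF that] E(5)[OF that] by simp
    show "\<beta> b' < \<beta> b" if "0 < ?e b'" "?e b = Suc (?e b')" "ch b = ch b'" for b b'
      using ch[OF that(1)] that by blast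
    show "0 < \<beta> c" if "0 < ?e c" for c using E(2)[of c] that by simp
  qed
  have sys': "chain_system \<alpha> \<beta> (?e \<circ> \<tau>) (ch \<circ> \<tau>)"
  proof (rule chain_systemI[OF part(1)])
    show "bij_betw (ch \<circ> \<tau>) {c. (?e \<circ> \<tau>) c = l} {..<conj_part \<alpha> l}" if "0 < l" for l
    proof (rule bij_betw_trans)
      show "bij_betw \<tau> {c. (?e \<circ> \<tau>) c = l} {c. ?e c = l}"
        by (rule bij_betw_byWitness[where f' = \<tau>]) (auto simp: \<tau>\<tau>)
      show "bij_betw ch {c. ?e c = l} {..<conj_part \<alpha> l}" using ch[OF that] E(5)[OF that] by simp
    qed
    show "\<beta> b' < \<beta> b" if "0 < (?e \<circ> \<tau>) b'" "(?e \<circ> \<tau>) b = Suc ((?e \<circ> \<tau>) b')" "(ch \<circ> \<tau>) b = (ch \<circ> \<tau>) b'" for b b'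
    proof -
      have "\<beta> (\<tau> (\<tau> b')) < \<beta> (\<tau> (\<tau> b))"
        using conjunct2[OF ch[of "?e (\<tau> b')"], rule_format, of "\<tau> b" "\<tau> b'"] that by (simp only: comp_apply)
      then show ?thesis by (simp only: \<tau>\<tau>)
    qed
    show "0 < \<beta> c" if "0 < (?e \<circ> \<tau>) c" for c
      using E(2)[of "\<tau> c"] E(2)[of c\<^sub>1] r \<beta> that by (auto simp: \<tau>_def Transposition.transpose_def split: if_splits)
  qed
  show ?thesis
    by (rule that[OF sys sys'[unfolded \<tau>_def] r(4) lt \<beta> mv(5) conjunct1[OF mv(6)] e'[unfolded \<tau>_def]])
qed

section \<open>Quotients by triangular submodules\<close>

text \<open>A subspace with a basis of elements \<open>b c\<close> of height \<open>\<beta> c - 1\<close> that are triangular with respect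
  to the socle: dividing \<open>b c\<close> by \<open>T\<^sup>\<beta>\<^sup>c\<^sup>-\<^sup>1\<close> gives new generators whose orders modulo \<open>U\<close> have
  dropped by one.\<close>

locale triangular_submodule =
  fixes \<beta> :: "nat \<Rightarrow> nat" and S :: "nat set" and b :: "nat \<Rightarrow> 'k::field kT_elem" and a :: "nat \<Rightarrow> 'k"
    and U :: "'k kT_elem set"
  assumes fin: "finite {c. \<beta> c \<noteq> 0}"
    and S_pos: "\<And>c. c \<in> S \<Longrightarrow> 0 < \<beta> c"
    and b_carrier: "\<And>c. c \<in> S \<Longrightarrow> b c \<in> carrier (nil_mod \<beta>)"
    and b_zero: "\<And>c c'. c \<in> S \<Longrightarrow> c' \<noteq> c \<Longrightarrow> \<beta> c' \<le> \<beta> c \<Longrightarrow> b c c' = 0"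
    and b_diag: "\<And>c. c \<in> S \<Longrightarrow> b c c = monom (a c) (\<beta> c - 1)"
    and a_nz: "\<And>c. c \<in> S \<Longrightarrow> a c \<noteq> 0"
    and b_dvd: "\<And>c c'. c \<in> S \<Longrightarrow> monom 1 (\<beta> c - 1) dvd b c c'"
    and U_eq: "U = {v. \<exists>x. v = (\<Sum>c\<in>S. kscale (x c) (b c))}"
    and U_sub: "submod \<beta> U"
begin

abbreviation "N \<equiv> carrier (nil_mod \<beta>) :: 'k kT_elem set"
abbreviation "F \<equiv> {c. \<beta> c \<noteq> 0}"

lemma S_F: "S \<subseteq> F" using S_pos by auto

lemma finite_S: "finite S" using S_F fin by (rule finite_subset)

definition d :: "nat \<Rightarrow> nat \<Rightarrow> 'k poly" where
  "d c c' = (if c \<in> S then b c c' div monom 1 (\<beta> c - 1) else if c' = c then 1 else 0)"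

definition lead :: "nat \<Rightarrow> 'k" where
  "lead c = (if c \<in> S then a c else 1)"

lemma b_eq: "c \<in> S \<Longrightarrow> b c c' = monom 1 (\<beta> c - 1) * d c c'"
  using b_dvd by (simp add: d_def)

lemma d_diag: "d c c = [:lead c:]"
proof (cases "c \<in> S")
  case True
  have "monom 1 (\<beta> c - 1) * d c c = monom 1 (\<beta> c - 1) * [:a c:]"
    using b_eq[OF True, of c] b_diag[OF True] by (simp add: smult_monom)
  moreover have "monom 1 (\<beta> c - 1) \<noteq> (0 :: 'k poly)" by (simp only: monom_eq_0_iff) simp
  ultimately have "d c c = [:a c:]" by (simp only: mult_cancel_left) blast
  then show ?thesis using True by (simp add: lead_def)
qed (simp add: d_def lead_def one_pCons)

lemma lead_nz: "lead c \<noteq> 0"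
  using a_nz by (simp add: lead_def)

lemma d_zero: "c' \<noteq> c \<Longrightarrow> \<beta> c' \<le> \<beta> c \<Longrightarrow> d c c' = 0"
  using b_zero by (simp add: d_def)

text \<open>The linear combination of the new generators with coefficients \<open>w\<close>. This is
  not k[T]-linear: T^(beta_c) need not annihilate \<open>d c\<close>, which may have components in
  longer columns.\<close>

definition \<Phi> :: "'k kT_elem \<Rightarrow> 'k kT_elem" where
  "\<Phi> w = (\<lambda>c'. (\<Sum>c\<in>F. w c * d c c') mod monom 1 (\<beta> c'))"

definition rest :: "'k kT_elem \<Rightarrow> nat \<Rightarrow> 'k poly" where
  "rest w c' = (\<Sum>c\<in>{c \<in> F. \<beta> c < \<beta> c'}. w c * d c c')"

lemma \<Phi>_carrier: "\<Phi> w \<in> N"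
  unfolding \<Phi>_def by (rule nil_mod_reduce)

lemma \<Phi>_add: "\<Phi> (v + w) = \<Phi> v + \<Phi> w"
  by (simp add: \<Phi>_def fun_eq_iff distrib_right sum.distrib poly_mod_add_left)

text \<open>Ordered by column length, \<open>\<Phi>\<close> is triangular with nonzero constants on
  the diagonal. Different columns of equal length do not interact, by \<open>d_zero\<close>.\<close>

lemma \<Phi>_triangular:
  assumes "c' \<in> F"
  shows "\<Phi> w c' = (smult (lead c') (w c') + rest w c') mod monom 1 (\<beta> c')"
proof -
  have "(\<Sum>c\<in>F. w c * d c c') = (\<Sum>c\<in>insert c' {c \<in> F. \<beta> c < \<beta> c'}. w c * d c c')"
  proof (rule sum.mono_neutral_right)
    show "\<forall>c\<in>F - insert c' {c \<in> F. \<beta> c < \<beta> c'}. w c * d c c' = 0"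
    proof
      fix c assume "c \<in> F - insert c' {c \<in> F. \<beta> c < \<beta> c'}"
      then have "d c c' = 0" by (intro d_zero) auto
      then show "w c * d c c' = 0" by simp
    qed
  qed (use fin assms in auto)
  also have "\<dots> = smult (lead c') (w c') + rest w c'"
    using fin by (subst sum.insert) (simp_all add: rest_def d_diag)
  finally show ?thesis by (simp add: \<Phi>_def)
qed

lemma rest_cong: "(\<And>c. \<beta> c < \<beta> c' \<Longrightarrow> v c = w c) \<Longrightarrow> rest v c' = rest w c'"
  unfolding rest_def by (rule sum.cong) auto

lemma nil_mod_outside: "v \<in> N \<Longrightarrow> \<beta> c = 0 \<Longrightarrow> v c = 0"
  by (auto simp: carrier_nil_mod poly_eq_iff)

text \<open>In a shortest column where \<open>w\<close> is nonzero, only the diagonal term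
  contributes, and nothing can cancel it.\<close>

lemma \<Phi>_eq_0D:
  assumes w: "w \<in> N" and z: "\<Phi> w = 0"
  shows "w = 0"
proof (rule ccontr)
  assume "w \<noteq> 0"
  then have "\<exists>c. w c \<noteq> 0" by (auto simp: fun_eq_iff)
  then obtain c where c: "w c \<noteq> 0" "\<And>c'. w c' \<noteq> 0 \<Longrightarrow> \<beta> c \<le> \<beta> c'"
    using ex_has_least_nat[of "\<lambda>c. w c \<noteq> 0" _ \<beta>] by blast
  have cF: "c \<in> F" using nil_mod_outside[OF w, of c] c(1) by auto
  have "rest w c = rest 0 c" by (rule rest_cong) (use c(2) in force)
  then have "rest w c = 0" by (simp add: rest_def)
  then have "smult (lead c) (w c) mod monom 1 (\<beta> c) = 0" using \<Phi>_triangular[OF cF, of w] z by simp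
  moreover have "smult (lead c) (w c) mod monom 1 (\<beta> c) = smult (lead c) (w c)"
    using w by (simp add: mod_monom_eq_self_iff carrier_nil_mod)
  ultimately show False using c(1) lead_nz by simp
qed

text \<open>Forward substitution along the column length: \<open>rest\<close> involves only the
  shorter columns, which are already settled.\<close>

lemma \<Phi>_surj_upto:
  assumes n: "n \<in> N"
  shows "\<exists>w\<in>N. \<forall>c. \<beta> c < m \<longrightarrow> \<Phi> w c = n c"
proof (induction m)
  case 0
  then show ?case using nil_mod_zero by blast
next
  case (Suc m)
  then obtain w where w: "w \<in> N" "\<And>c. \<beta> c < m \<Longrightarrow> \<Phi> w c = n c" by blast
  define w' where "w' c = (if \<beta> c = m then smult (inverse (lead c)) ((n c - rest w c) mod monom 1 (\<beta> c)) else w c)" for c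
  have "w' \<in> N" using w(1) by (auto simp: carrier_nil_mod w'_def coeff_mod_monom)
  moreover have "\<Phi> w' c = n c" if c: "\<beta> c < Suc m" for c
  proof (cases "\<beta> c = 0")
    case True
    then show ?thesis using nil_mod_outside[OF \<Phi>_carrier] nil_mod_outside[OF n] by simp
  next
    case False
    then have cF: "c \<in> F" by simp
    have r: "rest w' c = rest w c" by (rule rest_cong) (use c in \<open>simp add: w'_def\<close>)
    show ?thesis
    proof (cases "\<beta> c = m")
      case True
      have "\<Phi> w' c = ((n c - rest w c) mod monom 1 (\<beta> c) + rest w c) mod monom 1 (\<beta> c)"
        unfolding \<Phi>_triangular[OF cF] r using True lead_nz[of c] by (simp add: w'_def)
      also have "\<dots> = n c mod monom 1 (\<beta> c)" by (simp add: mod_add_left_eq)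
      also have "\<dots> = n c" by (rule nil_mod_reduce_eq[OF n])
      finally show ?thesis .
    next
      case False
      then have "\<Phi> w' c = \<Phi> w c" unfolding \<Phi>_triangular[OF cF] r by (simp add: w'_def)
      then show ?thesis using w(2)[of c] c False by simp
    qed
  qed
  ultimately show ?case by blast
qed

lemma \<Phi>_surj:
  assumes n: "n \<in> N"
  shows "\<exists>w\<in>N. \<Phi> w = n"
proof -
  have "finite (\<beta> ` F)" using fin by simp
  then obtain M where M: "\<forall>x\<in>\<beta> ` F. x \<le> M" using finite_nat_set_iff_bounded_le by auto
  have "\<beta> c < Suc M" for c using M by (cases "\<beta> c = 0") (auto simp: less_Suc_eq_le)
  then show ?thesis using \<Phi>_surj_upto[OF n, of "Suc M"] by (auto simp: fun_eq_iff)
qed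

lemma \<Phi>_inj:
  assumes "v \<in> N" "w \<in> N" "\<Phi> v = \<Phi> w"
  shows "v = w"
proof -
  have "\<Phi> v = \<Phi> (v - w) + \<Phi> w" using \<Phi>_add[of "v - w" w] by simp
  then have "\<Phi> (v - w) = 0" using assms(3) by simp
  then have "v - w = 0" by (rule \<Phi>_eq_0D[OF nil_mod_diff[OF assms(1,2)]])
  then show ?thesis by simp
qed

section \<open>The quotient by U in terms of the new generators\<close>

definition \<Psi> :: "'k kT_elem \<Rightarrow> 'k kT_elem" where
  "\<Psi> n = (SOME w. w \<in> N \<and> \<Phi> w = n)"

lemma \<Psi>:
  assumes "n \<in> N"
  shows "\<Psi> n \<in> N" "\<Phi> (\<Psi> n) = n"
proof -
  have "\<exists>w. w \<in> N \<and> \<Phi> w = n" using \<Phi>_surj[OF assms] by blast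
  from someI_ex[OF this] show "\<Psi> n \<in> N" "\<Phi> (\<Psi> n) = n" by (auto simp: \<Psi>_def)
qed

lemma \<Psi>_\<Phi>: "w \<in> N \<Longrightarrow> \<Psi> (\<Phi> w) = w"
  by (rule \<Phi>_inj[OF \<Psi>(1)[OF \<Phi>_carrier] _ \<Psi>(2)[OF \<Phi>_carrier]])

definition \<delta> :: "nat \<Rightarrow> nat" where
  "\<delta> c = \<beta> c - (if c \<in> S then 1 else 0)"

text \<open>The coordinates of elements of \<open>U\<close> with respect to the new generators: just
  the highest coefficient in each column of \<open>S\<close>.\<close>

definition top :: "(nat \<Rightarrow> 'k) \<Rightarrow> 'k kT_elem" where
  "top x = (\<lambda>c. if c \<in> S then monom (x c) (\<beta> c - 1) else 0)"

lemma top_carrier: "top x \<in> N"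
  using S_pos by (force simp: top_def carrier_nil_mod)

lemma \<Phi>_top: "\<Phi> (top x) = (\<Sum>c\<in>S. kscale (x c) (b c))"
proof
  fix c'
  have "(\<Sum>c\<in>F. top x c * d c c') = (\<Sum>c\<in>S. top x c * d c c')"
    by (rule sum.mono_neutral_right[OF fin S_F]) (simp add: top_def)
  also have "\<dots> = (\<Sum>c\<in>S. kscale (x c) (b c) c')"
  proof (rule sum.cong)
    fix c assume c: "c \<in> S"
    have "monom (x c) (\<beta> c - 1) = smult (x c) (monom 1 (\<beta> c - 1))" by (simp add: smult_monom)
    then show "top x c * d c c' = kscale (x c) (b c) c'"
      using c by (simp only: top_def if_True kscale_apply b_eq[OF c] mult_smult_left)
  qed simp
  also have "\<dots> = (\<Sum>c\<in>S. kscale (x c) (b c)) c'" by (simp only: sum_fun_apply)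
  finally have e: "(\<Sum>c\<in>F. top x c * d c c') = (\<Sum>c\<in>S. kscale (x c) (b c)) c'" .
  have "(\<Sum>c\<in>S. kscale (x c) (b c)) \<in> N"
    using b_carrier by (intro kv.subspace_sum kv.subspace_scale subspace_nil_mod)
  from nil_mod_reduce_eq[OF this] show "\<Phi> (top x) c' = (\<Sum>c\<in>S. kscale (x c) (b c)) c'"
    by (simp only: \<Phi>_def e)
qed

text \<open>Expand in the new generators, then forget the highest coefficient in the columns of
  \<open>S\<close>; by \<open>\<Phi>_top\<close> what is forgotten amounts to
  \<open>U\<close>.\<close>

definition \<phi> :: "'k kT_elem \<Rightarrow> 'k kT_elem" where
  "\<phi> n = (\<lambda>c. \<Psi> n c mod monom 1 (\<delta> c))"

lemma \<phi>_add:
  assumes "m \<in> N" "n \<in> N"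
  shows "\<phi> (m + n) = \<phi> m + \<phi> n"
proof -
  have "\<Psi> (m + n) = \<Psi> m + \<Psi> n"
  proof (rule \<Phi>_inj)
    show "\<Psi> m + \<Psi> n \<in> N" by (intro nil_mod_add \<Psi> assms)
    show "\<Phi> (\<Psi> (m + n)) = \<Phi> (\<Psi> m + \<Psi> n)"
      by (simp only: \<Phi>_add \<Psi>(2)[OF assms(1)] \<Psi>(2)[OF assms(2)] \<Psi>(2)[OF nil_mod_add[OF assms]])
  qed (intro \<Psi> nil_mod_add assms)
  then show ?thesis by (simp add: \<phi>_def fun_eq_iff poly_mod_add_left)
qed

lemma \<phi>_eq_0_iff:
  assumes n: "n \<in> N"
  shows "\<phi> n = 0 \<longleftrightarrow> n \<in> U"
proof
  assume z: "\<phi> n = 0"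
  let ?w = "\<Psi> n"
  have "coeff (?w c) m = coeff (top (\<lambda>c. coeff (?w c) (\<beta> c - 1)) c) m" for c m
  proof (cases "m < \<delta> c")
    case True
    have "coeff (\<phi> n c) m = coeff (?w c) m" using True by (simp add: \<phi>_def coeff_mod_monom)
    then have "coeff (?w c) m = 0" using z by simp
    then show ?thesis using True by (auto simp: top_def \<delta>_def split: if_splits)
  next
    case False
    then show ?thesis using \<Psi>(1)[OF n] S_pos[of c]
      by (cases "m = \<beta> c - 1") (auto simp: top_def \<delta>_def carrier_nil_mod split: if_splits)
  qed
  then have "?w = top (\<lambda>c. coeff (?w c) (\<beta> c - 1))" by (intro ext poly_eqI)
  then have "n = \<Phi> (top (\<lambda>c. coeff (?w c) (\<beta> c - 1)))" using \<Psi>(2)[OF n] by simp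
  then show "n \<in> U" unfolding \<Phi>_top U_eq mem_Collect_eq by - (rule exI)
next
  assume "n \<in> U"
  then obtain x where "n = \<Phi> (top x)" unfolding U_eq \<Phi>_top by blast
  then have "\<Psi> n = top x" using \<Psi>_\<Phi>[OF top_carrier] by simp
  moreover have "monom (x c) (\<beta> c - 1) mod monom 1 (\<beta> c - 1) = 0" for c
    by (auto simp: poly_eq_iff coeff_mod_monom)
  ultimately show "\<phi> n = 0" by (simp add: \<phi>_def \<delta>_def top_def fun_eq_iff)
qed

text \<open>Reducing \<open>p * w c\<close> modulo T^(beta_c) discards a multiple q T^(beta_c) of
  \<open>d c\<close>. For \<open>c\<close> in \<open>S\<close> this is q T times \<open>b c\<close>,
  hence in the submodule \<open>U\<close>; for other \<open>c\<close> the generator is a standard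
  one and T^(beta_c) kills it.\<close>

lemma smult_defect:
  assumes w: "w \<in> N"
  shows "(\<lambda>c'. (p * \<Phi> w c') mod monom 1 (\<beta> c')) - \<Phi> (\<lambda>c. (p * w c) mod monom 1 (\<beta> c)) \<in> U"
proof -
  define q where "q c = (p * w c) div monom 1 (\<beta> c)" for c
  let ?x = "\<lambda>c c'. ((q c * monom 1 1) * b c c') mod monom 1 (\<beta> c')"
  have "(p * \<Phi> w c') mod monom 1 (\<beta> c') - \<Phi> (\<lambda>c. (p * w c) mod monom 1 (\<beta> c)) c' = (\<Sum>c\<in>S. ?x c c')" for c'
  proof -
    have "(p * \<Phi> w c') mod monom 1 (\<beta> c') = (p * (\<Sum>c\<in>F. w c * d c c')) mod monom 1 (\<beta> c')"
      by (simp only: \<Phi>_def mod_mult_right_eq)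
    then have "(p * \<Phi> w c') mod monom 1 (\<beta> c') - \<Phi> (\<lambda>c. (p * w c) mod monom 1 (\<beta> c)) c'
      = (p * (\<Sum>c\<in>F. w c * d c c') - (\<Sum>c\<in>F. ((p * w c) mod monom 1 (\<beta> c)) * d c c')) mod monom 1 (\<beta> c')"
      by (simp only: \<Phi>_def poly_mod_diff_left)
    also have "p * (\<Sum>c\<in>F. w c * d c c') - (\<Sum>c\<in>F. ((p * w c) mod monom 1 (\<beta> c)) * d c c')
      = (\<Sum>c\<in>F. (p * w c - (p * w c) mod monom 1 (\<beta> c)) * d c c')"
      by (simp only: sum_distrib_left sum_subtractf[symmetric] left_diff_distrib mult.assoc)
    also have "\<dots> = (\<Sum>c\<in>F. q c * monom 1 (\<beta> c) * d c c')"
      by (simp only: q_def minus_mod_eq_div_mult)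
    also have "\<dots> = (\<Sum>c\<in>S. q c * monom 1 (\<beta> c) * d c c') + (\<Sum>c\<in>F - S. q c * monom 1 (\<beta> c) * d c c')"
      by (rule sum.subset_diff[OF S_F fin, THEN trans]) (simp only: add.commute)
    also have "(\<Sum>c\<in>S. q c * monom 1 (\<beta> c) * d c c') = (\<Sum>c\<in>S. (q c * monom 1 1) * b c c')"
    proof (rule sum.cong)
      fix c assume c: "c \<in> S"
      have "monom 1 (\<beta> c) = monom 1 1 * (monom 1 (\<beta> c - 1) :: 'k poly)"
        using S_pos[OF c] by (simp add: mult_monom)
      then show "q c * monom 1 (\<beta> c) * d c c' = (q c * monom 1 1) * b c c'"
        by (simp only: b_eq[OF c] mult.assoc)
    qed simp
    also have "((\<Sum>c\<in>S. (q c * monom 1 1) * b c c') + (\<Sum>c\<in>F - S. q c * monom 1 (\<beta> c) * d c c')) mod monom 1 (\<beta> c')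
       = (\<Sum>c\<in>S. (q c * monom 1 1) * b c c') mod monom 1 (\<beta> c') + (\<Sum>c\<in>F - S. q c * monom 1 (\<beta> c) * d c c') mod monom 1 (\<beta> c')"
      by (rule poly_mod_add_left)
    also have "(\<Sum>c\<in>F - S. q c * monom 1 (\<beta> c) * d c c') mod monom 1 (\<beta> c') = 0"
    proof -
      have "monom 1 (\<beta> c') dvd q c * monom 1 (\<beta> c) * d c c'" if "c \<in> F - S" for c
        using that by (cases "c' = c") (simp_all add: d_def)
      then show ?thesis by (meson dvd_sum mod_0_imp_dvd dvd_imp_mod_0)
    qed
    also have "(\<Sum>c\<in>S. (q c * monom 1 1) * b c c') mod monom 1 (\<beta> c') = (\<Sum>c\<in>S. ?x c c')"
      by (induction S rule: infinite_finite_induct) (simp_all add: poly_mod_add_left)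
    finally show ?thesis by simp
  qed
  then have "(\<lambda>c'. (p * \<Phi> w c') mod monom 1 (\<beta> c')) - \<Phi> (\<lambda>c. (p * w c) mod monom 1 (\<beta> c)) = (\<Sum>c\<in>S. ?x c)"
    by (intro ext) (simp only: fun_diff_def sum_fun_apply)
  moreover have "(\<Sum>c\<in>S. ?x c) \<in> U"
  proof (rule kv.subspace_sum[OF submod_subspace[OF U_sub]])
    fix c assume c: "c \<in> S"
    have "b c = (\<Sum>c'\<in>S. kscale (if c' = c then 1 else 0) (b c'))"
    proof -
      have "(\<Sum>c'\<in>S. kscale (if c' = c then 1 else 0) (b c')) = (\<Sum>c'\<in>{c}. kscale (if c' = c then 1 else 0) (b c'))"
        using finite_S c by (intro sum.mono_neutral_right) (auto simp: fun_eq_iff)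
      then show ?thesis by (simp add: fun_eq_iff)
    qed
    then have "b c \<in> U" unfolding U_eq mem_Collect_eq by - (rule exI)
    then show "?x c \<in> U" by (rule submodD(4)[OF U_sub])
  qed
  ultimately show ?thesis by simp
qed

text \<open>Although \<open>\<Phi>\<close> fails to be k[T]-linear, its defect lies in
  \<open>U\<close>, which \<open>\<phi>\<close> annihilates.\<close>

lemma \<phi>_smult:
  assumes n: "n \<in> N"
  shows "\<phi> (p \<odot>\<^bsub>nil_mod \<beta>\<^esub> n) = p \<odot>\<^bsub>nil_mod \<delta>\<^esub> \<phi> n"
proof -
  let ?w = "\<Psi> n"
  let ?pw = "\<lambda>c. (p * ?w c) mod monom 1 (\<beta> c)" and ?pn = "\<lambda>c. (p * n c) mod monom 1 (\<beta> c)"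
  have pw: "?pw \<in> N" by (rule nil_mod_reduce)
  have u: "?pn - \<Phi> ?pw \<in> U" using smult_defect[OF \<Psi>(1)[OF n], of p] \<Psi>(2)[OF n] by simp
  note uN = submodD(1)[OF U_sub u]
  have "\<phi> ?pn = \<phi> (\<Phi> ?pw + (?pn - \<Phi> ?pw))" by simp
  also have "\<dots> = \<phi> (\<Phi> ?pw) + \<phi> (?pn - \<Phi> ?pw)" by (rule \<phi>_add[OF \<Phi>_carrier uN])
  also have "\<phi> (?pn - \<Phi> ?pw) = 0" using \<phi>_eq_0_iff[OF uN] u by simp
  finally have "\<phi> ?pn = (\<lambda>c. ?pw c mod monom 1 (\<delta> c))" by (simp add: \<phi>_def \<Psi>_\<Phi>[OF pw])
  also have "\<dots> = (\<lambda>c. (p * ?w c) mod monom 1 (\<delta> c))"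
  proof
    fix c
    show "?pw c mod monom 1 (\<delta> c) = (p * ?w c) mod monom 1 (\<delta> c)"
      by (auto simp: poly_eq_iff coeff_mod_monom \<delta>_def)
  qed
  also have "\<dots> = (\<lambda>c. (p * \<phi> n c) mod monom 1 (\<delta> c))" by (simp only: \<phi>_def mod_mult_right_eq)
  finally show ?thesis by simp
qed

lemma mod_iso_quot:
  "mod_iso (carrier ring_of_type_algebra) (quot_module (nil_mod \<beta>) U) (nil_mod \<delta> :: ('k poly, _) module)"
proof (rule mod_iso_quotI[OF U_sub])
  show "U = {x \<in> N. \<phi> x = 0}" using \<phi>_eq_0_iff submodD(1)[OF U_sub] by auto
  show "\<phi> ` N = carrier (nil_mod \<delta>)"
  proof (intro subset_antisym subsetI)
    fix v assume v: "v \<in> carrier (nil_mod \<delta> :: ('k poly, _) module)"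
    have "\<beta> c \<ge> \<delta> c" for c by (simp add: \<delta>_def)
    then have vN: "v \<in> N" using v by (auto simp: carrier_nil_mod intro: order_trans)
    have "\<phi> (\<Phi> v) = v" unfolding \<phi>_def \<Psi>_\<Phi>[OF vN] using nil_mod_reduce_eq[OF v] by simp
    then show "v \<in> \<phi> ` N" using imageI[OF \<Phi>_carrier[of v], of \<phi>] by simp
  qed (auto simp: \<phi>_def nil_mod_reduce)
qed (rule \<phi>_add \<phi>_smult; assumption)+

text \<open>A relation among the \<open>b c\<close> is an element \<open>top x\<close> killed by the
  injective \<open>\<Phi>\<close>. This later yields injectivity of the embeddings.\<close>

lemma b_independent:
  assumes "(\<Sum>c\<in>S. kscale (x c) (b c)) = 0" "c \<in> S"
  shows "x c = 0"
proof -
  have "top x = 0" by (rule \<Phi>_eq_0D[OF top_carrier]) (simp only: \<Phi>_top assms(1))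
  then have "top x c = 0" by (simp only: zero_fun_def)
  then have "monom (x c) (\<beta> c - 1) = 0" by (simp only: top_def assms(2) if_True)
  then show ?thesis by (simp only: monom_eq_0_iff)
qed

end

section \<open>Sums of poles and their deformations\<close>

lemma span_image_sum:
  assumes "finite S"
  shows "kv.span (h ` S) = {v. \<exists>x. v = (\<Sum>c\<in>S. kscale (x c) (h c))}" (is "_ = ?R")
proof (rule subset_antisym)
  show "?R \<subseteq> kv.span (h ` S)"
  proof
    fix v assume "v \<in> ?R"
    then obtain x where "v = (\<Sum>c\<in>S. kscale (x c) (h c))" by blast
    moreover have "(\<Sum>c\<in>S. kscale (x c) (h c)) \<in> kv.span (h ` S)"
      by (rule kv.span_sum, rule kv.span_scale, rule kv.span_base) simp
    ultimately show "v \<in> kv.span (h ` S)" by simp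
  qed
  show "kv.span (h ` S) \<subseteq> ?R"
  proof (rule kv.span_minimal)
    show "h ` S \<subseteq> ?R"
    proof
      fix v assume "v \<in> h ` S"
      then obtain c where c: "c \<in> S" "v = h c" by blast
      have "(\<Sum>c'\<in>S. kscale (if c' = c then 1 else 0) (h c')) = (\<Sum>c'\<in>{c}. kscale (if c' = c then 1 else 0) (h c'))"
        using assms c by (intro sum.mono_neutral_right) (auto simp: fun_eq_iff)
      then have "v = (\<Sum>c'\<in>S. kscale (if c' = c then 1 else 0) (h c'))" using c by (simp add: fun_eq_iff)
      then show "v \<in> ?R" unfolding mem_Collect_eq by - (rule exI)
    qed
    show "kv.subspace ?R"
      unfolding kv.subspace_def
    proof (intro conjI ballI allI)
      show "0 \<in> ?R" by (auto intro!: exI[of _ "\<lambda>_. 0"] simp: fun_eq_iff sum_fun_apply)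
      fix v assume "v \<in> ?R"
      then obtain x where x: "v = (\<Sum>c\<in>S. kscale (x c) (h c))" by blast
      show "v + w \<in> ?R" if w: "w \<in> ?R" for w
      proof -
        obtain y where y: "w = (\<Sum>c\<in>S. kscale (y c) (h c))" using w by blast
        have "v + w = (\<Sum>c\<in>S. kscale (x c + y c) (h c))"
          unfolding x y by (simp only: kv.scale_left_distrib sum.distrib)
        then show ?thesis unfolding mem_Collect_eq by - (rule exI)
      qed
      fix a
      have "kscale a v = (\<Sum>c\<in>S. kscale (a * x c) (h c))"
        unfolding x by (simp only: kv.scale_sum_right kv.scale_scale)
      then show "kscale a v \<in> ?R" unfolding mem_Collect_eq by - (rule exI)
    qed
  qed
qed

text \<open>Renumbering direct summands changes nothing. It is needed because the layers of the
  sorted tableau are permuted by \<open>\<sigma>\<close>, while quotients are computed in the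
  unsorted columns.\<close>

lemma mod_iso_quot_permute:
  fixes H :: "'k::field kT_elem set"
  assumes H: "submod \<beta> H" and \<sigma>: "bij \<sigma>"
    and iso: "mod_iso (carrier ring_of_type_algebra) (quot_module (nil_mod \<beta>) H) (nil_mod \<delta> :: ('k poly, _) module)"
  shows "mod_iso (carrier ring_of_type_algebra) (quot_module (nil_mod \<beta>) H)
    (nil_mod (\<lambda>c. \<delta> (\<sigma> c)) :: ('k poly, _) module)"
proof -
  obtain \<phi> :: "'k kT_elem \<Rightarrow> 'k kT_elem" where \<phi>: "H = {x \<in> carrier (nil_mod \<beta>). \<phi> x = 0}"
    "\<phi> ` carrier (nil_mod \<beta>) = carrier (nil_mod \<delta>)"
    "\<And>x y. x \<in> carrier (nil_mod \<beta>) \<Longrightarrow> y \<in> carrier (nil_mod \<beta>) \<Longrightarrow> \<phi> (x + y) = \<phi> x + \<phi> y"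
    "\<And>p x. x \<in> carrier (nil_mod \<beta>) \<Longrightarrow> \<phi> (p \<odot>\<^bsub>nil_mod \<beta>\<^esub> x) = p \<odot>\<^bsub>nil_mod \<delta>\<^esub> \<phi> x"
    using mod_iso_quotE[OF H iso] by blast
  have s: "\<sigma> (inv_into UNIV \<sigma> c) = c" "inv_into UNIV \<sigma> (\<sigma> c) = c" for c
    using \<sigma> by (simp_all add: bij_is_surj surj_f_inv_f bij_is_inj)
  define \<psi> where "\<psi> x = (\<lambda>c. \<phi> x (\<sigma> c))" for x
  have "\<psi> x = 0 \<longleftrightarrow> \<phi> x = 0" for x
  proof
    assume z: "\<psi> x = 0"
    have "\<phi> x c = 0" for c
    proof -
      have "\<psi> x (inv_into UNIV \<sigma> c) = 0" unfolding z by simp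
      then show ?thesis by (simp only: \<psi>_def s)
    qed
    then show "\<phi> x = 0" by (simp add: fun_eq_iff)
  qed (simp add: \<psi>_def fun_eq_iff)
  then have ker: "H = {x \<in> carrier (nil_mod \<beta>). \<psi> x = 0}" using \<phi>(1) by simp
  show ?thesis
  proof (rule mod_iso_quotI[OF H ker])
    show "\<psi> ` carrier (nil_mod \<beta>) = carrier (nil_mod (\<lambda>c. \<delta> (\<sigma> c)))"
    proof (intro subset_antisym subsetI)
      fix v assume "v \<in> \<psi> ` carrier (nil_mod \<beta>)"
      then obtain x where x: "x \<in> carrier (nil_mod \<beta>)" "v = \<psi> x" by blast
      then have "\<phi> x \<in> carrier (nil_mod \<delta>)" using \<phi>(2) by blast
      then show "v \<in> carrier (nil_mod (\<lambda>c. \<delta> (\<sigma> c)))" by (simp add: x(2) \<psi>_def carrier_nil_mod)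
    next
      fix v :: "'k kT_elem" assume v: "v \<in> carrier (nil_mod (\<lambda>c. \<delta> (\<sigma> c)))"
      have "coeff (v (inv_into UNIV \<sigma> i)) m = 0" if "\<delta> i \<le> m" for i m
        using v s(1)[of i] that by (simp add: carrier_nil_mod)
      then have "(\<lambda>c. v (inv_into UNIV \<sigma> c)) \<in> carrier (nil_mod \<delta>)" by (simp add: carrier_nil_mod)
      then obtain x where x: "x \<in> carrier (nil_mod \<beta>)" "(\<lambda>c. v (inv_into UNIV \<sigma> c)) = \<phi> x"
        unfolding \<phi>(2)[symmetric] by blast
      have "v = \<psi> x" unfolding \<psi>_def x(2)[symmetric] s(2) ..
      then show "v \<in> \<psi> ` carrier (nil_mod \<beta>)" using x(1) by blast
    qed
    fix x :: "'k kT_elem" assume x: "x \<in> carrier (nil_mod \<beta>)"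
    show "\<psi> (x + y) = \<psi> x + \<psi> y" if "y \<in> carrier (nil_mod \<beta>)" for y
      by (simp add: \<psi>_def \<phi>(3)[OF x that] fun_eq_iff)
    show "\<psi> (p \<odot>\<^bsub>nil_mod \<beta>\<^esub> x) = p \<odot>\<^bsub>nil_mod (\<lambda>c. \<delta> (\<sigma> c))\<^esub> \<psi> x" for p
      unfolding \<psi>_def \<phi>(4)[OF x] by simp
  qed
qed

text \<open>The embedding \<open>g\<^sub>j \<mapsto> \<Sum> T\<^sup>\<beta>\<^sup>c\<^sup>-\<^sup>e\<^sup>c e\<^sub>c\<close>, the sum over the chain \<open>j\<close>, which for \<open>s = 0\<close> is a direct
  sum of poles; \<open>s\<close> is the parameter of a deformation of one matrix entry.\<close>

definition chain_map :: "(nat \<Rightarrow> nat) \<Rightarrow> (nat \<Rightarrow> nat) \<Rightarrow> (nat \<Rightarrow> nat) \<Rightarrow> (nat \<Rightarrow> nat) \<Rightarrow> nat \<Rightarrow> nat \<Rightarrow> nat \<Rightarrow>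
    'k::field \<Rightarrow> 'k kT_elem \<Rightarrow> 'k kT_elem" where
  "chain_map \<alpha> \<beta> e ch c0 j0 m s = restrict (\<lambda>v c.
     ((if 0 < e c then v (ch c) * monom 1 (\<beta> c - e c) else 0) + (if c = c0 then v j0 * monom s m else 0))
       mod monom 1 (\<beta> c)) (carrier (nil_mod \<alpha>))"

text \<open>This is the condition for multiplication by T^m to be well defined from k[T]/(T^a) to
  k[T]/(T^n).\<close>

lemma mod_monom_shift:
  fixes q :: "'k::field poly"
  assumes "n \<le> a + m"
  shows "((q mod monom 1 a) * monom s m) mod monom 1 n = (q * monom s m) mod monom 1 n"
proof (rule poly_eqI)
  fix k
  show "coeff (((q mod monom 1 a) * monom s m) mod monom 1 n) k = coeff ((q * monom s m) mod monom 1 n) k"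
    using assms by (auto simp: coeff_mod_monom coeff_monom_mult mult.commute[of _ "monom s m"])
qed

lemma monom_mod_monom:
  "monom (s :: 'k::field) k mod monom 1 n = (if k < n then monom s k else 0)"
  by (auto simp: poly_eq_iff coeff_mod_monom)

text \<open>Each matrix entry must satisfy the bound of \<open>mod_monom_shift\<close>. For the
  poles it follows from \<open>e c \<le> \<alpha> (ch c)\<close>, for the extra entry it is the
  assumption \<open>m\<close>.\<close>

lemma chain_map_hom:
  assumes sys: "chain_system \<alpha> \<beta> e ch" and m: "\<beta> c0 \<le> \<alpha> j0 + m"
  shows "chain_map \<alpha> \<beta> e ch c0 j0 m s \<in> kT_hom \<alpha> \<beta>"
  unfolding kT_hom_def mod_hom_def
proof (intro CollectI conjI ballI)
  let ?f = "chain_map \<alpha> \<beta> e ch c0 j0 m s"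
  show "?f \<in> carrier (nil_mod \<alpha>) \<rightarrow>\<^sub>E carrier (nil_mod \<beta>)"
    unfolding chain_map_def restrict_PiE_iff by (intro ballI, rule nil_mod_reduce)
  fix v :: "'a kT_elem" assume v: "v \<in> carrier (nil_mod \<alpha>)"
  show "?f (v \<oplus>\<^bsub>nil_mod \<alpha>\<^esub> w) = ?f v \<oplus>\<^bsub>nil_mod \<beta>\<^esub> ?f w" if w: "w \<in> carrier (nil_mod \<alpha>)" for w
    using v w nil_mod_add[OF v w]
    by (simp add: chain_map_def fun_eq_iff poly_mod_add_left distrib_right)
  fix p
  let ?pv = "\<lambda>i. (p * v i) mod monom 1 (\<alpha> i)"
  have pv: "?pv \<in> carrier (nil_mod \<alpha>)" by (rule nil_mod_reduce)
  have "?f ?pv c = (p * ?f v c) mod monom 1 (\<beta> c)" for c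
  proof -
    have 1: "(if 0 < e c then ?pv (ch c) * monom 1 (\<beta> c - e c) else 0) mod monom 1 (\<beta> c) =
      (p * (if 0 < e c then v (ch c) * monom 1 (\<beta> c - e c) else 0)) mod monom 1 (\<beta> c)"
    proof (cases "0 < e c")
      case True
      then have "e c \<le> \<alpha> (ch c)" using sys by (auto simp: chain_system_def bij_betw_def)
      then have "\<beta> c \<le> \<alpha> (ch c) + (\<beta> c - e c)" by simp
      from mod_monom_shift[OF this, of "p * v (ch c)" 1] show ?thesis using True by (simp only: if_True mult.assoc)
    qed simp
    have 2: "(if c = c0 then ?pv j0 * monom s m else 0) mod monom 1 (\<beta> c) =
      (p * (if c = c0 then v j0 * monom s m else 0)) mod monom 1 (\<beta> c)"
    proof (cases "c = c0")
      case True
      from mod_monom_shift[OF m, of "p * v j0" s] show ?thesis using True by (simp only: if_True simp_thms mult.assoc)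
    qed simp
    have "?f ?pv c = (p * (if 0 < e c then v (ch c) * monom 1 (\<beta> c - e c) else 0)) mod monom 1 (\<beta> c)
      + (p * (if c = c0 then v j0 * monom s m else 0)) mod monom 1 (\<beta> c)"
      unfolding 1[symmetric] 2[symmetric] using pv by (simp only: chain_map_def restrict_apply if_True poly_mod_add_left)
    also have "\<dots> = (p * ((if 0 < e c then v (ch c) * monom 1 (\<beta> c - e c) else 0) + (if c = c0 then v j0 * monom s m else 0))) mod monom 1 (\<beta> c)"
      by (simp only: distrib_left poly_mod_add_left)
    also have "\<dots> = (p * ?f v c) mod monom 1 (\<beta> c)"
      using v by (simp only: chain_map_def restrict_apply if_True mod_mult_right_eq)
    finally show ?thesis .
  qed
  then show "?f (p \<odot>\<^bsub>nil_mod \<alpha>\<^esub> v) = p \<odot>\<^bsub>nil_mod \<beta>\<^esub> ?f v" unfolding smult_nil_mod by (rule ext)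
qed

text \<open>Component \<open>c\<close> of the image of T^n times the generator \<open>j\<close>
  under the undeformed map; for \<open>n \<ge> e c\<close> the exponent reaches
  \<open>\<beta> c\<close> and the component dies.\<close>

definition chain_val :: "(nat \<Rightarrow> nat) \<Rightarrow> (nat \<Rightarrow> nat) \<Rightarrow> (nat \<Rightarrow> nat) \<Rightarrow> nat \<Rightarrow> nat \<Rightarrow> nat \<Rightarrow> 'k::field poly" where
  "chain_val \<beta> e ch j n c = (if ch c = j \<and> n < e c then monom 1 (n + (\<beta> c - e c)) else 0)"

lemma chain_map_basis_vec:
  assumes sys: "chain_system \<alpha> \<beta> e ch" and n: "n < \<alpha> j"
  shows "chain_map \<alpha> \<beta> e ch c0 j0 m (s :: 'k::field) (basis_vec j n) c =
    chain_val \<beta> e ch j n c + (if c = c0 \<and> j = j0 \<and> n + m < \<beta> c0 then monom s (n + m) else 0)"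
proof -
  have "e c \<le> \<beta> c" using sys by (simp add: chain_system_def)
  then have lt: "n + (\<beta> c - e c) < \<beta> c \<longleftrightarrow> n < e c" if "0 < e c" using that by linarith
  have 1: "(if 0 < e c then basis_vec j n (ch c) * monom 1 (\<beta> c - e c) else 0) mod monom 1 (\<beta> c) = (chain_val \<beta> e ch j n c :: 'k poly)"
    using lt by (auto simp: basis_vec_def chain_val_def mult_monom monom_mod_monom)
  have 2: "(if c = c0 then basis_vec j n j0 * monom s m else 0) mod monom 1 (\<beta> c)
    = (if c = c0 \<and> j = j0 \<and> n + m < \<beta> c0 then monom s (n + m) else 0)"
    by (auto simp: basis_vec_def mult_monom monom_mod_monom)
  have car: "(basis_vec j n :: 'k kT_elem) \<in> carrier (nil_mod \<alpha>)" using n by (rule basis_vec_carrier)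
  show ?thesis
    by (simp only: chain_map_def restrict_apply'[OF car] poly_mod_add_left 1 2)
qed

text \<open>The factor T^(e_c - 1) kills the columns of the chain with smaller entries and reaches
  the highest power in \<open>c\<close>. Columns with larger entries are longer, and by the last
  clause of \<open>chain_system\<close> their exponent is at least
  \<open>\<beta> c - 1\<close>.\<close>

lemma chain_val_triangular:
  assumes sys: "chain_system \<alpha> \<beta> e ch" and c: "0 < e c"
  shows "chain_val \<beta> e ch (ch c) (e c - 1) c = (monom 1 (\<beta> c - 1) :: 'k::field poly)"
    and "c' \<noteq> c \<Longrightarrow> \<beta> c' \<le> \<beta> c \<Longrightarrow> chain_val \<beta> e ch (ch c) (e c - 1) c' = (0 :: 'k poly)"
    and "monom 1 (\<beta> c - 1) dvd (chain_val \<beta> e ch (ch c) (e c - 1) c' :: 'k poly)"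
proof -
  have le: "e c \<le> \<beta> c" for c using sys by (simp add: chain_system_def)
  have later: "\<beta> c < \<beta> c' \<and> \<beta> c - 1 \<le> e c - 1 + (\<beta> c' - e c')" if "ch c' = ch c" "e c - 1 < e c'" "c' \<noteq> c"
  proof -
    have "e c' \<noteq> e c" using sys that c by (auto simp: chain_system_def bij_betw_def inj_on_def)
    then have "e c < e c'" using that c by simp
    then have "\<beta> c + e c' \<le> \<beta> c' + e c" using sys that c unfolding chain_system_def by metis
    then show ?thesis using \<open>e c < e c'\<close> le[of c'] le[of c] c by linarith
  qed
  show "chain_val \<beta> e ch (ch c) (e c - 1) c = (monom 1 (\<beta> c - 1) :: 'k poly)"
    using c le[of c] by (simp add: chain_val_def)
  show "c' \<noteq> c \<Longrightarrow> \<beta> c' \<le> \<beta> c \<Longrightarrow> chain_val \<beta> e ch (ch c) (e c - 1) c' = (0 :: 'k poly)"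
    using later by (auto simp: chain_val_def)
  show "monom 1 (\<beta> c - 1) dvd (chain_val \<beta> e ch (ch c) (e c - 1) c' :: 'k poly)"
  proof (cases "ch c' = ch c \<and> e c - 1 < e c' \<and> c' \<noteq> c")
    case True
    then show ?thesis using later by (auto simp: chain_val_def monom_1_dvd_iff')
  next
    case False
    then show ?thesis using c le[of c] by (auto simp: chain_val_def monom_1_dvd_iff')
  qed
qed

text \<open>The column carrying entry \<open>l\<close> of chain \<open>j\<close> names the basis
  vector T^(l-1) of summand \<open>j\<close>; with this shift, an exponent at least \<open>i\<close>
  means an entry greater than \<open>i\<close>.\<close>

lemma T_power_image_span:
  assumes sys: "chain_system \<alpha> \<beta> e ch" and fin: "finite {c. \<alpha> c \<noteq> 0}"
  shows "T_power_image i \<alpha> = kv.span ((\<lambda>c. basis_vec (ch c) (e c - 1) :: 'k::field kT_elem) ` {c. i < e c})" (is "_ = kv.span (?h ` _)")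
proof (rule subset_antisym)
  have bij: "bij_betw (\<lambda>c. (ch c, e c)) {c. 0 < e c} {(j, l). 0 < l \<and> l \<le> \<alpha> j}"
    using sys by (simp add: chain_system_def)
  show "T_power_image i \<alpha> \<subseteq> kv.span (?h ` {c. i < e c})"
  proof
    fix v :: "'k kT_elem" assume v: "v \<in> T_power_image i \<alpha>"
    have "v = (\<Sum>p\<in>boxes \<alpha> i. kscale (coeff (v (fst p)) (snd p)) (basis_vec (fst p) (snd p)))"
      using v by (intro nil_mod_expand[OF fin]) (auto simp: T_power_image_iff)
    also have "\<dots> \<in> kv.span (?h ` {c. i < e c})"
    proof (rule kv.span_sum, rule kv.span_scale, rule kv.span_base)
      fix p assume "p \<in> boxes \<alpha> i"
      then obtain j m where p: "p = (j, m)" "i \<le> m" "m < \<alpha> j" by (auto simp: boxes_def)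
      then have "(j, Suc m) \<in> (\<lambda>c. (ch c, e c)) ` {c. 0 < e c}"
        using bij by (auto simp: bij_betw_def)
      then obtain c where "ch c = j" "e c = Suc m" by auto
      then show "basis_vec (fst p) (snd p) \<in> ?h ` {c. i < e c}" using p by (intro image_eqI[of _ _ c]) simp_all
    qed
    finally show "v \<in> kv.span (?h ` {c. i < e c})" .
  qed
  show "kv.span (?h ` {c. i < e c}) \<subseteq> T_power_image i \<alpha>"
  proof (rule kv.span_minimal[OF _ submod_subspace[OF submod_T_power_image]], rule image_subsetI)
    fix c assume "c \<in> {c. i < e c}"
    then have c: "i < e c" by simp
    then have "e c \<le> \<alpha> (ch c)" using bij_betwE[OF bij, rule_format, of c] by auto
    then have "e c - 1 < \<alpha> (ch c)" using c by simp
    then show "(basis_vec (ch c) (e c - 1) :: 'k kT_elem) \<in> T_power_image i \<alpha>"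
      using c by (auto simp: T_power_image_iff basis_vec_carrier coeff_basis_vec)
  qed
qed

text \<open>One family \<open>h\<close> serves all \<open>i\<close>, since its members with
  \<open>i < e c\<close> span T^i N_alpha. It is kept general because the deformed map needs a
  corrected basis rather than the standard one.\<close>

lemma hom_triangular_quotients:
  fixes f :: "'k::field kT_elem \<Rightarrow> 'k kT_elem"
  assumes f: "f \<in> kT_hom \<alpha> \<beta>" and fin: "finite {c. \<beta> c \<noteq> 0}" and e: "\<And>c. e c \<le> \<beta> c"
    and h: "\<And>c. 0 < e c \<Longrightarrow> h c \<in> carrier (nil_mod \<alpha>)"
    and T: "\<And>i. T_power_image i \<alpha> = kv.span (h ` {c. i < e c})"
    and zero: "\<And>c c'. 0 < e c \<Longrightarrow> c' \<noteq> c \<Longrightarrow> \<beta> c' \<le> \<beta> c \<Longrightarrow> f (h c) c' = 0"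
    and diag: "\<And>c. 0 < e c \<Longrightarrow> f (h c) c = monom (a c) (\<beta> c - 1)"
    and nz: "\<And>c. 0 < e c \<Longrightarrow> a c \<noteq> 0"
    and dvd: "\<And>c c'. 0 < e c \<Longrightarrow> monom 1 (\<beta> c - 1) dvd f (h c) c'"
  shows "inj_on f (carrier (nil_mod \<alpha>))"
    and "mod_iso (carrier ring_of_type_algebra) (quot_module (nil_mod \<beta>) (f ` T_power_image i \<alpha>))
       (nil_mod (\<lambda>c. \<beta> c - (if i < e c then 1 else 0)) :: ('k poly, _) module)"
proof -
  have finS: "finite {c. i < e c}" for i
  proof (rule finite_subset[OF _ fin], rule Collect_mono, rule impI)
    fix c assume "i < e c"
    then show "\<beta> c \<noteq> 0" using e[of c] by simp
  qed
  have sum: "f (\<Sum>c\<in>{c. i < e c}. kscale (x c) (h c)) = (\<Sum>c\<in>{c. i < e c}. kscale (x c) (f (h c)))" for x i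
    by (rule kT_hom_sum[OF f]) (auto intro: h)
  have tri: "triangular_submodule \<beta> {c. i < e c} (\<lambda>c. f (h c)) a (f ` T_power_image i \<alpha>)" for i
  proof
    show "f ` T_power_image i \<alpha> = {v. \<exists>x. v = (\<Sum>c\<in>{c. i < e c}. kscale (x c) (f (h c)))}"
      unfolding T span_image_sum[OF finS] sum[symmetric] by blast
    show "submod \<beta> (f ` T_power_image i \<alpha>)" by (rule submod_image[OF f submod_T_power_image])
    fix c assume "c \<in> {c. i < e c}"
    then have c: "0 < e c" by auto
    show "0 < \<beta> c" using e[of c] c by simp
    show "f (h c) \<in> carrier (nil_mod \<beta>)" by (rule kT_homD(1)[OF f h[OF c]])
    show "c' \<noteq> c \<Longrightarrow> \<beta> c' \<le> \<beta> c \<Longrightarrow> f (h c) c' = 0" for c' by (rule zero[OF c])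
    show "f (h c) c = monom (a c) (\<beta> c - 1)" by (rule diag[OF c])
    show "a c \<noteq> 0" by (rule nz[OF c])
    show "monom 1 (\<beta> c - 1) dvd f (h c) c'" for c' by (rule dvd[OF c])
  qed (rule fin)
  show "mod_iso (carrier ring_of_type_algebra) (quot_module (nil_mod \<beta>) (f ` T_power_image i \<alpha>))
       (nil_mod (\<lambda>c. \<beta> c - (if i < e c then 1 else 0)) :: ('k poly, _) module)"
    using triangular_submodule.mod_iso_quot[OF tri[of i]]
    unfolding triangular_submodule.\<delta>_def[OF tri[of i], abs_def] mem_Collect_eq .
  show "inj_on f (carrier (nil_mod \<alpha>))"
  proof (rule inj_onI)
    fix v w :: "'k kT_elem" assume v: "v \<in> carrier (nil_mod \<alpha>)" and w: "w \<in> carrier (nil_mod \<alpha>)" and eq: "f v = f w"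
    have vw: "v - w \<in> carrier (nil_mod \<alpha>)" by (rule nil_mod_diff[OF v w])
    then have "v - w \<in> T_power_image 0 \<alpha>" by (simp only: T_power_image_0)
    then obtain x where x: "v - w = (\<Sum>c\<in>{c. 0 < e c}. kscale (x c) (h c))"
      unfolding T span_image_sum[OF finS] by blast
    have "f v = f (v - w) + f w" using kT_homD(2)[OF f vw w] by simp
    then have "f (v - w) = 0" using eq by simp
    then have "(\<Sum>c\<in>{c. 0 < e c}. kscale (x c) (f (h c))) = 0" by (simp only: x sum)
    then have "x c = 0" if "0 < e c" for c
      using triangular_submodule.b_independent[OF tri[of 0]] that by simp
    then have "v - w = 0" unfolding x by (intro sum.neutral) (simp add: fun_eq_iff)
    then show "v = w" by simp
  qed
qed

section \<open>Maps with a prescribed tableau\<close>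

lemma V_tabI:
  fixes f :: "'k::field kT_elem \<Rightarrow> 'k kT_elem"
  assumes part: "is_partition \<alpha>" "is_partition \<beta>" and strip: "horizontal_strip \<beta> \<gamma>"
    and LR: "\<Gamma> \<in> LR_tableaux \<alpha> \<beta> \<gamma>"
    and f: "f \<in> kT_hom \<alpha> \<beta>" and inj: "inj_on f (carrier (nil_mod \<alpha>))"
    and iso: "\<And>i. mod_iso (carrier ring_of_type_algebra) (quot_module (nil_mod \<beta>) (f ` T_power_image i \<alpha>))
       (nil_mod (\<lambda>c. \<beta> c - (if i < e c then 1 else 0)) :: ('k poly, _) module)"
    and \<sigma>: "bij \<sigma>" "\<And>c. \<beta> (\<sigma> c) = \<beta> c" "\<And>c. entry \<gamma> \<Gamma> c = e (\<sigma> c)"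
  shows "f \<in> V_tab \<alpha> \<beta> \<gamma> \<Gamma>"
proof -
  note E = LR_entry[OF part strip LR]
  have layer: "layer \<beta> \<Gamma> i = (\<lambda>c. \<beta> (\<sigma> c) - (if i < e (\<sigma> c) then 1 else 0))" for i
    by (rule ext) (simp only: E(6) \<sigma>(2,3))
  have iso': "mod_iso (carrier ring_of_type_algebra) (quot_module (nil_mod \<beta>) (f ` T_power_image i \<alpha>))
       (nil_mod (layer \<beta> \<Gamma> i) :: ('k poly, _) module)" for i
    unfolding layer by (rule mod_iso_quot_permute[OF submod_image[OF f submod_T_power_image] \<sigma>(1) iso])
  \<comment> \<open>The cokernel condition of \<open>V_shape\<close> is therefore the case
    \<open>i = 0\<close> of the tableau condition.\<close>
  have "layer \<beta> \<Gamma> 0 = \<gamma>"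
    by (rule ext) (simp only: E(6), simp add: E(2))
  then show ?thesis
    unfolding V_tab_def V_shape_def has_tableau_def
    using f inj iso' iso'[of 0] by (simp only: T_power_image_0 mem_Collect_eq) blast
qed

lemma chain_map_quotients:
  fixes m :: nat
  assumes sys: "chain_system \<alpha> \<beta> e ch" and fin: "finite {c. \<alpha> c \<noteq> 0}" "finite {c. \<beta> c \<noteq> 0}"
    and m: "\<beta> c0 \<le> \<alpha> j0 + m"
  defines "f \<equiv> chain_map \<alpha> \<beta> e ch c0 j0 m (0 :: 'k::field)"
  shows "inj_on f (carrier (nil_mod \<alpha>))"
    and "mod_iso (carrier ring_of_type_algebra) (quot_module (nil_mod \<beta>) (f ` T_power_image i \<alpha>))
       (nil_mod (\<lambda>c. \<beta> c - (if i < e c then 1 else 0)) :: ('k poly, _) module)"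
proof -
  have e: "e c \<le> \<beta> c" for c using sys by (simp add: chain_system_def)
  have n: "e c - 1 < \<alpha> (ch c)" if "0 < e c" for c
  proof -
    have "e c \<le> \<alpha> (ch c)" using sys that by (auto simp: chain_system_def bij_betw_def)
    then show ?thesis using that by simp
  qed
  have val: "f (basis_vec (ch c) (e c - 1)) c' = chain_val \<beta> e ch (ch c) (e c - 1) c'" if "0 < e c" for c c'
    unfolding f_def chain_map_basis_vec[OF sys n[OF that]] by simp
  have f: "f \<in> kT_hom \<alpha> \<beta>" unfolding f_def by (rule chain_map_hom[OF sys m])
  note tri = chain_val_triangular[OF sys]
  have bv: "(basis_vec (ch c) (e c - 1) :: 'k kT_elem) \<in> carrier (nil_mod \<alpha>)" if "0 < e c" for c
    using n[OF that] by (rule basis_vec_carrier)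
  have zero: "f (basis_vec (ch c) (e c - 1)) c' = 0" if "0 < e c" "c' \<noteq> c" "\<beta> c' \<le> \<beta> c" for c c'
    unfolding val[OF that(1)] by (rule tri(2)[OF that])
  have diag: "f (basis_vec (ch c) (e c - 1)) c = monom 1 (\<beta> c - 1)" if "0 < e c" for c
    unfolding val[OF that] by (rule tri(1)[OF that])
  have dvd: "monom 1 (\<beta> c - 1) dvd f (basis_vec (ch c) (e c - 1)) c'" if "0 < e c" for c c'
    unfolding val[OF that] by (rule tri(3)[OF that])
  note Q = hom_triangular_quotients[OF f fin(2) e bv T_power_image_span[OF sys fin(1)] zero diag one_neq_zero dvd]
  show "inj_on f (carrier (nil_mod \<alpha>))" by (rule Q(1))
  show "mod_iso (carrier ring_of_type_algebra) (quot_module (nil_mod \<beta>) (f ` T_power_image i \<alpha>))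
       (nil_mod (\<lambda>c. \<beta> c - (if i < e c then 1 else 0)) :: ('k poly, _) module)" by (rule Q(2))
qed

text \<open>Away from \<open>s = 0\<close> the deformed map has the tableau before the exchange: the socle element of
  column \<open>c\<^sub>2\<close> is obtained as a difference in which the contributions of column \<open>c\<^sub>1\<close> cancel.\<close>

lemma deformed_chain_map_quotients:
  fixes s :: "'k::field" and c\<^sub>1 c\<^sub>2 :: nat
  defines "\<tau> \<equiv> Transposition.transpose c\<^sub>1 c\<^sub>2"
  assumes sys: "chain_system \<alpha> \<beta> e ch" and sys': "chain_system \<alpha> \<beta> (e \<circ> \<tau>) (ch \<circ> \<tau>)"
    and fin: "finite {c. \<alpha> c \<noteq> 0}" "finite {c. \<beta> c \<noteq> 0}"
    and e\<^sub>2: "0 < e c\<^sub>2" and e\<^sub>1: "e c\<^sub>2 < e c\<^sub>1" and \<beta>: "\<beta> c\<^sub>1 < \<beta> c\<^sub>2" and s: "s \<noteq> 0"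
  defines "f \<equiv> chain_map \<alpha> \<beta> (e \<circ> \<tau>) (ch \<circ> \<tau>) c\<^sub>1 (ch c\<^sub>1) (\<beta> c\<^sub>1 - e c\<^sub>1) s"
  shows "f \<in> kT_hom \<alpha> \<beta>" and "inj_on f (carrier (nil_mod \<alpha>))"
    and "mod_iso (carrier ring_of_type_algebra) (quot_module (nil_mod \<beta>) (f ` T_power_image i \<alpha>))
       (nil_mod (\<lambda>c. \<beta> c - (if i < e c then 1 else 0)) :: ('k poly, _) module)"
proof -
  have e: "e c \<le> \<beta> c" for c using sys by (simp add: chain_system_def)
  have e\<alpha>: "e c \<le> \<alpha> (ch c)" if "0 < e c" for c
    using sys that by (auto simp: chain_system_def bij_betw_def)
  have n: "e c - 1 < \<alpha> (ch c)" if "0 < e c" for c using e\<alpha>[OF that] that by simp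
  have pos1: "0 < e c\<^sub>1" using e\<^sub>2 e\<^sub>1 by simp
  have c12: "c\<^sub>1 \<noteq> c\<^sub>2" using e\<^sub>1 by auto
  have \<tau>: "\<tau> c\<^sub>1 = c\<^sub>2" "\<tau> c\<^sub>2 = c\<^sub>1" "\<And>c. c \<noteq> c\<^sub>1 \<Longrightarrow> c \<noteq> c\<^sub>2 \<Longrightarrow> \<tau> c = c"
    by (simp_all add: \<tau>_def Transposition.transpose_def)
  show f: "f \<in> kT_hom \<alpha> \<beta>"
    unfolding f_def by (rule chain_map_hom[OF sys']) (use e\<alpha>[OF pos1] in simp)
  \<comment> \<open>Within one chain the larger entry sits in the longer column, contrary to the
    situation before a box move.\<close>
  have PQ: "ch c\<^sub>1 \<noteq> ch c\<^sub>2"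
  proof
    assume "ch c\<^sub>1 = ch c\<^sub>2"
    then have "\<beta> c\<^sub>2 + e c\<^sub>1 \<le> \<beta> c\<^sub>1 + e c\<^sub>2" using sys e\<^sub>1 e\<^sub>2 unfolding chain_system_def by simp
    then show False using \<beta> e\<^sub>1 by simp
  qed
  let ?bv = "\<lambda>c. basis_vec (ch c) (e c - 1) :: 'k kT_elem"
  let ?cv = "\<lambda>c. chain_val \<beta> (e \<circ> \<tau>) (ch \<circ> \<tau>) (ch c) (e c - 1) :: nat \<Rightarrow> 'k poly"
  \<comment> \<open>The image of the basis vector of \<open>c\<^sub>1\<close> has the term s
    T^(beta_c - 1) in column \<open>c\<^sub>1\<close> and the highest power in
    \<open>c\<^sub>2\<close>; that of \<open>c\<^sub>2\<close> has the highest power in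
    \<open>c\<^sub>1\<close>. In the combination with factor \<open>s\<close> the terms in
    \<open>c\<^sub>1\<close> cancel and the one in \<open>c\<^sub>2\<close> leads.\<close>
  define h where "h c = (if c = c\<^sub>2 then ?bv c\<^sub>1 - kscale s (?bv c\<^sub>2) else ?bv c)" for c
  have bvN: "?bv c \<in> carrier (nil_mod \<alpha>)" if "0 < e c" for c using n[OF that] by (rule basis_vec_carrier)
  have val: "f (?bv c) c' = ?cv c c' + (if c' = c\<^sub>1 \<and> ch c = ch c\<^sub>1 \<and> e c - 1 + (\<beta> c\<^sub>1 - e c\<^sub>1) < \<beta> c\<^sub>1
      then monom s (e c - 1 + (\<beta> c\<^sub>1 - e c\<^sub>1)) else 0)" if "0 < e c" for c c'
    unfolding f_def by (rule chain_map_basis_vec[OF sys' n[OF that]])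
  have val_other: "f (?bv c) c' = ?cv c c'" if "0 < e c" "c' \<noteq> c\<^sub>1 \<or> ch c \<noteq> ch c\<^sub>1" for c c'
    using val[OF that(1)] that(2) by auto
  have inj: "c = c'" if "ch c = ch c'" "e c = e c'" "0 < e c" for c c'
    using sys that by (auto simp: chain_system_def bij_betw_def inj_on_def)
  have hN: "h c \<in> carrier (nil_mod \<alpha>)" if "0 < e c" for c
    unfolding h_def using bvN that pos1 e\<^sub>2
    by (auto intro!: nil_mod_diff kv.subspace_scale[OF subspace_nil_mod])
  \<comment> \<open>The correction respects the filtration, because
    \<open>e c\<^sub>2 < e c\<^sub>1\<close> puts \<open>c\<^sub>1\<close> into every index set
    containing \<open>c\<^sub>2\<close>; it is reversible because \<open>s\<close> is
    invertible.\<close>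
  have span: "kv.span (h ` {c. i < e c}) = kv.span (?bv ` {c. i < e c})" for i
  proof (cases "i < e c\<^sub>2")
    case False
    then have "h ` {c. i < e c} = ?bv ` {c. i < e c}" by (intro image_cong) (auto simp: h_def)
    then show ?thesis by (rule arg_cong)
  next
    case True
    then have in12: "c\<^sub>1 \<in> {c. i < e c}" "c\<^sub>2 \<in> {c. i < e c}" using e\<^sub>1 by auto
    show ?thesis
      unfolding kv.span_eq
    proof (intro conjI image_subsetI)
      fix c assume c: "c \<in> {c. i < e c}"
      have bv: "?bv c \<in> kv.span (?bv ` {c. i < e c})" if "c \<in> {c. i < e c}" for c
        by (rule kv.span_base, rule imageI, rule that)
      show "h c \<in> kv.span (?bv ` {c. i < e c})"
        unfolding h_def using bv[OF c] bv[OF in12(1)] bv[OF in12(2)]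
        by (simp only: split: if_split) (blast intro: kv.span_diff kv.span_scale)
      have hh: "h c \<in> kv.span (h ` {c. i < e c})" if "c \<in> {c. i < e c}" for c
        by (rule kv.span_base, rule imageI, rule that)
      show "?bv c \<in> kv.span (h ` {c. i < e c})"
      proof (cases "c = c\<^sub>2")
        case True
        have "?bv c\<^sub>2 = kscale (inverse s) (h c\<^sub>1 - h c\<^sub>2)"
          using s c12 by (simp add: h_def fun_eq_iff)
        then show ?thesis using hh[OF in12(1)] hh[OF in12(2)] True
          by (simp only: kv.span_scale kv.span_diff)
      next
        case False
        then show ?thesis using hh[OF c] by (simp add: h_def)
      qed
    qed
  qed
  define a where "a c = (if c = c\<^sub>1 then s else 1)" for c
  have at1: "?cv c\<^sub>1 c\<^sub>1 = 0" "?cv c\<^sub>2 c\<^sub>2 = 0"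
    using PQ by (auto simp: chain_val_def \<tau>)
  have at1': "?cv c\<^sub>2 c\<^sub>1 = monom 1 (\<beta> c\<^sub>1 - 1)"
    using e\<^sub>2 chain_val_triangular(1)[OF sys', of c\<^sub>1, where ?'k = 'k] by (simp add: \<tau>)
  have comp2: "(e \<circ> \<tau>) c\<^sub>2 = e c\<^sub>1" "(ch \<circ> \<tau>) c\<^sub>2 = ch c\<^sub>1" by (simp_all add: \<tau>)
  note tri2 = chain_val_triangular[OF sys', of c\<^sub>2, where ?'k = 'k, unfolded comp2, OF pos1]
  have key: "f (h c) c = monom (a c) (\<beta> c - 1) \<and>
    (\<forall>c'. c' \<noteq> c \<longrightarrow> (\<beta> c' \<le> \<beta> c \<longrightarrow> f (h c) c' = 0) \<and> monom 1 (\<beta> c - 1) dvd f (h c) c')"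
    if c: "0 < e c" for c
  proof -
    consider "c = c\<^sub>1" | "c = c\<^sub>2" | "c \<noteq> c\<^sub>1" "c \<noteq> c\<^sub>2" by blast
    then show ?thesis
    proof cases
      case 1
      have v: "f (h c) c\<^sub>1 = monom s (\<beta> c\<^sub>1 - 1)"
        unfolding 1 h_def if_not_P[OF c12] val[OF pos1] at1 using pos1 e[of c\<^sub>1] by simp
      have o: "f (h c) c' = ?cv c\<^sub>1 c'" if "c' \<noteq> c\<^sub>1" for c'
        using c12 that val_other[OF pos1] unfolding 1 h_def by simp
      \<comment> \<open>Away from \<open>c\<^sub>1\<close> the image is the undeformed one, which is
        triangular at \<open>c\<^sub>2\<close>; this column is longer than
        \<open>c\<^sub>1\<close>.\<close>
      have d: "monom 1 (\<beta> c\<^sub>1 - 1) dvd ?cv c\<^sub>1 c'" for c'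
        by (rule dvd_trans[OF _ tri2(3)]) (use \<beta> in \<open>simp add: monom_1_dvd_iff'\<close>)
      have z: "?cv c\<^sub>1 c' = 0" if "c' \<noteq> c\<^sub>1" "\<beta> c' \<le> \<beta> c\<^sub>1" for c'
        by (rule tri2(2)) (use that \<beta> in auto)
      show ?thesis unfolding 1 using v o d z by (simp add: 1 a_def)
    next
      case 2
      have fh: "f (h c\<^sub>2) = f (?bv c\<^sub>1) - kscale s (f (?bv c\<^sub>2))"
      proof -
        have N: "?bv c\<^sub>1 \<in> carrier (nil_mod \<alpha>)" "kscale s (?bv c\<^sub>2) \<in> carrier (nil_mod \<alpha>)"
          using bvN[OF pos1] bvN[OF e\<^sub>2] by (auto intro: kv.subspace_scale[OF subspace_nil_mod])
        have "f (?bv c\<^sub>1) = f (h c\<^sub>2) + f (kscale s (?bv c\<^sub>2))"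
          using kT_homD(2)[OF f hN[OF e\<^sub>2] N(2)] by (simp add: h_def)
        then show ?thesis using kT_homD(4)[OF f bvN[OF e\<^sub>2]] by simp
      qed
      have v1: "f (h c\<^sub>2) c\<^sub>1 = 0"
      proof -
        have "f (h c\<^sub>2) c\<^sub>1 = f (?bv c\<^sub>1) c\<^sub>1 - smult s (f (?bv c\<^sub>2) c\<^sub>1)" by (simp only: fh fun_diff_def kscale_apply)
        then show ?thesis
          unfolding val[OF pos1] val[OF e\<^sub>2] at1 at1' using pos1 e[of c\<^sub>1] PQ by (simp add: smult_monom)
      qed
      have o: "f (h c\<^sub>2) c' = ?cv c\<^sub>1 c' - smult s (?cv c\<^sub>2 c')" if "c' \<noteq> c\<^sub>1" for c'
        by (simp only: fh fun_diff_def kscale_apply val_other[OF pos1 disjI1[OF that]] val_other[OF e\<^sub>2 disjI1[OF that]])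
      have v2: "f (h c\<^sub>2) c\<^sub>2 = monom 1 (\<beta> c\<^sub>2 - 1)"
        unfolding o[OF c12[symmetric]] at1 tri2(1) by simp
      note tri = chain_val_triangular[OF sys e\<^sub>2, where ?'k = 'k]
      \<comment> \<open>For this chain the exchanged system bounds exponents only by the length of
        \<open>c\<^sub>1\<close>. The stronger bound by \<open>\<beta> c\<^sub>2\<close> comes from
        the original system, which agrees with it away from the two columns.\<close>
      have cv: "?cv c\<^sub>2 c' = chain_val \<beta> e ch (ch c\<^sub>2) (e c\<^sub>2 - 1) c'" if "c' \<noteq> c\<^sub>1" "c' \<noteq> c\<^sub>2" for c'
        using that by (simp add: chain_val_def \<tau>)
      have "f (h c\<^sub>2) c' = 0" if "c' \<noteq> c\<^sub>2" "\<beta> c' \<le> \<beta> c\<^sub>2" for c'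
      proof (cases "c' = c\<^sub>1")
        case False
        show ?thesis
          unfolding o[OF False] cv[OF False that(1)] tri(2)[OF that] tri2(2)[OF that] by simp
      qed (simp add: v1)
      moreover have "monom 1 (\<beta> c\<^sub>2 - 1) dvd f (h c\<^sub>2) c'" if "c' \<noteq> c\<^sub>2" for c'
      proof (cases "c' = c\<^sub>1")
        case False
        show ?thesis
          unfolding o[OF False] cv[OF False that] by (intro dvd_diff dvd_smult tri(3) tri2(3))
      qed (simp add: v1)
      ultimately show ?thesis unfolding 2 using v2 c12 by (simp add: a_def)
    next
      case 3
      have \<tau>c: "\<tau> c = c" by (rule \<tau>(3)[OF 3])
      have compc: "(e \<circ> \<tau>) c = e c" "(ch \<circ> \<tau>) c = ch c" by (simp_all add: \<tau>c)
      note tri' = chain_val_triangular[OF sys', of c, where ?'k = 'k, unfolded compc, OF c]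
      have v: "f (h c) c = monom 1 (\<beta> c - 1)"
        using 3 val_other[OF c, of c] tri'(1) by (simp add: h_def)
      \<comment> \<open>Members of the chain of \<open>c\<^sub>1\<close> with smaller entries also
        feel the extra matrix entry. Their new term lies in the longer column
        \<open>c\<^sub>1\<close> with sufficient exponent, by the chain condition of the original
        system.\<close>
      have B: "\<beta> c < \<beta> c\<^sub>1 \<and> \<beta> c - 1 \<le> e c - 1 + (\<beta> c\<^sub>1 - e c\<^sub>1)" if "ch c = ch c\<^sub>1" "e c - 1 + (\<beta> c\<^sub>1 - e c\<^sub>1) < \<beta> c\<^sub>1"
      proof -
        have "e c \<le> e c\<^sub>1" using that(2) e[of c\<^sub>1] c by linarith
        moreover have "e c \<noteq> e c\<^sub>1" using inj[OF that(1) _ c] 3 by blast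
        ultimately have lt: "e c < e c\<^sub>1" by simp
        then have "\<beta> c + e c\<^sub>1 \<le> \<beta> c\<^sub>1 + e c" using sys that(1) c unfolding chain_system_def by simp
        then show ?thesis using lt e[of c\<^sub>1] e[of c] c by linarith
      qed
      have "f (h c) c' = 0" if "c' \<noteq> c" "\<beta> c' \<le> \<beta> c" for c'
        using val[OF c, of c'] tri'(2)[OF that] B that(2) 3 by (auto simp: h_def)
      moreover have "monom 1 (\<beta> c - 1) dvd f (h c) c'" for c'
      proof -
        have "monom 1 (\<beta> c - 1) dvd (if c' = c\<^sub>1 \<and> ch c = ch c\<^sub>1 \<and> e c - 1 + (\<beta> c\<^sub>1 - e c\<^sub>1) < \<beta> c\<^sub>1
            then monom s (e c - 1 + (\<beta> c\<^sub>1 - e c\<^sub>1)) else 0)"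
          using B by (auto simp: monom_1_dvd_iff')
        then show ?thesis using 3 val[OF c, of c'] tri'(3) by (simp only: h_def if_False dvd_add)
      qed
      ultimately show ?thesis using v 3 by (simp add: a_def)
    qed
  qed
  have T: "T_power_image i \<alpha> = kv.span (h ` {c. i < e c})" for i
    unfolding span by (rule T_power_image_span[OF sys fin(1)])
  have nz: "a c \<noteq> 0" for c using s by (simp add: a_def)
  have diag: "f (h c) c = monom (a c) (\<beta> c - 1)" if "0 < e c" for c using key[OF that] by blast
  have zero: "f (h c) c' = 0" if "0 < e c" "c' \<noteq> c" "\<beta> c' \<le> \<beta> c" for c c'
    using key[OF that(1)] that(2,3) by blast
  have dvd: "monom 1 (\<beta> c - 1) dvd f (h c) c'" if c: "0 < e c" for c c'
  proof (cases "c' = c")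
    case True
    have "monom 1 (\<beta> c - 1) dvd monom (a c) (\<beta> c - 1)" by (simp add: monom_1_dvd_iff')
    then show ?thesis unfolding True diag[OF c] .
  qed (use key[OF c] in blast)
  note Q = hom_triangular_quotients[OF f fin(2) e hN T zero diag nz dvd]
  show "inj_on f (carrier (nil_mod \<alpha>))" by (rule Q(1))
  show "mod_iso (carrier ring_of_type_algebra) (quot_module (nil_mod \<beta>) (f ` T_power_image i \<alpha>))
       (nil_mod (\<lambda>c. \<beta> c - (if i < e c then 1 else 0)) :: ('k poly, _) module)" by (rule Q(2))
qed

section \<open>Degeneration along a line\<close>

lemma infinite_alg_closed: "infinite (UNIV :: 'k::alg_closed_field set)"
proof
  assume fin: "finite (UNIV :: 'k set)"
  \<comment> \<open>Over a finite field, one plus the product of all X - a would be a nonconstant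
    polynomial without roots.\<close>
  define p where "p = (\<Prod>a\<in>(UNIV :: 'k set). [:- a, 1:])"
  have "degree p = card (UNIV :: 'k set)"
    unfolding p_def by (subst degree_prod_eq_sum_degree) auto
  then have "degree (p + 1) = card (UNIV :: 'k set)"
    using fin by (subst degree_add_eq_left) (simp_all add: card_gt_0_iff)
  then have "degree (p + 1) > 0" using fin by (simp add: card_gt_0_iff)
  then obtain x where "poly (p + 1) x = 0" using alg_closed_imp_poly_has_root by blast
  moreover have "poly p x = 0" using fin unfolding p_def poly_prod by (intro prod_zero) auto
  ultimately show False by simp
qed

lemma poly_funs_curve:
  fixes F :: "'k::field \<Rightarrow> 'x"
  assumes "p \<in> poly_funs C" and C: "\<And>c. c \<in> C \<Longrightarrow> \<exists>q. \<forall>t. c (F t) = poly q t"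
  shows "\<exists>q. \<forall>t. p (F t) = poly q t"
  using assms(1)
proof induction
  case (const a)
  show ?case by (rule exI[of _ "[:a:]"]) simp
next
  case (coord c)
  then show ?case by (rule C)
next
  case (add p q)
  then obtain r s where "\<And>t. p (F t) = poly r t" "\<And>t. q (F t) = poly s t" by blast
  then show ?case by (intro exI[of _ "r + s"]) simp
next
  case (mult p q)
  then obtain r s where "\<And>t. p (F t) = poly r t" "\<And>t. q (F t) = poly s t" by blast
  then show ?case by (intro exI[of _ "r * s"]) simp
qed

text \<open>A polynomial function not vanishing at \<open>F 0\<close> restricts to a nonzero
  polynomial in the parameter. Its roots and 0 form a finite set, so every neighbourhood of
  \<open>F 0\<close> contains some \<open>F t\<close> with \<open>t \<noteq> 0\<close>.\<close>

lemma boundary_step_curve: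
  fixes F :: "'k::alg_closed_field \<Rightarrow> 'k kT_elem \<Rightarrow> 'k kT_elem"
  assumes LR: "\<Gamma> \<in> LR_tableaux \<alpha> \<beta> \<gamma>" "\<Gamma>' \<in> LR_tableaux \<alpha> \<beta> \<gamma>"
    and F: "\<And>t. t \<noteq> 0 \<Longrightarrow> F t \<in> V_tab \<alpha> \<beta> \<gamma> \<Gamma>" "F 0 \<in> V_tab \<alpha> \<beta> \<gamma> \<Gamma>'"
    and coords: "\<And>c. c \<in> hom_coords \<alpha> \<beta> \<Longrightarrow> \<exists>q. \<forall>t. c (F t) = poly q t"
  shows "boundary_step TYPE('k) \<alpha> \<beta> \<gamma> \<Gamma> \<Gamma>'"
proof -
  let ?E = "k_hom \<alpha> \<beta> :: ('k kT_elem \<Rightarrow> 'k kT_elem) set"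
  have V: "f \<in> ?E \<and> f \<in> V_shape \<alpha> \<beta> \<gamma>" if "f \<in> V_tab \<alpha> \<beta> \<gamma> \<Delta>" for f \<Delta>
    using that kT_hom_subset_k_hom by (auto simp: V_tab_def V_shape_def)
  have top: "topspace (V_top \<alpha> \<beta> \<gamma>) = ?E \<inter> V_shape \<alpha> \<beta> \<gamma>"
    by (simp add: V_top_def topspace_zariski)
  have "F 0 \<in> V_top \<alpha> \<beta> \<gamma> closure_of V_tab \<alpha> \<beta> \<gamma> \<Gamma>"
    unfolding in_closure_of top
  proof (intro conjI allI impI)
    show "F 0 \<in> ?E \<inter> V_shape \<alpha> \<beta> \<gamma>" using V[OF F(2)] by blast
    fix T assume T: "F 0 \<in> T \<and> openin (V_top \<alpha> \<beta> \<gamma>) T"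
    then obtain W where W: "zariski_open ?E (hom_coords \<alpha> \<beta>) W" "T = W \<inter> V_shape \<alpha> \<beta> \<gamma>"
      by (auto simp: V_top_def openin_subtopology openin_zariski)
    then obtain P where P: "P \<subseteq> poly_funs (hom_coords \<alpha> \<beta>)" "W = ?E - zero_locus ?E P"
      by (auto simp: zariski_open_def)
    have "F 0 \<in> W" using T W by blast
    then obtain p where p: "p \<in> P" "p (F 0) \<noteq> 0" unfolding P(2) zero_locus_def by blast
    obtain q where q: "\<And>t. p (F t) = poly q t"
      using poly_funs_curve[of p "hom_coords \<alpha> \<beta>" F] p(1) P(1) coords by blast
    have "q \<noteq> 0" using q[of 0] p(2) by auto
    then have "finite ({t. poly q t = 0} \<union> {0})" using poly_roots_finite[of q] by simp
    then obtain t where t: "t \<notin> {t. poly q t = 0} \<union> {0}"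
      using infinite_alg_closed[where ?'k = 'k] ex_new_if_finite by blast
    then have "F t \<in> V_tab \<alpha> \<beta> \<gamma> \<Gamma>" "p (F t) \<noteq> 0" using F(1)[of t] q[of t] by auto
    moreover from this have "F t \<in> T"
      using V[of "F t" \<Gamma>] p(1) unfolding W(2) P(2) zero_locus_def by blast
    ultimately show "\<exists>y. y \<in> V_tab \<alpha> \<beta> \<gamma> \<Gamma> \<and> y \<in> T" by blast
  qed
  then show ?thesis unfolding boundary_step_def using LR F(2) by blast
qed

text \<open>The deformation parameter enters through a single matrix entry, so every coordinate is
  affine in it.\<close>

lemma chain_map_coord:
  assumes "g \<in> hom_coords \<alpha> \<beta>"
  shows "\<exists>q. \<forall>t. g (chain_map \<alpha> \<beta> e ch c0 j0 m t) = poly q (t :: 'k::field)"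
proof -
  obtain i j l n where g: "g = (\<lambda>f. coeff (f (basis_vec i j) l) n)" "j < \<alpha> i"
    using assms by (auto simp: hom_coords_def)
  have car: "(basis_vec i j :: 'k kT_elem) \<in> carrier (nil_mod \<alpha>)" using g(2) by (rule basis_vec_carrier)
  define A B :: 'k where
    "A = coeff ((if 0 < e l then basis_vec i j (ch l) * monom 1 (\<beta> l - e l) else 0) mod monom 1 (\<beta> l)) n"
    and "B = coeff ((if l = c0 then basis_vec i j j0 * monom 1 m else 0) mod monom 1 (\<beta> l)) n"
  have scale: "(if l = c0 then basis_vec i j j0 * monom t m else 0) = smult t (if l = c0 then basis_vec i j j0 * monom 1 m else 0)" for t :: 'k
  proof (cases "l = c0")
    case True
    then show ?thesis by (simp only: simp_thms if_True mult_smult_right[symmetric] smult_monom mult_1_right)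
  qed simp
  have "g (chain_map \<alpha> \<beta> e ch c0 j0 m t) = A + t * B" for t
    unfolding g(1) A_def B_def chain_map_def restrict_apply'[OF car] scale[of t] poly_mod_add_left
    by (simp only: coeff_add mod_smult_left coeff_smult)
  then show ?thesis by (intro exI[of _ "[:A, B:]"]) (simp add: mult.commute)
qed

lemma box_move_boundary_step:
  assumes part: "is_partition \<alpha>" "is_partition \<beta>" and strip: "horizontal_strip \<beta> \<gamma>"
    and move: "box_move \<alpha> \<beta> \<gamma> \<Gamma> \<Gamma>'"
  shows "boundary_step TYPE('k::alg_closed_field) \<alpha> \<beta> \<gamma> \<Gamma> \<Gamma>'"
proof -
  have LR: "\<Gamma> \<in> LR_tableaux \<alpha> \<beta> \<gamma>" "\<Gamma>' \<in> LR_tableaux \<alpha> \<beta> \<gamma>" using move by (auto simp: box_move_def)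
  have fin: "finite {c. \<alpha> c \<noteq> 0}" "finite {c. \<beta> c \<noteq> 0}" using part by (auto simp: is_partition_def)
  let ?e = "entry \<gamma> \<Gamma>"
  obtain c\<^sub>1 c\<^sub>2 \<sigma> ch where sys: "chain_system \<alpha> \<beta> ?e ch"
    "chain_system \<alpha> \<beta> (?e \<circ> Transposition.transpose c\<^sub>1 c\<^sub>2) (ch \<circ> Transposition.transpose c\<^sub>1 c\<^sub>2)"
    and c: "0 < ?e c\<^sub>2" "?e c\<^sub>2 < ?e c\<^sub>1" "\<beta> c\<^sub>1 < \<beta> c\<^sub>2"
    and \<sigma>: "bij \<sigma>" "\<And>c. \<beta> (\<sigma> c) = \<beta> c" "\<And>c. entry \<gamma> \<Gamma>' c = ?e (Transposition.transpose c\<^sub>1 c\<^sub>2 (\<sigma> c))"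
    by (rule box_move_chain_system[OF part strip move], rule that)
  \<comment> \<open>At parameter 0 this is the pole sum of the exchanged chains. The extra entry is
    the coefficient by which the pole sum of \<open>\<Gamma>\<close> sends generator
    \<open>ch c\<^sub>1\<close> into column \<open>c\<^sub>1\<close>.\<close>
  define F :: "'k \<Rightarrow> 'k kT_elem \<Rightarrow> 'k kT_elem" where
    "F = chain_map \<alpha> \<beta> (?e \<circ> Transposition.transpose c\<^sub>1 c\<^sub>2) (ch \<circ> Transposition.transpose c\<^sub>1 c\<^sub>2) c\<^sub>1 (ch c\<^sub>1) (\<beta> c\<^sub>1 - ?e c\<^sub>1)"
  have "?e c\<^sub>1 \<le> \<alpha> (ch c\<^sub>1)" using sys(1) c by (auto simp: chain_system_def bij_betw_def)
  then have m: "\<beta> c\<^sub>1 \<le> \<alpha> (ch c\<^sub>1) + (\<beta> c\<^sub>1 - ?e c\<^sub>1)" by simp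
  show ?thesis
  proof (rule boundary_step_curve[OF LR])
    fix t :: 'k assume "t \<noteq> 0"
    note D = deformed_chain_map_quotients[OF sys fin c this, folded F_def]
    show "F t \<in> V_tab \<alpha> \<beta> \<gamma> \<Gamma>"
      by (rule V_tabI[OF part strip LR(1) D, where \<sigma> = "\<lambda>c. c"]) (simp_all add: bij_def)
  next
    note D = chain_map_quotients[OF sys(2) fin m, where ?'k = 'k, folded F_def]
    show "F 0 \<in> V_tab \<alpha> \<beta> \<gamma> \<Gamma>'"
      by (rule V_tabI[OF part strip LR(2) _ D \<sigma>(1,2)])
        (simp_all add: F_def chain_map_hom[OF sys(2) m] \<sigma>(3))
  next
    fix g :: "('k kT_elem \<Rightarrow> 'k kT_elem) \<Rightarrow> 'k" assume "g \<in> hom_coords \<alpha> \<beta>"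
    then show "\<exists>q. \<forall>t. g (F t) = poly q t" unfolding F_def by (rule chain_map_coord)
  qed
qed

section \<open>Reflexivity and conclusion\<close>

lemma V_tab_nonempty:
  assumes part: "is_partition \<alpha>" "is_partition \<beta>" and strip: "horizontal_strip \<beta> \<gamma>"
    and LR: "\<Gamma> \<in> LR_tableaux \<alpha> \<beta> \<gamma>"
  shows "(V_tab \<alpha> \<beta> \<gamma> \<Gamma> :: ('k::field kT_elem \<Rightarrow> 'k kT_elem) set) \<noteq> {}"
proof -
  have fin: "finite {c. \<alpha> c \<noteq> 0}" "finite {c. \<beta> c \<noteq> 0}" using part by (auto simp: is_partition_def)
  obtain ch where sys: "chain_system \<alpha> \<beta> (entry \<gamma> \<Gamma>) ch"
    using LR_chain_system[OF part strip LR] by blast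
  \<comment> \<open>With parameter 0 the extra entry vanishes; the exponent \<open>\<beta> 0\<close>
    is chosen to meet the bound in \<open>chain_map_hom\<close>.\<close>
  have m: "\<beta> 0 \<le> \<alpha> 0 + \<beta> 0" by simp
  have "chain_map \<alpha> \<beta> (entry \<gamma> \<Gamma>) ch 0 0 (\<beta> 0) (0 :: 'k) \<in> V_tab \<alpha> \<beta> \<gamma> \<Gamma>"
    by (rule V_tabI[OF part strip LR chain_map_hom[OF sys m] chain_map_quotients[OF sys fin m], where \<sigma> = "\<lambda>c. c"])
      (simp_all add: bij_def)
  then show ?thesis by blast
qed

text \<open>\<open>le_boundary\<close> is a transitive closure without built-in reflexivity, so the
  empty sequence of box moves is realised by a step from a tableau to itself, for which a point of
  its variety is required.\<close>

lemma boundary_step_refl: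
  assumes LR: "\<Gamma> \<in> LR_tableaux \<alpha> \<beta> \<gamma>"
    and ne: "(V_tab \<alpha> \<beta> \<gamma> \<Gamma> :: ('k::field kT_elem \<Rightarrow> 'k kT_elem) set) \<noteq> {}"
  shows "boundary_step TYPE('k) \<alpha> \<beta> \<gamma> \<Gamma> \<Gamma>"
proof -
  have "(V_tab \<alpha> \<beta> \<gamma> \<Gamma> :: ('k kT_elem \<Rightarrow> 'k kT_elem) set) \<subseteq> topspace (V_top \<alpha> \<beta> \<gamma>)"
    using kT_hom_subset_k_hom by (auto simp: V_top_def topspace_zariski V_tab_def V_shape_def)
  then have "(V_tab \<alpha> \<beta> \<gamma> \<Gamma> :: ('k kT_elem \<Rightarrow> 'k kT_elem) set) \<subseteq> V_top \<alpha> \<beta> \<gamma> closure_of V_tab \<alpha> \<beta> \<gamma> \<Gamma>"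
    by (rule closure_of_subset)
  then show ?thesis unfolding boundary_step_def using LR ne by blast
qed

lemma le_box_le_boundary:
  assumes part: "is_partition \<alpha>" "is_partition \<beta>" and strip: "horizontal_strip \<beta> \<gamma>"
    and LR: "\<Gamma> \<in> LR_tableaux \<alpha> \<beta> \<gamma>" and box: "le_box \<alpha> \<beta> \<gamma> \<Gamma> \<Gamma>'"
  shows "le_boundary TYPE('k::alg_closed_field) \<alpha> \<beta> \<gamma> \<Gamma> \<Gamma>'"
  using box unfolding le_box_def
proof (induction rule: rtranclp_induct)
  case base
  show ?case unfolding le_boundary_def
    by (rule tranclp.r_into_trancl, rule boundary_step_refl[OF LR V_tab_nonempty[OF part strip LR]])
next
  case (step \<Delta> \<Delta>')
  have "boundary_step TYPE('k) \<alpha> \<beta> \<gamma> \<Delta> \<Delta>'"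
    by (rule box_move_boundary_step[OF part strip step.hyps(2)])
  with step.IH show ?case unfolding le_boundary_def
    by (rule tranclp.trancl_into_trancl[where r = "boundary_step TYPE('k) \<alpha> \<beta> \<gamma>"])
qed

theorem theorem1p3:
  fixes \<alpha> \<beta> \<gamma> :: "nat \<Rightarrow> nat" and \<Gamma> \<Gamma>' :: "nat \<times> nat \<Rightarrow> nat"
  assumes "is_partition \<alpha>" and "is_partition \<beta>" and "is_partition \<gamma>"
    and "\<Gamma> \<in> LR_tableaux \<alpha> \<beta> \<gamma>" and "\<Gamma>' \<in> LR_tableaux \<alpha> \<beta> \<gamma>"
  shows "(le_boundary TYPE('k::alg_closed_field) \<alpha> \<beta> \<gamma> \<Gamma> \<Gamma>' \<longrightarrow> le_dom \<alpha> \<beta> \<Gamma> \<Gamma>') \<and>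
         (horizontal_strip \<beta> \<gamma> \<longrightarrow> le_box \<alpha> \<beta> \<gamma> \<Gamma> \<Gamma>' \<longrightarrow>
            le_boundary TYPE('k) \<alpha> \<beta> \<gamma> \<Gamma> \<Gamma>')"
  using le_boundary_le_dom[OF assms(1,2)] le_box_le_boundary[OF assms(1,2) _ assms(4)] by blast

end
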